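(* Let $\mathcal U$ be a variety with a difference term and $(Q,E^{\tau})$ regular datum in $\mathcal U$. Assume $F_{\mathcal U}/\theta\cong Q$ is a free presentation in $\mathcal U$ ($F_{\mathcal U}$ a free algebra in $\mathcal U$, $\theta\in\mathrm{Con}\,F_{\mathcal U}$) such that $F_{\mathcal U}/[\theta,1]$ has an idempotent element. Then there are isomorphisms of abelian groups $$H^{2}_{\mathcal U}(Q,E^{\tau})\cong\mathrm{Hom}\Big(\kappa_{\theta/[\theta,1]\,1}\big(F_{\mathcal U}/[\theta,1]\,\big((\theta\wedge[1,1])/[\theta,1]\big)\big),E^{\tau}\Big)\cong\mathrm{Hom}\Big(I_{(\theta\wedge[1,1])/[\theta,1]},E^{\tau}\Big).$$
   Context: Conventions. Algebras are universal algebras in a signature $\tau$; $[\alpha,\beta]$ is the term-condition commutator of congruences; $0,1$ are the least and greatest congruences. A variety $\mathcal U$ has a difference term if there is a ternary term $m$ with $m(x,x,y)=y$ in $\mathcal U$ and $(x,m(x,y,y))\in[\alpha,\alpha]$ whenever $A\in\mathcal U$ and $(x,y)\in\alpha\in\mathrm{Con}\,A$; it is assumed throughout that $m$ is a fundamental operation symbol of $\tau$. A congruence $\alpha$ is central if $[\alpha,1]=0$. An element $u$ is idempotent if $f(u,\ldots,u)=u$ for all $f\in\tau$. Kernel algebras and datum. A kernel algebra $B^{\tau}$ is a $\tau$-algebra on the universe of a unital module $B$ over a ring $R$ with $1$ in which each $f\in\tau$ is a module term $f^{B}(x_1,\ldots,x_n)=r_1x_1+\cdots+r_nx_n$ $(r_i\in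 R)$ and $m^{B}(x,y,z)=x-y+z$. Central datum $(Q,B^{\tau})$ in $\mathcal U$ is a kernel algebra $B^{\tau}\in\mathcal U$ and an algebra $Q\in\mathcal U$. A kernel algebra $E^{\tau}\in\mathcal U$ is regular in $\mathcal U$ if (RD1) for kernel algebras $B^{\tau}\le C^{\tau}$ in $\mathcal U$ every homomorphism $B^{\tau}\to E^{\tau}$ extends to a homomorphism $C^{\tau}\to E^{\tau}$; (RD2) for every kernel algebra $B^{\tau}\in\mathcal U$, $\alpha\in\mathrm{Con}\,B^{\tau}$ and $(a,b)\notin\alpha$ there is a homomorphism $\phi:B^{\tau}\to E^{\tau}$ with $\alpha\le\ker\phi$, $(a,b)\notin\ker\phi$. Regular datum is central datum $(Q,E^{\tau})$ with $E^{\tau}$ regular. $\mathrm{Hom}(B^{\tau},E^{\tau})$, for kernel algebras, is the abelian group of $\tau$-homomorphisms preserving $0$. Cocycles. A 2-cocycle for $(Q,B^{\tau})$ is a family $T=\{T_f:Q^{\mathrm{ar} f}\to B\}_{f\in\tau}$. For a term $t$ define $t^{\partial,T}$ by $x^{\partial,T}=0$ for a variable and $f(t_1,\ldots,t_n)^{\partial,T}=f^{B}(t_1^{\partial,T},\ldots,t_n^{\partial,T})+T_f(t_1^{Q},\ldots,t_n^{Q})$. $T$ is $\mathcal U$-compatible if $t^{\partial,T}=g^{\partial,T}$ under all evaluations in $Q$ for every identity $t=g$ of $\mathcal U$. A 2-coboundary is a family $G_f(\vec x)=f^{B}(h(\vec x))-h(f^{Q}(\vec x))$ for some function $h:Q\to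 B$. Under pointwise addition, $H^{2}_{\mathcal U}(Q,B^{\tau})$ is the group of $\mathcal U$-compatible 2-cocycles modulo 2-coboundaries. Kernel algebra of a central congruence. For an algebra $A$ and $\alpha\in\mathrm{Con}\,A$, $A(\alpha)$ is $\alpha$ viewed as a subalgebra of $A\times A$, and $\Delta_{\alpha 1}$ is the congruence of $A(\alpha)$ generated by all pairs $\langle(u,u),(v,v)\rangle$, $u,v\in A$; $\kappa_{\alpha1}:A(\alpha)\to A(\alpha)/\Delta_{\alpha1}$ is the quotient map. If $A\in\mathcal U$ and $\alpha$ is central, $A(\alpha)/\Delta_{\alpha1}$ is abelian, the diagonal is a single $\Delta_{\alpha1}$-class $\hat\delta$ which is an idempotent element, and $A(\alpha)/\Delta_{\alpha1}$ is a kernel algebra with zero $\hat\delta$ and addition $x+y=m(x,\hat\delta,y)$. Here $A=F_{\mathcal U}/[\theta,1]$, $\alpha=\theta/[\theta,1]$ is central, and for $\gamma\le\alpha$, $\kappa_{\alpha1}(A(\gamma))$ is the image of the subalgebra $A(\gamma)\le A(\alpha)$, with zero $\hat\delta$. For an idempotent $u\in A$ and $\gamma\in\mathrm{Con}\,A$, $I_\gamma$ is the $\gamma$-class of $u$, a subalgebra of $A$, considered with zero $u$. *)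

theory Defs
  imports "HOL-Algebra.Coset" "HOL-Algebra.Module"
begin

section \<open>Universal algebra\<close>

text \<open>The operation symbols are all elements of a type \<open>'f\<close>, with arities given by
  \<open>ar\<close>. An operation takes its arguments as a list; only its values on lists of the right
  length over the universe matter.\<close>

datatype ('f, 'v) trm = Var 'v | App 'f "('f, 'v) trm list"

record ('f, 'a) alg =
  univ :: "'a set"
  ops :: "'f \<Rightarrow> 'a list \<Rightarrow> 'a"

definition tuples :: "'a set \<Rightarrow> nat \<Rightarrow> 'a list set" where
  "tuples S n = {xs. length xs = n \<and> set xs \<subseteq> S}"

definition subuniverse :: "('f \<Rightarrow> nat) \<Rightarrow> ('f, 'a) alg \<Rightarrow> 'a set \<Rightarrow> bool" where
  "subuniverse ar A S \<longleftrightarrow> S \<subseteq> univ A \<and> (\<forall>f. \<forall>xs \<in> tuples S (ar f). ops A f xs \<in> S)"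

definition ualgebra :: "('f \<Rightarrow> nat) \<Rightarrow> ('f, 'a) alg \<Rightarrow> bool" where
  "ualgebra ar A \<longleftrightarrow> univ A \<noteq> {} \<and> subuniverse ar A (univ A)"

definition subalgebra :: "('f \<Rightarrow> nat) \<Rightarrow> ('f, 'a) alg \<Rightarrow> ('f, 'a) alg \<Rightarrow> bool" where
  "subalgebra ar B C \<longleftrightarrow> univ B \<subseteq> univ C \<and>
     (\<forall>f. \<forall>xs \<in> tuples (univ B) (ar f). ops B f xs = ops C f xs)"

text \<open>Homomorphisms are extensional functions, so that a homomorphism is determined by its
  values on the universe.\<close>

definition alg_hom :: "('f \<Rightarrow> nat) \<Rightarrow> ('f, 'a) alg \<Rightarrow> ('f, 'b) alg \<Rightarrow> ('a \<Rightarrow> 'b) set" where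
  "alg_hom ar A B = {\<phi> \<in> univ A \<rightarrow>\<^sub>E univ B.
     \<forall>f. \<forall>xs \<in> tuples (univ A) (ar f). \<phi> (ops A f xs) = ops B f (map \<phi> xs)}"

definition alg_iso :: "('f \<Rightarrow> nat) \<Rightarrow> ('f, 'a) alg \<Rightarrow> ('f, 'b) alg \<Rightarrow> bool" where
  "alg_iso ar A B \<longleftrightarrow> (\<exists>\<phi> \<in> alg_hom ar A B. bij_betw \<phi> (univ A) (univ B))"

definition hom_ker :: "('f, 'a) alg \<Rightarrow> ('a \<Rightarrow> 'b) \<Rightarrow> ('a \<times> 'a) set" where
  "hom_ker A \<phi> = {(x, y). x \<in> univ A \<and> y \<in> univ A \<and> \<phi> x = \<phi> y}"

definition idempotent_elem :: "('f \<Rightarrow> nat) \<Rightarrow> ('f, 'a) alg \<Rightarrow> 'a \<Rightarrow> bool" where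
  "idempotent_elem ar A u \<longleftrightarrow> u \<in> univ A \<and> (\<forall>f. ops A f (replicate (ar f) u) = u)"

fun wf_trm :: "('f \<Rightarrow> nat) \<Rightarrow> ('f, 'v) trm \<Rightarrow> bool" where
  "wf_trm ar (Var v) \<longleftrightarrow> True"
| "wf_trm ar (App f ts) \<longleftrightarrow> length ts = ar f \<and> (\<forall>t \<in> set ts. wf_trm ar t)"

primrec eval_trm :: "('f, 'a) alg \<Rightarrow> ('v \<Rightarrow> 'a) \<Rightarrow> ('f, 'v) trm \<Rightarrow> 'a" where
  "eval_trm A \<rho> (Var v) = \<rho> v"
| "eval_trm A \<rho> (App f ts) = ops A f (map (eval_trm A \<rho>) ts)"


section \<open>Congruences and the term-condition commutator\<close>

definition con :: "('f \<Rightarrow> nat) \<Rightarrow> ('f, 'a) alg \<Rightarrow> ('a \<times> 'a) set set" where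
  "con ar A = {\<alpha>. equiv (univ A) \<alpha> \<and>
     (\<forall>f. \<forall>xs \<in> tuples (univ A) (ar f). \<forall>ys \<in> tuples (univ A) (ar f).
        list_all2 (\<lambda>x y. (x, y) \<in> \<alpha>) xs ys \<longrightarrow> (ops A f xs, ops A f ys) \<in> \<alpha>)}"

definition one_con :: "('f, 'a) alg \<Rightarrow> ('a \<times> 'a) set" where
  "one_con A = univ A \<times> univ A"

definition cg :: "('f \<Rightarrow> nat) \<Rightarrow> ('f, 'a) alg \<Rightarrow> ('a \<times> 'a) set \<Rightarrow> ('a \<times> 'a) set" where
  "cg ar A X = \<Inter>{\<alpha> \<in> con ar A. X \<subseteq> \<alpha>}"

text \<open>An element of a quotient is a congruence class; operations are computed on
  representatives.\<close>

definition quot :: "('f, 'a) alg \<Rightarrow> ('a \<times> 'a) set \<Rightarrow> ('f, 'a set) alg" where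
  "quot A \<alpha> = \<lparr>univ = univ A // \<alpha>,
     ops = (\<lambda>f Xs. \<alpha> `` {ops A f (map (\<lambda>X. SOME x. x \<in> X) Xs)})\<rparr>"

text \<open>The relation \<open>\<beta>/\<alpha>\<close> on \<open>A/\<alpha>\<close>.\<close>

definition quot_con :: "('a \<times> 'a) set \<Rightarrow> ('a \<times> 'a) set \<Rightarrow> ('a set \<times> 'a set) set" where
  "quot_con \<beta> \<alpha> = {(\<alpha> `` {x}, \<alpha> `` {y}) | x y. (x, y) \<in> \<beta>}"

text \<open>The term condition. Variables \<open>Inl i\<close> are moved along \<open>\<alpha>\<close>, variables
  \<open>Inr i\<close> along \<open>\<beta>\<close>; a term uses finitely many of either.\<close>

definition centralizes :: "('f \<Rightarrow> nat) \<Rightarrow> ('f, 'a) alg \<Rightarrow>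
    ('a \<times> 'a) set \<Rightarrow> ('a \<times> 'a) set \<Rightarrow> ('a \<times> 'a) set \<Rightarrow> bool" where
  "centralizes ar A \<alpha> \<beta> \<delta> \<longleftrightarrow>
     (\<forall>t :: ('f, nat + nat) trm. wf_trm ar t \<longrightarrow>
       (\<forall>a b c d. (\<forall>i. (a i, b i) \<in> \<alpha>) \<and> (\<forall>i. (c i, d i) \<in> \<beta>) \<and>
          (eval_trm A (case_sum a c) t, eval_trm A (case_sum a d) t) \<in> \<delta> \<longrightarrow>
          (eval_trm A (case_sum b c) t, eval_trm A (case_sum b d) t) \<in> \<delta>))"

definition commutator :: "('f \<Rightarrow> nat) \<Rightarrow> ('f, 'a) alg \<Rightarrow>
    ('a \<times> 'a) set \<Rightarrow> ('a \<times> 'a) set \<Rightarrow> ('a \<times> 'a) set" where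
  "commutator ar A \<alpha> \<beta> = \<Inter>{\<delta> \<in> con ar A. centralizes ar A \<alpha> \<beta> \<delta>}"


section \<open>Varieties\<close>

text \<open>HOL cannot quantify over the algebras of all types, so a variety is represented by its
  members with universe in a fixed type \<open>'u\<close>, and every "for all algebras in the variety" ranges
  over these. For \<open>'u\<close> infinite and at least as large as the set of operation symbols this loses
  nothing: the countably generated free algebra is then, up to isomorphism, among these
  members, so they have the same identities as the whole variety, and both the difference term
  property and regularity (Baer's criterion) are determined by members of that size.\<close>

definition satisfies :: "('f, 'a) alg \<Rightarrow> ('f, nat) trm \<times> ('f, nat) trm \<Rightarrow> bool" where
  "satisfies A e \<longleftrightarrow>
     (\<forall>\<rho>. range \<rho> \<subseteq> univ A \<longrightarrow> eval_trm A \<rho> (fst e) = eval_trm A \<rho> (snd e))"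

definition variety :: "('f \<Rightarrow> nat) \<Rightarrow> ('f, 'u) alg set \<Rightarrow> bool" where
  "variety ar \<U> \<longleftrightarrow> (\<exists>\<Sigma>. (\<forall>(s, t) \<in> \<Sigma>. wf_trm ar s \<and> wf_trm ar t) \<and>
     \<U> = {A. ualgebra ar A \<and> (\<forall>e \<in> \<Sigma>. satisfies A e)})"

definition identities ::
    "('f \<Rightarrow> nat) \<Rightarrow> ('f, 'u) alg set \<Rightarrow> (('f, nat) trm \<times> ('f, nat) trm) set" where
  "identities ar \<U> =
     {(s, t). wf_trm ar s \<and> wf_trm ar t \<and> (\<forall>A \<in> \<U>. satisfies A (s, t))}"

definition difference_term :: "('f \<Rightarrow> nat) \<Rightarrow> ('f, 'u) alg set \<Rightarrow> 'f \<Rightarrow> bool" where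
  "difference_term ar \<U> m \<longleftrightarrow> ar m = 3 \<and>
     (\<forall>A \<in> \<U>. (\<forall>x \<in> univ A. \<forall>y \<in> univ A. ops A m [x, x, y] = y) \<and>
        (\<forall>\<alpha> \<in> con ar A. \<forall>(x, y) \<in> \<alpha>. (x, ops A m [x, y, y]) \<in> commutator ar A \<alpha> \<alpha>))"

definition free_algebra :: "('f \<Rightarrow> nat) \<Rightarrow> ('f, 'u) alg set \<Rightarrow> ('f, 'u) alg \<Rightarrow> bool" where
  "free_algebra ar \<U> F \<longleftrightarrow> F \<in> \<U> \<and>
     (\<exists>X \<subseteq> univ F. \<Inter>{S. subuniverse ar F S \<and> X \<subseteq> S} = univ F \<and>
        (\<forall>A \<in> \<U>. \<forall>g \<in> X \<rightarrow> univ A. \<exists>\<phi> \<in> alg_hom ar F A. \<forall>x \<in> X. \<phi> x = g x))"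


section \<open>Kernel algebras and regular datum\<close>

text \<open>The locale \<open>module\<close> of the library requires a commutative ring; here
  \<open>R\<close> is an arbitrary ring with 1.\<close>

locale left_module = R?: ring R + M?: abelian_group M for R (structure) and M (structure) +
  assumes smult_closed:
      "\<lbrakk>r \<in> carrier R; x \<in> carrier M\<rbrakk> \<Longrightarrow> r \<odot>\<^bsub>M\<^esub> x \<in> carrier M"
    and smult_l_distr: "\<lbrakk>r \<in> carrier R; s \<in> carrier R; x \<in> carrier M\<rbrakk> \<Longrightarrow>
      (r \<oplus>\<^bsub>R\<^esub> s) \<odot>\<^bsub>M\<^esub> x = r \<odot>\<^bsub>M\<^esub> x \<oplus>\<^bsub>M\<^esub> s \<odot>\<^bsub>M\<^esub> x"
    and smult_r_distr: "\<lbrakk>r \<in> carrier R; x \<in> carrier M; y \<in> carrier M\<rbrakk> \<Longrightarrow>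
      r \<odot>\<^bsub>M\<^esub> (x \<oplus>\<^bsub>M\<^esub> y) = r \<odot>\<^bsub>M\<^esub> x \<oplus>\<^bsub>M\<^esub> r \<odot>\<^bsub>M\<^esub> y"
    and smult_assoc: "\<lbrakk>r \<in> carrier R; s \<in> carrier R; x \<in> carrier M\<rbrakk> \<Longrightarrow>
      (r \<otimes>\<^bsub>R\<^esub> s) \<odot>\<^bsub>M\<^esub> x = r \<odot>\<^bsub>M\<^esub> (s \<odot>\<^bsub>M\<^esub> x)"
    and smult_one: "x \<in> carrier M \<Longrightarrow> \<one>\<^bsub>R\<^esub> \<odot>\<^bsub>M\<^esub> x = x"

definition kernel_algebra :: "('f \<Rightarrow> nat) \<Rightarrow> 'f \<Rightarrow> 'r ring \<Rightarrow> ('r, 'a) module \<Rightarrow>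
    ('f, 'a) alg \<Rightarrow> bool" where
  "kernel_algebra ar m R M B \<longleftrightarrow> left_module R M \<and> univ B = carrier M \<and>
     (\<forall>f. \<exists>r \<in> tuples (carrier R) (ar f). \<forall>xs \<in> tuples (carrier M) (ar f).
        ops B f xs = (\<Oplus>\<^bsub>M\<^esub> i \<in> {..<ar f}. (r ! i) \<odot>\<^bsub>M\<^esub> (xs ! i))) \<and>
     (\<forall>x \<in> carrier M. \<forall>y \<in> carrier M. \<forall>z \<in> carrier M.
        ops B m [x, y, z] = (x \<ominus>\<^bsub>M\<^esub> y) \<oplus>\<^bsub>M\<^esub> z)"

text \<open>The ring of a kernel algebra on \<open>B\<close> may be replaced by its image in the ring of
  endomorphisms of the group \<open>B\<close>, so rings of functions are all the rings needed here.\<close>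

definition is_kernel_algebra :: "('f \<Rightarrow> nat) \<Rightarrow> 'f \<Rightarrow> ('f, 'a) alg \<Rightarrow> bool" where
  "is_kernel_algebra ar m B \<longleftrightarrow>
     (\<exists>(R :: ('a \<Rightarrow> 'a) ring) (M :: ('a \<Rightarrow> 'a, 'a) module). kernel_algebra ar m R M B)"

definition RD1 :: "('f \<Rightarrow> nat) \<Rightarrow> ('f, 'u) alg set \<Rightarrow> 'f \<Rightarrow> ('f, 'u) alg \<Rightarrow> bool" where
  "RD1 ar \<U> m E \<longleftrightarrow>
     (\<forall>B \<in> \<U>. \<forall>C \<in> \<U>. is_kernel_algebra ar m B \<and> is_kernel_algebra ar m C \<and>
        subalgebra ar B C \<longrightarrow>
        (\<forall>\<phi> \<in> alg_hom ar B E. \<exists>\<psi> \<in> alg_hom ar C E. \<forall>x \<in> univ B. \<psi> x = \<phi> x))"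

definition RD2 :: "('f \<Rightarrow> nat) \<Rightarrow> ('f, 'u) alg set \<Rightarrow> 'f \<Rightarrow> ('f, 'u) alg \<Rightarrow> bool" where
  "RD2 ar \<U> m E \<longleftrightarrow>
     (\<forall>B \<in> \<U>. is_kernel_algebra ar m B \<longrightarrow>
        (\<forall>\<alpha> \<in> con ar B. \<forall>a \<in> univ B. \<forall>b \<in> univ B. (a, b) \<notin> \<alpha> \<longrightarrow>
           (\<exists>\<phi> \<in> alg_hom ar B E. \<alpha> \<subseteq> hom_ker B \<phi> \<and> (a, b) \<notin> hom_ker B \<phi>)))"

definition central_datum :: "('f \<Rightarrow> nat) \<Rightarrow> ('f, 'u) alg set \<Rightarrow> 'f \<Rightarrow> ('f, 'u) alg \<Rightarrow>
    'r ring \<Rightarrow> ('r, 'u) module \<Rightarrow> ('f, 'u) alg \<Rightarrow> bool" where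
  "central_datum ar \<U> m Q R M B \<longleftrightarrow> Q \<in> \<U> \<and> B \<in> \<U> \<and> kernel_algebra ar m R M B"

definition regular_datum :: "('f \<Rightarrow> nat) \<Rightarrow> ('f, 'u) alg set \<Rightarrow> 'f \<Rightarrow> ('f, 'u) alg \<Rightarrow>
    'r ring \<Rightarrow> ('r, 'u) module \<Rightarrow> ('f, 'u) alg \<Rightarrow> bool" where
  "regular_datum ar \<U> m Q R M E \<longleftrightarrow>
     central_datum ar \<U> m Q R M E \<and> RD1 ar \<U> m E \<and> RD2 ar \<U> m E"

text \<open>The homomorphisms from \<open>A\<close> with zero \<open>z\<close> to the kernel algebra \<open>E\<close> on
  the module \<open>M\<close> that preserve zero, under pointwise addition.\<close>

definition Hom0 :: "('f \<Rightarrow> nat) \<Rightarrow> ('f, 'a) alg \<Rightarrow> 'a \<Rightarrow> ('r, 'b) module \<Rightarrow>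
    ('f, 'b) alg \<Rightarrow> ('a \<Rightarrow> 'b) monoid" where
  "Hom0 ar A z M E = \<lparr>carrier = {\<phi> \<in> alg_hom ar A E. \<phi> z = \<zero>\<^bsub>M\<^esub>},
     mult = (\<lambda>\<phi> \<psi>. \<lambda>x \<in> univ A. \<phi> x \<oplus>\<^bsub>M\<^esub> \<psi> x),
     one = (\<lambda>x \<in> univ A. \<zero>\<^bsub>M\<^esub>)\<rparr>"


section \<open>Second cohomology\<close>

primrec partial_trm :: "('f, 'q) alg \<Rightarrow> ('r, 'b) module \<Rightarrow> ('f, 'b) alg \<Rightarrow>
    ('f \<Rightarrow> 'q list \<Rightarrow> 'b) \<Rightarrow> ('v \<Rightarrow> 'q) \<Rightarrow> ('f, 'v) trm \<Rightarrow> 'b" where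
  "partial_trm Q M B T \<rho> (Var v) = \<zero>\<^bsub>M\<^esub>"
| "partial_trm Q M B T \<rho> (App f ts) =
     ops B f (map (partial_trm Q M B T \<rho>) ts) \<oplus>\<^bsub>M\<^esub> T f (map (eval_trm Q \<rho>) ts)"

definition cocycles :: "('f \<Rightarrow> nat) \<Rightarrow> ('f, 'q) alg \<Rightarrow> ('f, 'b) alg \<Rightarrow>
    ('f \<Rightarrow> 'q list \<Rightarrow> 'b) set" where
  "cocycles ar Q B = {T. \<forall>f. T f \<in> tuples (univ Q) (ar f) \<rightarrow>\<^sub>E univ B}"

definition compatible :: "('f \<Rightarrow> nat) \<Rightarrow> ('f, 'u) alg set \<Rightarrow> ('f, 'q) alg \<Rightarrow>
    ('r, 'b) module \<Rightarrow> ('f, 'b) alg \<Rightarrow> ('f \<Rightarrow> 'q list \<Rightarrow> 'b) \<Rightarrow> bool" where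
  "compatible ar \<U> Q M B T \<longleftrightarrow>
     (\<forall>(s, t) \<in> identities ar \<U>. \<forall>\<rho>. range \<rho> \<subseteq> univ Q \<longrightarrow>
        partial_trm Q M B T \<rho> s = partial_trm Q M B T \<rho> t)"

definition Z2 :: "('f \<Rightarrow> nat) \<Rightarrow> ('f, 'u) alg set \<Rightarrow> ('f, 'q) alg \<Rightarrow> ('r, 'b) module \<Rightarrow>
    ('f, 'b) alg \<Rightarrow> ('f \<Rightarrow> 'q list \<Rightarrow> 'b) monoid" where
  "Z2 ar \<U> Q M B = \<lparr>carrier = {T \<in> cocycles ar Q B. compatible ar \<U> Q M B T},
     mult = (\<lambda>S T f. \<lambda>xs \<in> tuples (univ Q) (ar f). S f xs \<oplus>\<^bsub>M\<^esub> T f xs),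
     one = (\<lambda>f. \<lambda>xs \<in> tuples (univ Q) (ar f). \<zero>\<^bsub>M\<^esub>)\<rparr>"

definition coboundaries :: "('f \<Rightarrow> nat) \<Rightarrow> ('f, 'q) alg \<Rightarrow> ('r, 'b) module \<Rightarrow>
    ('f, 'b) alg \<Rightarrow> ('f \<Rightarrow> 'q list \<Rightarrow> 'b) set" where
  "coboundaries ar Q M B =
     {(\<lambda>f. \<lambda>xs \<in> tuples (univ Q) (ar f). ops B f (map h xs) \<ominus>\<^bsub>M\<^esub> h (ops Q f xs)) | h.
        h \<in> univ Q \<rightarrow> univ B}"

definition H2 :: "('f \<Rightarrow> nat) \<Rightarrow> ('f, 'u) alg set \<Rightarrow> ('f, 'q) alg \<Rightarrow> ('r, 'b) module \<Rightarrow>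
    ('f, 'b) alg \<Rightarrow> ('f \<Rightarrow> 'q list \<Rightarrow> 'b) set monoid" where
  "H2 ar \<U> Q M B = Z2 ar \<U> Q M B Mod coboundaries ar Q M B"


section \<open>Algebras attached to a central congruence\<close>

text \<open>\<open>con_alg A \<alpha>\<close> is \<open>A(\<alpha>)\<close>, and \<open>Delta1 ar A \<alpha>\<close> is
  \<open>\<Delta>\<^sub>\<alpha>\<^sub>1\<close>.\<close>

definition con_alg :: "('f, 'a) alg \<Rightarrow> ('a \<times> 'a) set \<Rightarrow> ('f, 'a \<times> 'a) alg" where
  "con_alg A \<alpha> = \<lparr>univ = \<alpha>,
     ops = (\<lambda>f ps. (ops A f (map fst ps), ops A f (map snd ps)))\<rparr>"

definition Delta1 :: "('f \<Rightarrow> nat) \<Rightarrow> ('f, 'a) alg \<Rightarrow> ('a \<times> 'a) set \<Rightarrow>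
    (('a \<times> 'a) \<times> ('a \<times> 'a)) set" where
  "Delta1 ar A \<alpha> =
     cg ar (con_alg A \<alpha>) {((u, u), (v, v)) | u v. u \<in> univ A \<and> v \<in> univ A}"

definition kappa :: "('f \<Rightarrow> nat) \<Rightarrow> ('f, 'a) alg \<Rightarrow> ('a \<times> 'a) set \<Rightarrow>
    'a \<times> 'a \<Rightarrow> ('a \<times> 'a) set" where
  "kappa ar A \<alpha> p = Delta1 ar A \<alpha> `` {p}"

text \<open>The image under \<open>kappa ar A \<alpha>\<close> of \<open>A(\<gamma>)\<close>, for \<open>\<gamma> \<subseteq> \<alpha>\<close>.\<close>

definition kappa_image :: "('f \<Rightarrow> nat) \<Rightarrow> ('f, 'a) alg \<Rightarrow> ('a \<times> 'a) set \<Rightarrow>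
    ('a \<times> 'a) set \<Rightarrow> ('f, ('a \<times> 'a) set) alg" where
  "kappa_image ar A \<alpha> \<gamma> = \<lparr>univ = kappa ar A \<alpha> ` \<gamma>,
     ops = ops (quot (con_alg A \<alpha>) (Delta1 ar A \<alpha>))\<rparr>"

text \<open>The \<open>\<Delta>\<^sub>\<alpha>\<^sub>1\<close>-class of the diagonal.\<close>

definition diag_class :: "('f \<Rightarrow> nat) \<Rightarrow> ('f, 'a) alg \<Rightarrow> ('a \<times> 'a) set \<Rightarrow>
    ('a \<times> 'a) set" where
  "diag_class ar A \<alpha> = Delta1 ar A \<alpha> `` Id_on (univ A)"

text \<open>The \<open>\<gamma>\<close>-class of an idempotent element \<open>u\<close>, as a subalgebra.\<close>

definition class_alg :: "('f, 'a) alg \<Rightarrow> ('a \<times> 'a) set \<Rightarrow> 'a \<Rightarrow> ('f, 'a) alg" where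
  "class_alg A \<gamma> u = \<lparr>univ = \<gamma> `` {u}, ops = ops A\<rparr>"

end

(* Let d = [theta,1] and p : F -> Q the presentation. A cocycle T is compatible if and only if
   it has a derivation, that is, a map D : F -> E with D(f(x)) = f(D(x)) + T_f(p(x)): the free
   algebra F lifts to the central extension of Q by E that T defines. Such a D is constant on
   the classes of d, because that extension is central, and two such D differ by a homomorphism
   from F to the abelian algebra E, which is constant on the classes of [1,1]. So T determines
   the homomorphism x |-> D(x) - D(u) on the (theta /\ [1,1])-class of u. Extending homomorphisms
   by regularity shows that every homomorphism arises in this way, and that exactly the
   coboundaries give zero. The second isomorphism is x |-> kappa(x, u), with inverse induced by
   (x, y) |-> m(x, y, u). *)
theory Submission
  imports Defs
begin

section \<open>Congruences, terms and commutators\<close>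

text \<open>The theorem concerns quotients of \<open>F\<close>, but \<open>RD1\<close> speaks of
  kernel algebras whose universe lies in the type \<open>'u\<close>, while congruence classes are
  sets over \<open>'u\<close>. So the argument stays upstairs: a homomorphism on a quotient is
  treated as a map on a subset of \<open>F\<close> that is constant on classes, and a quotient
  becomes an algebra over \<open>'u\<close>, on chosen representatives, when \<open>RD1\<close> is
  applied. That it is a kernel algebra rests on one fact: along a central congruence
  \<open>m\<close> commutes with every operation. Together with a zero this makes each operation
  additive. The idempotent supplies the zero; it also makes the \<theta>-class of \<open>u0\<close>
  a subalgebra, and on that class the cocycle term in D(x) - D(u0) cancels. Regularity is applied
  twice, with different congruences: modulo [\<theta>,1], from the class of \<open>u0\<close> under
  the meet of \<theta> and [1,1] to its \<theta>-class, to see that every homomorphism occurs; and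
  modulo [1,1], from the \<theta>-class to all of \<open>F\<close>, to see that a cocycle sent to
  zero is a coboundary.\<close>

lemma in_tuples: "xs \<in> tuples S n \<longleftrightarrow> length xs = n \<and> (\<forall>x \<in> set xs. x \<in> S)"
  unfolding tuples_def by auto

lemma ops_closed:
  assumes "ualgebra ar A" "length xs = ar f" "\<And>x. x \<in> set xs \<Longrightarrow> x \<in> univ A"
  shows "ops A f xs \<in> univ A"
  using assms by (simp add: ualgebra_def subuniverse_def in_tuples)

lemma con_equiv: "\<alpha> \<in> con ar A \<Longrightarrow> equiv (univ A) \<alpha>"
  by (simp add: con_def)

lemma con_in: "\<alpha> \<in> con ar A \<Longrightarrow> (x, y) \<in> \<alpha> \<Longrightarrow> x \<in> univ A \<and> y \<in> univ A"
  using equiv_type[OF con_equiv, of \<alpha> ar A] by auto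

lemma con_refl: "\<alpha> \<in> con ar A \<Longrightarrow> x \<in> univ A \<Longrightarrow> (x, x) \<in> \<alpha>"
  by (meson con_equiv equiv_def refl_onD)

lemma con_sym: "\<alpha> \<in> con ar A \<Longrightarrow> (x, y) \<in> \<alpha> \<Longrightarrow> (y, x) \<in> \<alpha>"
  by (meson con_equiv equiv_def symD)

lemma con_trans: "\<alpha> \<in> con ar A \<Longrightarrow> (x, y) \<in> \<alpha> \<Longrightarrow> (y, z) \<in> \<alpha> \<Longrightarrow> (x, z) \<in> \<alpha>"
  by (meson con_equiv equiv_def transD)

lemma con_ops:
  assumes a: "\<alpha> \<in> con ar A" and l: "list_all2 (\<lambda>x y. (x, y) \<in> \<alpha>) xs ys" "length xs = ar f"
  shows "(ops A f xs, ops A f ys) \<in> \<alpha>"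
proof -
  have n: "length ys = ar f" "\<And>i. i < ar f \<Longrightarrow> (xs ! i, ys ! i) \<in> \<alpha>"
    using l by (auto simp: list_all2_conv_all_nth)
  have "xs \<in> tuples (univ A) (ar f)" "ys \<in> tuples (univ A) (ar f)"
    using n l(2) con_in[OF a n(2)] unfolding in_tuples by (auto simp: in_set_conv_nth)
  then show ?thesis using a l(1) by (simp add: con_def)
qed

lemma con_ops_map:
  assumes "\<alpha> \<in> con ar A" "\<And>x. x \<in> set xs \<Longrightarrow> (g x, h x) \<in> \<alpha>" "length xs = ar f"
  shows "(ops A f (map g xs), ops A f (map h xs)) \<in> \<alpha>"
  by (rule con_ops) (use assms in \<open>auto simp: list_all2_conv_all_nth\<close>)

lemma con_Image_eq_iff:
  assumes "\<alpha> \<in> con ar A" "x \<in> univ A" "y \<in> univ A"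
  shows "\<alpha> `` {x} = \<alpha> `` {y} \<longleftrightarrow> (x, y) \<in> \<alpha>"
  using assms by (meson con_equiv eq_equiv_class_iff)

lemma con_Inter:
  assumes "\<C> \<subseteq> con ar A" "\<C> \<noteq> {}"
  shows "\<Inter>\<C> \<in> con ar A"
proof -
  have c: "\<And>\<alpha>. \<alpha> \<in> \<C> \<Longrightarrow> \<alpha> \<in> con ar A" using assms by blast
  have "equiv (univ A) (\<Inter>\<C>)"
  proof (rule equivI)
    show "refl_on (univ A) (\<Inter>\<C>)" unfolding refl_on_def using c by (auto intro: con_refl)
    show "sym (\<Inter>\<C>)" unfolding sym_def by (meson Inter_iff c con_sym)
    show "trans (\<Inter>\<C>)" unfolding trans_def by (meson Inter_iff c con_trans)
    obtain \<alpha> where "\<alpha> \<in> \<C>" using assms(2) by blast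
    then show "\<Inter>\<C> \<subseteq> univ A \<times> univ A" using con_in[OF c] by auto
  qed
  moreover have "(ops A f xs, ops A f ys) \<in> \<alpha>"
    if "xs \<in> tuples (univ A) (ar f)" "list_all2 (\<lambda>x y. (x, y) \<in> \<Inter>\<C>) xs ys" "\<alpha> \<in> \<C>" for f xs ys \<alpha>
  proof (rule con_ops[OF c])
    show "list_all2 (\<lambda>x y. (x, y) \<in> \<alpha>) xs ys"
      using that(2) by (rule list_all2_mono) (use that(3) in blast)
  qed (use that in \<open>auto simp: in_tuples\<close>)
  ultimately show ?thesis by (simp add: con_def)
qed

lemma con_Int: "\<alpha> \<in> con ar A \<Longrightarrow> \<beta> \<in> con ar A \<Longrightarrow> \<alpha> \<inter> \<beta> \<in> con ar A"
  using con_Inter[of "{\<alpha>, \<beta>}" ar A] by simp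

lemma one_con_con: "ualgebra ar A \<Longrightarrow> one_con A \<in> con ar A"
  unfolding con_def one_con_def equiv_def refl_on_def sym_def trans_def
  by (auto simp: in_tuples intro!: ops_closed)

section \<open>Evaluation of terms\<close>

lemma eval_closed:
  assumes "ualgebra ar A" "wf_trm ar t" "\<And>v. \<rho> v \<in> univ A"
  shows "eval_trm A \<rho> t \<in> univ A"
  using assms(2) by (induction t) (auto intro!: ops_closed[OF assms(1)] assms(3))

lemma eval_con:
  assumes "\<alpha> \<in> con ar A" "wf_trm ar t" "\<And>v. (\<rho> v, \<sigma> v) \<in> \<alpha>"
  shows "(eval_trm A \<rho> t, eval_trm A \<sigma> t) \<in> \<alpha>"
  using assms(2) by (induction t) (auto intro!: con_ops_map[OF assms(1)] assms(3))

lemma eval_hom: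
  assumes "ualgebra ar A" "wf_trm ar t" "\<And>v. \<rho> v \<in> univ A"
    and "\<And>f xs. xs \<in> tuples (univ A) (ar f) \<Longrightarrow> \<phi> (ops A f xs) = ops B f (map \<phi> xs)"
  shows "\<phi> (eval_trm A \<rho> t) = eval_trm B (\<lambda>v. \<phi> (\<rho> v)) t"
  using assms(2)
proof (induction t)
  case (App f ts)
  have "map (eval_trm A \<rho>) ts \<in> tuples (univ A) (ar f)"
    using App.prems by (auto simp: in_tuples intro: eval_closed[OF assms(1) _ assms(3)])
  then have "\<phi> (eval_trm A \<rho> (App f ts)) = ops B f (map \<phi> (map (eval_trm A \<rho>) ts))"
    by (simp add: assms(4))
  moreover have "map \<phi> (map (eval_trm A \<rho>) ts) = map (eval_trm B (\<lambda>v. \<phi> (\<rho> v))) ts"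
    using App by simp
  ultimately show ?case by (simp only: eval_trm.simps)
qed simp

section \<open>The term condition and the commutator\<close>

lemma centralizesD:
  fixes t :: "('f, nat + nat) trm"
  assumes "centralizes ar A \<alpha> \<beta> \<delta>" "wf_trm ar t" "\<And>i. (a i, b i) \<in> \<alpha>" "\<And>i. (c i, d i) \<in> \<beta>"
    "(eval_trm A (case_sum a c) t, eval_trm A (case_sum a d) t) \<in> \<delta>"
  shows "(eval_trm A (case_sum b c) t, eval_trm A (case_sum b d) t) \<in> \<delta>"
  by (rule assms(1)[unfolded centralizes_def, rule_format, OF assms(2)]) (use assms(3-5) in auto)

text \<open>Guarantees that the intersection defining \<open>commutator\<close> runs over a nonempty
  family, so that it is again a congruence.\<close>

lemma centralizes_one:
  fixes A :: "('b, 'a) alg"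
  assumes A: "ualgebra ar A" and \<alpha>: "\<alpha> \<subseteq> one_con A" and \<beta>: "\<beta> \<subseteq> one_con A"
  shows "centralizes ar A \<alpha> \<beta> (one_con A)"
  unfolding centralizes_def
proof (intro allI impI, elim conjE)
  fix t :: "('b, nat + nat) trm" and a b c d :: "nat \<Rightarrow> 'a"
  assume t: "wf_trm ar t"
    and ab: "\<forall>i. (a i, b i) \<in> \<alpha>" and cd: "\<forall>i. (c i, d i) \<in> \<beta>"
  have "b i \<in> univ A" "c i \<in> univ A" "d i \<in> univ A" for i
    using ab cd \<alpha> \<beta> unfolding one_con_def by auto
  then show "(eval_trm A (case_sum b c) t, eval_trm A (case_sum b d) t) \<in> one_con A"
    unfolding one_con_def by (auto intro!: eval_closed[OF A t] split: sum.split)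
qed

lemma commutator_con:
  assumes "ualgebra ar A" "\<alpha> \<subseteq> one_con A" "\<beta> \<subseteq> one_con A"
  shows "commutator ar A \<alpha> \<beta> \<in> con ar A"
  unfolding commutator_def
  by (rule con_Inter) (use one_con_con[OF assms(1)] centralizes_one[OF assms] in auto)

lemma commutator_least:
  "\<delta> \<in> con ar A \<Longrightarrow> centralizes ar A \<alpha> \<beta> \<delta> \<Longrightarrow> commutator ar A \<alpha> \<beta> \<subseteq> \<delta>"
  unfolding commutator_def by (rule Inter_lower) simp

text \<open>The premise of the term condition at an intersection holds at each member, and each
  member returns the conclusion.\<close>

lemma centralizes_commutator:
  fixes A :: "('b, 'a) alg"
  shows "centralizes ar A \<alpha> \<beta> (commutator ar A \<alpha> \<beta>)"
  unfolding centralizes_def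
proof (intro allI impI, elim conjE)
  fix t :: "('b, nat + nat) trm" and a b c d :: "nat \<Rightarrow> 'a"
  assume h: "wf_trm ar t" "\<forall>i. (a i, b i) \<in> \<alpha>" "\<forall>i. (c i, d i) \<in> \<beta>"
    "(eval_trm A (case_sum a c) t, eval_trm A (case_sum a d) t) \<in> commutator ar A \<alpha> \<beta>"
  have k: "(eval_trm A (case_sum b c) t, eval_trm A (case_sum b d) t) \<in> \<delta>"
    if "\<delta> \<in> con ar A" "centralizes ar A \<alpha> \<beta> \<delta>" for \<delta>
  proof -
    have e: "(eval_trm A (case_sum a c) t, eval_trm A (case_sum a d) t) \<in> \<delta>"
      using h(4) commutator_least[OF that] by (rule subsetD[rotated])
    show ?thesis by (rule centralizesD[OF that(2) h(1) h(2)[rule_format] h(3)[rule_format] e])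
  qed
  show "(eval_trm A (case_sum b c) t, eval_trm A (case_sum b d) t) \<in> commutator ar A \<alpha> \<beta>"
    unfolding commutator_def by (auto intro: k)
qed

lemma centralizes_mono:
  fixes A :: "('b, 'a) alg"
  shows "centralizes ar A \<alpha>' \<beta>' \<delta> \<Longrightarrow> \<alpha> \<subseteq> \<alpha>' \<Longrightarrow> \<beta> \<subseteq> \<beta>' \<Longrightarrow> centralizes ar A \<alpha> \<beta> \<delta>"
  unfolding centralizes_def[of ar A \<alpha> \<beta>]
proof (intro allI impI, elim conjE)
  fix t :: "('b, nat + nat) trm" and a b c d :: "nat \<Rightarrow> 'a"
  assume C: "centralizes ar A \<alpha>' \<beta>' \<delta>" and s: "\<alpha> \<subseteq> \<alpha>'" "\<beta> \<subseteq> \<beta>'" and t: "wf_trm ar t"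
    and ab: "\<forall>i. (a i, b i) \<in> \<alpha>" and cd: "\<forall>i. (c i, d i) \<in> \<beta>"
    and e: "(eval_trm A (case_sum a c) t, eval_trm A (case_sum a d) t) \<in> \<delta>"
  show "(eval_trm A (case_sum b c) t, eval_trm A (case_sum b d) t) \<in> \<delta>"
    by (rule centralizesD[OF C t _ _ e]) (use ab cd s in auto)
qed

lemma commutator_mono:
  "\<alpha> \<subseteq> \<alpha>' \<Longrightarrow> \<beta> \<subseteq> \<beta>' \<Longrightarrow> commutator ar A \<alpha> \<beta> \<subseteq> commutator ar A \<alpha>' \<beta>'"
  unfolding commutator_def
  by (rule Inter_anti_mono, rule Collect_mono) (simp add: centralizes_mono[of ar A \<alpha>' \<beta>' _ \<alpha> \<beta>])

text \<open>Changing \<open>a\<close> to \<open>b\<close> moves each of the two values inside its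
  \<alpha>-class, so \<alpha> itself meets the term condition.\<close>

lemma commutator_le_left:
  fixes A :: "('b, 'a) alg"
  assumes A: "ualgebra ar A" and \<alpha>: "\<alpha> \<in> con ar A" and \<beta>: "\<beta> \<subseteq> one_con A"
  shows "commutator ar A \<alpha> \<beta> \<subseteq> \<alpha>"
proof (rule commutator_least[OF \<alpha>])
  show "centralizes ar A \<alpha> \<beta> \<alpha>"
    unfolding centralizes_def
  proof (intro allI impI, elim conjE)
    fix t :: "('b, nat + nat) trm" and a b c d :: "nat \<Rightarrow> 'a"
    assume t: "wf_trm ar t" and ab: "\<forall>i. (a i, b i) \<in> \<alpha>" and cd: "\<forall>i. (c i, d i) \<in> \<beta>"
      and s: "(eval_trm A (case_sum a c) t, eval_trm A (case_sum a d) t) \<in> \<alpha>"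
    have u: "c i \<in> univ A" "d i \<in> univ A" for i using cd \<beta> unfolding one_con_def by auto
    have k: "(eval_trm A (case_sum a x) t, eval_trm A (case_sum b x) t) \<in> \<alpha>"
      if "\<And>i. x i \<in> univ A" for x
      by (rule eval_con[OF \<alpha> t]) (use ab that con_refl[OF \<alpha>] in \<open>auto split: sum.split\<close>)
    show "(eval_trm A (case_sum b c) t, eval_trm A (case_sum b d) t) \<in> \<alpha>"
      by (rule con_trans[OF \<alpha> con_trans[OF \<alpha> con_sym[OF \<alpha> k] s] k]) (use u in auto)
  qed
qed

text \<open>Along a central congruence the difference term commutes with every operation. With the
  variables \<open>Y\<close> moved from \<open>x\<close> to \<open>y\<close>, apply the term condition to
  \<open>m(f(m(Y,P,Q)), m(f Y, f P, f Q), R)\<close>: its values for \<open>(P,Q) = (x,z)\<close> and for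
  \<open>(P,Q) = (y,y)\<close> agree at \<open>Y = x\<close>.\<close>

lemma central_difference_commutes_nat:
  fixes y x z :: "nat \<Rightarrow> 'a"
  assumes A: "ualgebra ar A" and \<alpha>: "\<alpha> \<in> con ar A" and \<delta>: "\<delta> \<in> con ar A"
    and C: "centralizes ar A \<alpha> (one_con A) \<delta>" and ar: "ar m = 3"
    and m1: "\<And>x y. x \<in> univ A \<Longrightarrow> y \<in> univ A \<Longrightarrow> ops A m [x, x, y] = y"
    and m2: "\<And>x y. (x, y) \<in> \<alpha> \<Longrightarrow> (ops A m [x, y, y], x) \<in> \<delta>"
    and yx: "\<And>i. (y i, x i) \<in> \<alpha>" and z: "\<And>i. z i \<in> univ A"
  shows "(ops A f (map (\<lambda>i. ops A m [y i, x i, z i]) [0..<ar f]),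
          ops A m [ops A f (map y [0..<ar f]), ops A f (map x [0..<ar f]), ops A f (map z [0..<ar f])]) \<in> \<delta>"
proof -
  define F where "F = (\<lambda>g. ops A f (map g [0..<ar f]))"
  \<comment> \<open>The parameter is the right-hand side of the claim. With \<open>Y = y\<close> and
    \<open>(P, Q) = (x, z)\<close> the term is then m(L, r, r), where L is the left-hand side, and
    \<open>m2\<close> compares this with L.\<close>
  define r where "r = ops A m [F y, F x, F z]"
  \<comment> \<open>\<open>Inr 0\<close> carries the parameter \<open>r\<close>; odd indices belong
    to P, positive even ones to Q (here \<open>Z\<close>). The assignment \<open>c\<close> decodes
    them.\<close>
  define Y P Z where "Y = (\<lambda>i::nat. Var (Inl i) :: ('b, nat + nat) trm)"
    and "P = (\<lambda>i::nat. Var (Inr (Suc (2 * i))) :: ('b, nat + nat) trm)"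
    and "Z = (\<lambda>i::nat. Var (Inr (Suc (Suc (2 * i)))) :: ('b, nat + nat) trm)"
  define t where "t = App m [App f (map (\<lambda>i. App m [Y i, P i, Z i]) [0..<ar f]),
     App m [App f (map Y [0..<ar f]), App f (map P [0..<ar f]), App f (map Z [0..<ar f])], Var (Inr 0)]"
  define c where "c = (\<lambda>g h n. case n of 0 \<Rightarrow> r
     | Suc k \<Rightarrow> if even k then g (k div 2) else (h (k div 2) :: 'a))"
  have wf: "wf_trm ar t" unfolding t_def Y_def P_def Z_def by (auto simp: ar)
  have ev: "eval_trm A (case_sum a (c g h)) t =
      ops A m [F (\<lambda>i. ops A m [a i, g i, h i]), ops A m [F a, F g, F h], r]" for a g h
    unfolding t_def Y_def P_def Z_def c_def F_def by (simp add: comp_def)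
  have xu: "x i \<in> univ A" and yu: "y i \<in> univ A" for i
    using con_in[OF \<alpha> yx] by blast+
  have mc: "ops A m [a, b, d] \<in> univ A" if "a \<in> univ A" "b \<in> univ A" "d \<in> univ A" for a b d
    using that by (intro ops_closed[OF A, of _ m]) (auto simp: ar)
  have Fc: "F g \<in> univ A" if "\<And>i. g i \<in> univ A" for g
    unfolding F_def using that by (intro ops_closed[OF A]) auto
  have ru: "r \<in> univ A" unfolding r_def by (intro mc Fc xu yu z)
  have Fd: "(F g, F h) \<in> \<beta>" if "\<And>i. (g i, h i) \<in> \<beta>" "\<beta> \<in> con ar A" for g h \<beta>
    unfolding F_def using that by (intro con_ops_map) auto
  have md: "(ops A m [a, b, d], ops A m [a', b', d']) \<in> \<beta>"
    if "(a, a') \<in> \<beta>" "(b, b') \<in> \<beta>" "(d, d') \<in> \<beta>" "\<beta> \<in> con ar A" for a b d a' b' d' \<beta>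
    using that by (intro con_ops[where ar = ar]) (auto simp: ar)
  note tr = con_trans[OF \<delta>] and sy = con_sym[OF \<delta>] and re = con_refl[OF \<delta>]
  \<comment> \<open>Both values at \<open>Y = x\<close> have the form m(w, w, r) = r, the first
    exactly and the second modulo \<delta>. This is the premise of the term condition.\<close>
  have xz: "eval_trm A (case_sum x (c x z)) t = r"
    unfolding ev using m1 xu z ru Fc by simp
  have "(ops A m [F (\<lambda>i. ops A m [x i, y i, y i]), ops A m [F x, F y, F y], r], ops A m [F x, F x, r]) \<in> \<delta>"
    by (intro md Fd m2 con_sym[OF \<alpha> yx] re ru \<delta> \<alpha>)
  then have 1: "(eval_trm A (case_sum x (c x z)) t, eval_trm A (case_sum x (c y y)) t) \<in> \<delta>"
    unfolding xz unfolding ev using m1 Fc xu ru sy by simp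
  have "\<And>i. (c x z i, c y y i) \<in> one_con A"
    unfolding c_def one_con_def using xu yu z ru by (auto split: nat.split)
  then have 2: "(eval_trm A (case_sum y (c x z)) t, eval_trm A (case_sum y (c y y)) t) \<in> \<delta>"
    by (rule centralizesD[OF C wf con_sym[OF \<alpha> yx] _ 1])
  have yy: "eval_trm A (case_sum y (c y y)) t = r"
    unfolding ev using m1 yu ru Fc by simp
  \<comment> \<open>\<open>m2\<close> needs \<alpha>-related arguments: both sides of the claim are
    \<alpha>-related to \<open>F z\<close>, because replacing \<open>y\<close> by \<open>x\<close>
    collapses m(y, x, z) to z.\<close>
  have "(ops A m [y i, x i, z i], z i) \<in> \<alpha>" for i
    using md[OF yx[of i] con_refl[OF \<alpha> xu[of i]] con_refl[OF \<alpha> z[of i]] \<alpha>] m1 xu z by simp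
  then have a1: "(F (\<lambda>i. ops A m [y i, x i, z i]), F z) \<in> \<alpha>" by (intro Fd \<alpha>)
  have a2: "(r, F z) \<in> \<alpha>"
    unfolding r_def
    using md[OF Fd[of y x, OF yx \<alpha>] con_refl[OF \<alpha> Fc[of x, OF xu]] con_refl[OF \<alpha> Fc[of z, OF z]] \<alpha>]
    using m1 Fc[of x, OF xu] Fc[of z, OF z] by simp
  have "(F (\<lambda>i. ops A m [y i, x i, z i]), r) \<in> \<alpha>"
    by (rule con_trans[OF \<alpha> a1 con_sym[OF \<alpha> a2]])
  from m2[OF this] have "(F (\<lambda>i. ops A m [y i, x i, z i]), eval_trm A (case_sum y (c x z)) t) \<in> \<delta>"
    unfolding ev r_def[symmetric] by (rule sy)
  then have "(F (\<lambda>i. ops A m [y i, x i, z i]), r) \<in> \<delta>" using 2 unfolding yy by (rule tr)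
  then show ?thesis unfolding F_def r_def .
qed

lemma central_difference_commutes:
  assumes A: "ualgebra ar A" and \<alpha>: "\<alpha> \<in> con ar A" and \<delta>: "\<delta> \<in> con ar A"
    and C: "centralizes ar A \<alpha> (one_con A) \<delta>" and ar: "ar m = 3"
    and m1: "\<And>x y. x \<in> univ A \<Longrightarrow> y \<in> univ A \<Longrightarrow> ops A m [x, x, y] = y"
    and m2: "\<And>x y. (x, y) \<in> \<alpha> \<Longrightarrow> (ops A m [x, y, y], x) \<in> \<delta>"
    and len: "length is = ar f"
    and yx: "\<And>i. i \<in> set is \<Longrightarrow> (y i, x i) \<in> \<alpha>" and z: "\<And>i. i \<in> set is \<Longrightarrow> z i \<in> univ A"
  shows "(ops A f (map (\<lambda>i. ops A m [y i, x i, z i]) is),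
          ops A m [ops A f (map y is), ops A f (map x is), ops A f (map z is)]) \<in> \<delta>"
proof -
  obtain e where e: "e \<in> univ A" using A unfolding ualgebra_def by blast
  \<comment> \<open>Variables are indexed by all naturals, so the families are continued beyond the
    arity by an arbitrary element \<open>e\<close>, which is \<alpha>-related to itself.\<close>
  define ext where "ext = (\<lambda>g k. if k < ar f then g (is ! k) else e)"
  have mp: "map g is = map (ext g) [0..<ar f]" for g
    by (rule nth_equalityI) (auto simp: len ext_def)
  have "map (\<lambda>i. ops A m [y i, x i, z i]) is
      = map (\<lambda>k. ops A m [ext y k, ext x k, ext z k]) [0..<ar f]"
    by (rule nth_equalityI) (auto simp: len ext_def)
  moreover have "\<And>k. (ext y k, ext x k) \<in> \<alpha>" "\<And>k. ext z k \<in> univ A"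
    unfolding ext_def using yx z e con_refl[OF \<alpha> e] len by auto
  ultimately show ?thesis
    using central_difference_commutes_nat[OF A \<alpha> \<delta> C ar m1 m2, of "ext y" "ext x" "ext z" f]
    by (simp only: mp[of y] mp[of x] mp[of z])
qed

section \<open>Kernel algebras\<close>

locale kernel_alg = left_module R M for R :: "'r ring" and M :: "('r, 'b) module" +
  fixes ar :: "'f \<Rightarrow> nat" and m :: 'f and E :: "('f, 'b) alg"
  assumes kernel_algebra: "kernel_algebra ar m R M E"
begin

lemma univ_E: "univ E = carrier M"
  using kernel_algebra unfolding kernel_algebra_def by blast

lemma ops_m: "x \<in> carrier M \<Longrightarrow> y \<in> carrier M \<Longrightarrow> z \<in> carrier M \<Longrightarrow>
    ops E m [x, y, z] = (x \<ominus>\<^bsub>M\<^esub> y) \<oplus>\<^bsub>M\<^esub> z"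
  using kernel_algebra unfolding kernel_algebra_def by blast

lemma ops_linear:
  "\<exists>r. (\<forall>i < ar f. r i \<in> carrier R) \<and> (\<forall>xs. length xs = ar f \<longrightarrow> set xs \<subseteq> carrier M \<longrightarrow>
    ops E f xs = (\<Oplus>\<^bsub>M\<^esub>i \<in> {..<ar f}. r i \<odot>\<^bsub>M\<^esub> (xs ! i)))"
proof -
  from kernel_algebra obtain r where r: "r \<in> tuples (carrier R) (ar f)"
    and "\<forall>xs \<in> tuples (carrier M) (ar f). ops E f xs = (\<Oplus>\<^bsub>M\<^esub>i \<in> {..<ar f}. (r ! i) \<odot>\<^bsub>M\<^esub> (xs ! i))"
    unfolding kernel_algebra_def by blast
  then show ?thesis by (intro exI[of _ "\<lambda>i. r ! i"]) (auto simp: tuples_def)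
qed

lemma ops_E_closed:
  assumes "length xs = ar f" "\<And>x. x \<in> set xs \<Longrightarrow> x \<in> carrier M"
  shows "ops E f xs \<in> carrier M"
proof -
  obtain r where r: "\<And>i. i < ar f \<Longrightarrow> r i \<in> carrier R"
    and e: "\<And>xs. length xs = ar f \<Longrightarrow> set xs \<subseteq> carrier M \<Longrightarrow>
      ops E f xs = (\<Oplus>\<^bsub>M\<^esub>i \<in> {..<ar f}. r i \<odot>\<^bsub>M\<^esub> (xs ! i))"
    using ops_linear[of f] by blast
  have "ops E f xs = (\<Oplus>\<^bsub>M\<^esub>i \<in> {..<ar f}. r i \<odot>\<^bsub>M\<^esub> (xs ! i))"
    by (rule e) (use assms in auto)
  also have "\<dots> \<in> carrier M"
    using assms r by (intro M.finsum_closed) (auto intro!: smult_closed)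
  finally show ?thesis .
qed

lemma ualgebra_E: "ualgebra ar E"
  unfolding ualgebra_def subuniverse_def univ_E in_tuples
  using M.zero_closed by (auto intro!: ops_E_closed simp: in_tuples)

lemma ops_add:
  assumes "length is = ar f" "\<And>i. i \<in> set is \<Longrightarrow> g i \<in> carrier M" "\<And>i. i \<in> set is \<Longrightarrow> h i \<in> carrier M"
  shows "ops E f (map (\<lambda>i. g i \<oplus>\<^bsub>M\<^esub> h i) is) = ops E f (map g is) \<oplus>\<^bsub>M\<^esub> ops E f (map h is)"
proof -
  obtain r where r: "\<And>i. i < ar f \<Longrightarrow> r i \<in> carrier R"
    and e: "\<And>xs. length xs = ar f \<Longrightarrow> set xs \<subseteq> carrier M \<Longrightarrow>
      ops E f xs = (\<Oplus>\<^bsub>M\<^esub>i \<in> {..<ar f}. r i \<odot>\<^bsub>M\<^esub> (xs ! i))"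
    using ops_linear[of f] by blast
  have c: "g (is ! i) \<in> carrier M" "h (is ! i) \<in> carrier M" if "i < ar f" for i
    using that assms by auto
  have "ops E f (map (\<lambda>i. g i \<oplus>\<^bsub>M\<^esub> h i) is)
      = (\<Oplus>\<^bsub>M\<^esub>i \<in> {..<ar f}. r i \<odot>\<^bsub>M\<^esub> (map (\<lambda>i. g i \<oplus>\<^bsub>M\<^esub> h i) is ! i))"
    by (rule e) (use assms in auto)
  also have "\<dots> = (\<Oplus>\<^bsub>M\<^esub>i \<in> {..<ar f}. r i \<odot>\<^bsub>M\<^esub> g (is ! i) \<oplus>\<^bsub>M\<^esub> r i \<odot>\<^bsub>M\<^esub> h (is ! i))"
    using assms(1) c r by (intro M.finsum_cong') (auto simp: smult_r_distr intro!: smult_closed)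
  also have "\<dots> = (\<Oplus>\<^bsub>M\<^esub>i \<in> {..<ar f}. r i \<odot>\<^bsub>M\<^esub> g (is ! i)) \<oplus>\<^bsub>M\<^esub> (\<Oplus>\<^bsub>M\<^esub>i \<in> {..<ar f}. r i \<odot>\<^bsub>M\<^esub> h (is ! i))"
    using c r by (intro M.finsum_addf) (auto intro!: smult_closed)
  also have "(\<Oplus>\<^bsub>M\<^esub>i \<in> {..<ar f}. r i \<odot>\<^bsub>M\<^esub> g (is ! i)) = (\<Oplus>\<^bsub>M\<^esub>i \<in> {..<ar f}. r i \<odot>\<^bsub>M\<^esub> (map g is ! i))"
    using assms(1) c r by (intro M.finsum_cong') (auto intro!: smult_closed)
  also have "\<dots> = ops E f (map g is)"
    by (rule e[symmetric]) (use assms in auto)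
  also have "(\<Oplus>\<^bsub>M\<^esub>i \<in> {..<ar f}. r i \<odot>\<^bsub>M\<^esub> h (is ! i)) = (\<Oplus>\<^bsub>M\<^esub>i \<in> {..<ar f}. r i \<odot>\<^bsub>M\<^esub> (map h is ! i))"
    using assms(1) c r by (intro M.finsum_cong') (auto intro!: smult_closed)
  also have "\<dots> = ops E f (map h is)"
    by (rule e[symmetric]) (use assms in auto)
  finally show ?thesis .
qed

lemma ops_zero:
  assumes "length is = ar f"
  shows "ops E f (map (\<lambda>i. \<zero>\<^bsub>M\<^esub>) is) = \<zero>\<^bsub>M\<^esub>"
proof -
  have c: "ops E f (map (\<lambda>i. \<zero>\<^bsub>M\<^esub>) is) \<in> carrier M"
    by (rule ops_E_closed) (use assms in auto)
  have "ops E f (map (\<lambda>i. \<zero>\<^bsub>M\<^esub>) is) \<oplus>\<^bsub>M\<^esub> ops E f (map (\<lambda>i. \<zero>\<^bsub>M\<^esub>) is) = ops E f (map (\<lambda>i. \<zero>\<^bsub>M\<^esub>) is)"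
    using ops_add[OF assms, of "\<lambda>i. \<zero>\<^bsub>M\<^esub>" "\<lambda>i. \<zero>\<^bsub>M\<^esub>"] by simp
  then show ?thesis using c by simp
qed

lemma ops_neg:
  assumes "length is = ar f" "\<And>i. i \<in> set is \<Longrightarrow> g i \<in> carrier M"
  shows "ops E f (map (\<lambda>i. \<ominus>\<^bsub>M\<^esub> g i) is) = \<ominus>\<^bsub>M\<^esub> ops E f (map g is)"
proof -
  have c: "ops E f (map (\<lambda>i. \<ominus>\<^bsub>M\<^esub> g i) is) \<in> carrier M" "ops E f (map g is) \<in> carrier M"
    by (rule ops_E_closed; use assms in auto)+
  have "ops E f (map (\<lambda>i. \<ominus>\<^bsub>M\<^esub> g i) is) \<oplus>\<^bsub>M\<^esub> ops E f (map g is) = ops E f (map (\<lambda>i. \<zero>\<^bsub>M\<^esub>) is)"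
    using ops_add[OF assms(1), of "\<lambda>i. \<ominus>\<^bsub>M\<^esub> g i" g] assms(2)
    by (simp add: M.l_neg cong: map_cong)
  then show ?thesis using ops_zero[OF assms(1)] c by (simp add: M.minus_equality)
qed

lemma ops_diff:
  assumes "length is = ar f" "\<And>i. i \<in> set is \<Longrightarrow> g i \<in> carrier M" "\<And>i. i \<in> set is \<Longrightarrow> h i \<in> carrier M"
  shows "ops E f (map (\<lambda>i. g i \<ominus>\<^bsub>M\<^esub> h i) is) = ops E f (map g is) \<ominus>\<^bsub>M\<^esub> ops E f (map h is)"
  using ops_add[OF assms(1), of g "\<lambda>i. \<ominus>\<^bsub>M\<^esub> h i"] ops_neg[OF assms(1), of h] assms(2,3)
  by (simp add: M.minus_eq)

text \<open>Every operation of \<open>E\<close> is a module term, hence additive; this is why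
  pointwise sums and negatives of homomorphisms are homomorphisms.\<close>

lemma Hom0_comm_group:
  assumes A: "ualgebra ar A" and z: "z \<in> univ A"
  shows "comm_group (Hom0 ar A z M E)"
proof (rule comm_groupI)
  have cl: "\<phi> x \<in> carrier M" if "\<phi> \<in> alg_hom ar A E" "x \<in> univ A" for \<phi> x
    using that unfolding alg_hom_def univ_E by auto
  have hom: "\<phi> (ops A f xs) = ops E f (map \<phi> xs)" if "\<phi> \<in> alg_hom ar A E" "xs \<in> tuples (univ A) (ar f)" for \<phi> f xs
    using that unfolding alg_hom_def by auto
  have oc: "ops A f xs \<in> univ A" if "xs \<in> tuples (univ A) (ar f)" for f xs
    using that ops_closed[OF A] unfolding in_tuples by blast
  show "\<one>\<^bsub>Hom0 ar A z M E\<^esub> \<in> carrier (Hom0 ar A z M E)"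
    using z oc unfolding Hom0_def alg_hom_def univ_E
    by (auto simp: in_tuples ops_zero cong: map_cong)
  show "x \<otimes>\<^bsub>Hom0 ar A z M E\<^esub> y \<in> carrier (Hom0 ar A z M E)"
    if "x \<in> carrier (Hom0 ar A z M E)" "y \<in> carrier (Hom0 ar A z M E)" for x y
  proof -
    have h: "x \<in> alg_hom ar A E" "y \<in> alg_hom ar A E" and zz: "x z = \<zero>\<^bsub>M\<^esub>" "y z = \<zero>\<^bsub>M\<^esub>"
      using that unfolding Hom0_def by auto
    have "(\<lambda>a \<in> univ A. x a \<oplus>\<^bsub>M\<^esub> y a) (ops A f xs) = ops E f (map (\<lambda>a \<in> univ A. x a \<oplus>\<^bsub>M\<^esub> y a) xs)"
      if xs: "xs \<in> tuples (univ A) (ar f)" for f xs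
    proof -
      have "map (\<lambda>a \<in> univ A. x a \<oplus>\<^bsub>M\<^esub> y a) xs = map (\<lambda>a. x a \<oplus>\<^bsub>M\<^esub> y a) xs"
        using xs by (auto simp: in_tuples)
      moreover have "ops E f (map (\<lambda>a. x a \<oplus>\<^bsub>M\<^esub> y a) xs) = ops E f (map x xs) \<oplus>\<^bsub>M\<^esub> ops E f (map y xs)"
        by (rule ops_add) (use xs h cl in \<open>auto simp: in_tuples\<close>)
      ultimately show ?thesis using oc[OF xs] hom[OF h(1) xs] hom[OF h(2) xs] by (simp del: map_eq_conv)
    qed
    then show ?thesis using h zz z cl unfolding Hom0_def by (auto simp: alg_hom_def[of _ _ E] univ_E)
  qed
  show "\<exists>y \<in> carrier (Hom0 ar A z M E). y \<otimes>\<^bsub>Hom0 ar A z M E\<^esub> x = \<one>\<^bsub>Hom0 ar A z M E\<^esub>"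
    if "x \<in> carrier (Hom0 ar A z M E)" for x
  proof (rule bexI[of _ "\<lambda>a \<in> univ A. \<ominus>\<^bsub>M\<^esub> x a"])
    have h: "x \<in> alg_hom ar A E" and zz: "x z = \<zero>\<^bsub>M\<^esub>"
      using that unfolding Hom0_def by auto
    show "(\<lambda>a \<in> univ A. \<ominus>\<^bsub>M\<^esub> x a) \<otimes>\<^bsub>Hom0 ar A z M E\<^esub> x = \<one>\<^bsub>Hom0 ar A z M E\<^esub>"
      using cl[OF h] unfolding Hom0_def by (auto simp: M.l_neg)
    have "(\<lambda>a \<in> univ A. \<ominus>\<^bsub>M\<^esub> x a) (ops A f xs) = ops E f (map (\<lambda>a \<in> univ A. \<ominus>\<^bsub>M\<^esub> x a) xs)"
      if xs: "xs \<in> tuples (univ A) (ar f)" for f xs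
    proof -
      have "map (\<lambda>a \<in> univ A. \<ominus>\<^bsub>M\<^esub> x a) xs = map (\<lambda>a. \<ominus>\<^bsub>M\<^esub> x a) xs"
        using xs by (auto simp: in_tuples)
      moreover have "ops E f (map (\<lambda>a. \<ominus>\<^bsub>M\<^esub> x a) xs) = \<ominus>\<^bsub>M\<^esub> ops E f (map x xs)"
        by (rule ops_neg) (use xs h cl in \<open>auto simp: in_tuples\<close>)
      ultimately show ?thesis using oc[OF xs] hom[OF h xs] by (simp del: map_eq_conv)
    qed
    then show "(\<lambda>a \<in> univ A. \<ominus>\<^bsub>M\<^esub> x a) \<in> carrier (Hom0 ar A z M E)"
      using h zz z cl unfolding Hom0_def by (auto simp: alg_hom_def[of _ _ E] univ_E)
  qed
  show "x \<otimes>\<^bsub>Hom0 ar A z M E\<^esub> y \<otimes>\<^bsub>Hom0 ar A z M E\<^esub> w = x \<otimes>\<^bsub>Hom0 ar A z M E\<^esub> (y \<otimes>\<^bsub>Hom0 ar A z M E\<^esub> w)"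
    if "x \<in> carrier (Hom0 ar A z M E)" "y \<in> carrier (Hom0 ar A z M E)" "w \<in> carrier (Hom0 ar A z M E)" for x y w
    using that cl unfolding Hom0_def by (auto simp: M.a_assoc intro!: restrict_ext)
  show "x \<otimes>\<^bsub>Hom0 ar A z M E\<^esub> y = y \<otimes>\<^bsub>Hom0 ar A z M E\<^esub> x"
    if "x \<in> carrier (Hom0 ar A z M E)" "y \<in> carrier (Hom0 ar A z M E)" for x y
    using that cl unfolding Hom0_def by (auto simp: M.a_comm intro!: restrict_ext)
  show "\<one>\<^bsub>Hom0 ar A z M E\<^esub> \<otimes>\<^bsub>Hom0 ar A z M E\<^esub> x = x" if "x \<in> carrier (Hom0 ar A z M E)" for x
  proof -
    have h: "x \<in> alg_hom ar A E" using that unfolding Hom0_def by auto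
    then have "x \<in> extensional (univ A)" unfolding alg_hom_def by (auto simp: PiE_def)
    then show ?thesis using cl[OF h] unfolding Hom0_def
      by (auto intro!: extensionalityI[of _ "univ A"])
  qed
qed

end

text \<open>An abelian Mal'cev algebra with an idempotent element \<open>u\<close> is affine: the group is
  \<open>x + y = m(x,u,y)\<close> and the scalars are its additive endomorphisms.\<close>

locale affine_alg =
  fixes ar :: "'f \<Rightarrow> nat" and m :: 'f and A :: "('f, 'a) alg" and u :: 'a
  assumes alg: "ualgebra ar A" and ar_m: "ar m = 3"
    and idem: "idempotent_elem ar A u"
    and m1: "x \<in> univ A \<Longrightarrow> y \<in> univ A \<Longrightarrow> ops A m [x, x, y] = y"
    and m2: "x \<in> univ A \<Longrightarrow> y \<in> univ A \<Longrightarrow> ops A m [x, y, y] = x"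
    and commute: "ps \<in> tuples (univ A \<times> univ A \<times> univ A) (ar f) \<Longrightarrow>
      ops A f (map (\<lambda>(x, y, z). ops A m [x, y, z]) ps)
      = ops A m [ops A f (map fst ps), ops A f (map (fst \<circ> snd) ps), ops A f (map (snd \<circ> snd) ps)]"
begin

abbreviation "d x y z \<equiv> ops A m [x, y, z]"

lemma u_univ: "u \<in> univ A" and u_ops: "length is = ar f \<Longrightarrow> ops A f (map (\<lambda>i. u) is) = u"
  using idem unfolding idempotent_elem_def by (auto simp: map_replicate_const)

lemma d_closed: "x \<in> univ A \<Longrightarrow> y \<in> univ A \<Longrightarrow> z \<in> univ A \<Longrightarrow> d x y z \<in> univ A"
  by (rule ops_closed[OF alg]) (auto simp: ar_m)

lemma commute_map:
  assumes "length is = ar f" "\<And>i. i \<in> set is \<Longrightarrow> g i \<in> univ A"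
    "\<And>i. i \<in> set is \<Longrightarrow> h i \<in> univ A" "\<And>i. i \<in> set is \<Longrightarrow> k i \<in> univ A"
  shows "ops A f (map (\<lambda>i. d (g i) (h i) (k i)) is)
      = d (ops A f (map g is)) (ops A f (map h is)) (ops A f (map k is))"
  using commute[of "map (\<lambda>i. (g i, h i, k i)) is" f] assms by (auto simp: in_tuples comp_def)

text \<open>The case \<open>f = m\<close>: a 3 x 3 array may be evaluated by rows or by columns. The
  group laws below come from arrays with most entries equal to \<open>u\<close>.\<close>

lemma commute_m:
  assumes "{a1, a2, a3, b1, b2, b3, c1, c2, c3} \<subseteq> univ A"
  shows "d (d a1 b1 c1) (d a2 b2 c2) (d a3 b3 c3) = d (d a1 a2 a3) (d b1 b2 b3) (d c1 c2 c3)"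
  using commute[of "[(a1, b1, c1), (a2, b2, c2), (a3, b3, c3)]" m] assms by (auto simp: in_tuples ar_m)

abbreviation "endos \<equiv> {r \<in> univ A \<rightarrow>\<^sub>E univ A. \<forall>x \<in> univ A. \<forall>y \<in> univ A. r (d x u y) = d (r x) u (r y)}"

text \<open>The carrier has the function type that \<open>is_kernel_algebra\<close> prescribes for
  the ring, and extensionality on \<open>univ A\<close> turns the ring laws into equations between
  functions.\<close>

definition endo_ring :: "('a \<Rightarrow> 'a) ring" where
  "endo_ring = \<lparr>carrier = endos, mult = (\<lambda>r s. \<lambda>x \<in> univ A. r (s x)), one = (\<lambda>x \<in> univ A. x),
     zero = (\<lambda>x \<in> univ A. u), add = (\<lambda>r s. \<lambda>x \<in> univ A. d (r x) u (s x))\<rparr>"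

definition endo_module :: "('a \<Rightarrow> 'a, 'a) module" where
  "endo_module = \<lparr>carrier = univ A, mult = (\<lambda>x y. x), one = u, zero = u, add = (\<lambda>x y. d x u y),
     smult = (\<lambda>r x. r x)\<rparr>"

lemma plus_comm: "x \<in> univ A \<Longrightarrow> y \<in> univ A \<Longrightarrow> d x u y = d y u x"
  using commute_m[of u u y u u u x u u] u_univ by (simp add: m1 m2)

lemma plus_assoc:
  "x \<in> univ A \<Longrightarrow> y \<in> univ A \<Longrightarrow> z \<in> univ A \<Longrightarrow> d (d x u y) u z = d x u (d y u z)"
  using commute_m[of x u u u u u y u z] u_univ
  using commute_m[of x u u u u z y u u] commute_m[of x u y u u u u u z] by (simp add: m1 m2)

lemma plus_neg: "x \<in> univ A \<Longrightarrow> d (d u x u) u x = u"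
  using commute_m[of u u u x u u u u x] commute_m[of u u x x u u u u u]
    commute_m[of u u u x u x u u u] u_univ by (simp add: m1 m2)

lemma endo_module_group: "abelian_group endo_module"
proof (rule abelian_groupI)
  show "\<exists>y \<in> carrier endo_module. y \<oplus>\<^bsub>endo_module\<^esub> x = \<zero>\<^bsub>endo_module\<^esub>"
    if "x \<in> carrier endo_module" for x
    using that plus_neg u_univ d_closed by (intro bexI[of _ "d u x u"]) (auto simp: endo_module_def)
qed (auto simp: endo_module_def d_closed u_univ plus_assoc m1 intro: plus_comm)

lemma endo_add_closed:
  assumes "r \<in> endos" "s \<in> endos"
  shows "(\<lambda>x \<in> univ A. d (r x) u (s x)) \<in> endos"
proof -
  have "d (r (d x u y)) u (s (d x u y)) = d (d (r x) u (s x)) u (d (r y) u (s y))"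
    if "x \<in> univ A" "y \<in> univ A" for x y
  proof -
    have "r x \<in> univ A" "r y \<in> univ A" "s x \<in> univ A" "s y \<in> univ A" using assms that by auto
    then show ?thesis
      using commute_m[of "r x" u "r y" u u u "s x" u "s y"] assms that u_univ by (simp add: m1)
  qed
  moreover have "r x \<in> univ A" "s x \<in> univ A" if "x \<in> univ A" for x
    using assms that by auto
  ultimately show ?thesis using d_closed u_univ assms by simp
qed

lemma endo_neg_closed:
  assumes "r \<in> endos"
  shows "(\<lambda>x \<in> univ A. d u (r x) u) \<in> endos"
proof -
  have "d u (r (d x u y)) u = d (d u (r x) u) u (d u (r y) u)"
    if "x \<in> univ A" "y \<in> univ A" for x y
  proof -
    have "r x \<in> univ A" "r y \<in> univ A" using assms that by auto
    then show ?thesis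
      using commute_m[of u u u "r x" u "r y" u u u] assms that u_univ by (simp add: m1)
  qed
  moreover have "r x \<in> univ A" if "x \<in> univ A" for x
    using assms that by auto
  ultimately show ?thesis using d_closed u_univ assms by simp
qed

lemma endo_ring_ops:
  "r \<oplus>\<^bsub>endo_ring\<^esub> s = (\<lambda>x \<in> univ A. d (r x) u (s x))"
  "r \<otimes>\<^bsub>endo_ring\<^esub> s = (\<lambda>x \<in> univ A. r (s x))"
  "\<zero>\<^bsub>endo_ring\<^esub> = (\<lambda>x \<in> univ A. u)" "\<one>\<^bsub>endo_ring\<^esub> = (\<lambda>x \<in> univ A. x)"
  by (simp_all add: endo_ring_def)

lemma endo_ringD:
  assumes "r \<in> carrier endo_ring"
  shows "x \<in> univ A \<Longrightarrow> r x \<in> univ A" "r \<in> extensional (univ A)"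
    "x \<in> univ A \<Longrightarrow> y \<in> univ A \<Longrightarrow> r (d x u y) = d (r x) u (r y)"
  using assms unfolding endo_ring_def by (auto simp: PiE_def)

lemma endo_ring_ring: "ring endo_ring"
proof (rule ringI)
  show "abelian_group endo_ring"
  proof (rule abelian_groupI)
    show "r \<oplus>\<^bsub>endo_ring\<^esub> s \<in> carrier endo_ring" if "r \<in> carrier endo_ring" "s \<in> carrier endo_ring" for r s
      using endo_add_closed that unfolding endo_ring_def by simp
    show "\<exists>y \<in> carrier endo_ring. y \<oplus>\<^bsub>endo_ring\<^esub> r = \<zero>\<^bsub>endo_ring\<^esub>" if "r \<in> carrier endo_ring" for r
    proof (rule bexI[of _ "\<lambda>x \<in> univ A. d u (r x) u"])
      show "(\<lambda>x \<in> univ A. d u (r x) u) \<in> carrier endo_ring"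
        using that endo_neg_closed[of r] by (simp add: endo_ring_def)
    qed (use endo_ringD(1)[OF that] in \<open>auto simp: endo_ring_ops plus_neg intro!: restrict_ext\<close>)
    show "\<zero>\<^bsub>endo_ring\<^esub> \<oplus>\<^bsub>endo_ring\<^esub> r = r" if "r \<in> carrier endo_ring" for r
      using endo_ringD[OF that]
      by (auto simp: endo_ring_ops u_univ m1 intro!: extensionalityI[of _ "univ A"])
    show "\<zero>\<^bsub>endo_ring\<^esub> \<in> carrier endo_ring" by (auto simp: endo_ring_def u_univ m1 d_closed)
  qed (auto simp: endo_ring_ops d_closed u_univ endo_ringD(1) plus_assoc intro: plus_comm endo_ringD(1) intro!: restrict_ext)
  show "monoid endo_ring"
  proof (rule monoidI)
    show "r \<otimes>\<^bsub>endo_ring\<^esub> s \<in> carrier endo_ring" if "r \<in> carrier endo_ring" "s \<in> carrier endo_ring" for r s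
      using endo_ringD[OF that(1)] endo_ringD[OF that(2)]
      by (simp add: endo_ring_ops) (simp add: endo_ring_def d_closed u_univ)
    show "\<one>\<^bsub>endo_ring\<^esub> \<in> carrier endo_ring" by (auto simp: endo_ring_def d_closed u_univ)
    show "\<one>\<^bsub>endo_ring\<^esub> \<otimes>\<^bsub>endo_ring\<^esub> r = r" "r \<otimes>\<^bsub>endo_ring\<^esub> \<one>\<^bsub>endo_ring\<^esub> = r" if "r \<in> carrier endo_ring" for r
      using endo_ringD[OF that] by (auto simp: endo_ring_ops intro!: extensionalityI[of _ "univ A"])
  qed (auto simp: endo_ring_ops endo_ringD(1) intro!: restrict_ext)
qed (auto simp: endo_ring_ops endo_ringD(1,3) d_closed u_univ intro!: restrict_ext)

lemma endo_left_module: "left_module endo_ring endo_module"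
proof -
  interpret R: ring endo_ring by (rule endo_ring_ring)
  interpret M: abelian_group endo_module by (rule endo_module_group)
  show ?thesis by unfold_locales (auto simp: endo_ring_def endo_module_def)
qed

text \<open>An operation commutes with \<open>m\<close> and fixes \<open>u\<close>, so it is
  additive. The induction fills the coordinates one at a time: the list with \<open>Suc k\<close>
  entries is the pointwise sum of a list supported at \<open>k\<close> and the list with
  \<open>k\<close> entries.\<close>

lemma ops_eq_finsum:
  assumes xs: "length xs = ar f" "set xs \<subseteq> univ A"
  shows "ops A f xs = (\<Oplus>\<^bsub>endo_module\<^esub>i \<in> {..<ar f}.
    ops A f (map (\<lambda>j. if j = i then xs ! i else u) [0..<ar f]))"
proof -
  interpret M: abelian_group endo_module by (rule endo_module_group)
  have xu: "xs ! i \<in> univ A" if "i < ar f" for i using xs that by auto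
  have "ops A f (map (\<lambda>j. if j < k then xs ! j else u) [0..<ar f]) = (\<Oplus>\<^bsub>endo_module\<^esub>i \<in> {..<k}.
    ops A f (map (\<lambda>j. if j = i then xs ! i else u) [0..<ar f]))" if "k \<le> ar f" for k
    using that
  proof (induction k)
    case 0
    then show ?case using u_ops[of "[0..<ar f]" f]
      by (simp only: lessThan_0 M.finsum_empty not_less_zero if_False) (simp add: endo_module_def)
  next
    case (Suc k)
    let ?p = "\<lambda>j. if j = k then xs ! k else u" and ?q = "\<lambda>j. if j < k then xs ! j else u"
    have "map (\<lambda>j. if j < Suc k then xs ! j else u) [0..<ar f] = map (\<lambda>j. d (?p j) u (?q j)) [0..<ar f]"
      using xu u_univ by (auto simp: m1 m2 less_Suc_eq)
    then have "ops A f (map (\<lambda>j. if j < Suc k then xs ! j else u) [0..<ar f])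
        = d (ops A f (map ?p [0..<ar f])) u (ops A f (map ?q [0..<ar f]))"
      using commute_map[of "[0..<ar f]" f ?p "\<lambda>j. u" ?q] xu u_univ u_ops[of "[0..<ar f]" f] Suc.prems
      by (simp del: map_eq_conv)
    also have "\<dots> = (\<Oplus>\<^bsub>endo_module\<^esub>i \<in> {..<Suc k}.
        ops A f (map (\<lambda>j. if j = i then xs ! i else u) [0..<ar f]))"
      unfolding lessThan_Suc using Suc xu u_univ
      by (subst M.finsum_insert) (auto simp: endo_module_def intro!: ops_closed[OF alg])
    finally show ?case .
  qed
  note e = this[of "ar f", OF order_refl]
  have eq: "map (\<lambda>j. if j < ar f then xs ! j else u) [0..<ar f] = xs"
    by (rule nth_equalityI) (auto simp: xs)
  show ?thesis using e unfolding eq .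
qed

lemma is_kernel_algebra: "is_kernel_algebra ar m A"
  unfolding is_kernel_algebra_def
proof (intro exI)
  interpret M: left_module endo_ring endo_module by (rule endo_left_module)
  show "kernel_algebra ar m endo_ring endo_module A"
    unfolding kernel_algebra_def
  proof (intro conjI allI ballI)
    show "univ A = carrier endo_module" by (simp add: endo_module_def)
  next
    fix f
    \<comment> \<open>The i-th scalar is \<open>f\<close> restricted to its i-th coordinate axis,
      with the zero \<open>u\<close> at the other places.\<close>
    define r where "r = map (\<lambda>i. \<lambda>x \<in> univ A. ops A f (map (\<lambda>j. if j = i then x else u) [0..<ar f])) [0..<ar f]"
    show "\<exists>r \<in> tuples (carrier endo_ring) (ar f). \<forall>xs \<in> tuples (carrier endo_module) (ar f).
        ops A f xs = (\<Oplus>\<^bsub>endo_module\<^esub>i \<in> {..<ar f}. (r ! i) \<odot>\<^bsub>endo_module\<^esub> (xs ! i))"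
    proof (rule bexI[of _ r], rule ballI)
      have "ops A f (map (\<lambda>j. if j = i then d x u y else u) [0..<ar f])
          = d (ops A f (map (\<lambda>j. if j = i then x else u) [0..<ar f])) u
              (ops A f (map (\<lambda>j. if j = i then y else u) [0..<ar f]))"
        if "x \<in> univ A" "y \<in> univ A" for i x y
      proof -
        have "map (\<lambda>j. if j = i then d x u y else u) [0..<ar f] =
            map (\<lambda>j. d (if j = i then x else u) u (if j = i then y else u)) [0..<ar f]"
          using u_univ by (auto simp: m1)
        then show ?thesis
          using commute_map[of "[0..<ar f]" f "\<lambda>j. if j = i then x else u" "\<lambda>j. u" "\<lambda>j. if j = i then y else u"]
            that u_univ u_ops[of "[0..<ar f]" f] by (simp del: map_eq_conv)
      qed
      moreover have "ops A f (map (\<lambda>j. if j = i then x else u) [0..<ar f]) \<in> univ A"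
        if "x \<in> univ A" for i x
        by (rule ops_closed[OF alg]) (use that u_univ in auto)
      ultimately show "r \<in> tuples (carrier endo_ring) (ar f)"
        using d_closed u_univ unfolding r_def by (auto simp: in_tuples endo_ring_def)
      fix xs assume xs: "xs \<in> tuples (carrier endo_module) (ar f)"
      then have xu: "length xs = ar f" "set xs \<subseteq> univ A" by (auto simp: tuples_def endo_module_def)
      show "ops A f xs = (\<Oplus>\<^bsub>endo_module\<^esub>i \<in> {..<ar f}. (r ! i) \<odot>\<^bsub>endo_module\<^esub> (xs ! i))"
        unfolding ops_eq_finsum[OF xu]
        by (rule M.M.finsum_cong')
           (use xu u_univ in \<open>auto simp: r_def endo_module_def subset_iff intro!: ops_closed[OF alg]\<close>)
    qed
  next
    fix x y z
    assume "x \<in> carrier endo_module" "y \<in> carrier endo_module" "z \<in> carrier endo_module"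
    then have c: "x \<in> univ A" "y \<in> univ A" "z \<in> univ A" by (auto simp: endo_module_def)
    \<comment> \<open>It remains to see that x - y + z, formed in the group derived from
      \<open>m\<close>, gives back \<open>m\<close>; -y is d u y u.\<close>
    have "\<ominus>\<^bsub>endo_module\<^esub> y = d u y u"
      by (rule M.M.minus_equality) (use c plus_neg d_closed u_univ in \<open>auto simp: endo_module_def\<close>)
    then have "(x \<ominus>\<^bsub>endo_module\<^esub> y) \<oplus>\<^bsub>endo_module\<^esub> z = d (d x u (d u y u)) u z"
      by (simp add: a_minus_def endo_module_def)
    also have "d x u (d u y u) = d x y u"
      using commute_m[of x u u u y u u u u] commute_m[of x u u u u y u u u] c u_univ
      by (simp add: m1 m2)
    also have "d (d x y u) u z = d x y z"
      using commute_m[of x u u y u u u u z] commute_m[of x y u u u u u u z] c u_univ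
      by (simp add: m1 m2)
    finally show "d x y z = (x \<ominus>\<^bsub>endo_module\<^esub> y) \<oplus>\<^bsub>endo_module\<^esub> z" by simp
  qed (rule endo_left_module)
qed

end

text \<open>Precomposition with \<open>k\<close>, inverted by precomposition with its inverse
  \<open>j\<close>. That \<open>j\<close> respects the operations, and that these keep
  \<open>univ B\<close> closed, is carried over from \<open>A\<close> along
  \<open>k\<close>.\<close>

lemma Hom0_iso:
  assumes A: "ualgebra ar A" and k: "k \<in> alg_hom ar A B" "bij_betw k (univ A) (univ B)"
    and z: "z \<in> univ A" "k z = w"
  shows "Hom0 ar B w M E \<cong> Hom0 ar A z M E"
proof -
  define j where "j = inv_into (univ A) k"
  have kc: "k x \<in> univ B" if "x \<in> univ A" for x using k(2) that by (rule bij_betw_apply)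
  have jc: "j y \<in> univ A" and kj: "k (j y) = y" if "y \<in> univ B" for y
    using k(2) that unfolding j_def by (auto simp: bij_betw_def inv_into_into f_inv_into_f)
  have jk: "j (k x) = x" if "x \<in> univ A" for x
    using k(2) that unfolding j_def by (auto simp: bij_betw_def)
  have kh: "k (ops A f xs) = ops B f (map k xs)" if "xs \<in> tuples (univ A) (ar f)" for f xs
    using k(1) that unfolding alg_hom_def by blast
  have Ac: "ops A f xs \<in> univ A" if "xs \<in> tuples (univ A) (ar f)" for f xs
    using that by (auto simp: in_tuples intro: ops_closed[OF A])
  have jh: "ops B f ys \<in> univ B" "j (ops B f ys) = ops A f (map j ys)"
    if "ys \<in> tuples (univ B) (ar f)" for f ys
  proof -
    have t: "map j ys \<in> tuples (univ A) (ar f)" using that jc by (auto simp: in_tuples)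
    have "map k (map j ys) = ys" using that kj by (auto simp: in_tuples intro!: map_idI)
    with kh[OF t] have e: "k (ops A f (map j ys)) = ops B f ys" by simp
    show "ops B f ys \<in> univ B" "j (ops B f ys) = ops A f (map j ys)"
      using kc[OF Ac[OF t]] jk[OF Ac[OF t]] e by auto
  qed
  define \<Theta> where "\<Theta> = (\<lambda>\<phi>. \<lambda>x \<in> univ A. \<phi> (k x) :: 'd)"
  define \<Xi> where "\<Xi> = (\<lambda>\<psi>. \<lambda>y \<in> univ B. \<psi> (j y) :: 'd)"
  have c1: "\<Theta> \<phi> \<in> carrier (Hom0 ar A z M E)" if "\<phi> \<in> carrier (Hom0 ar B w M E)" for \<phi>
  proof -
    have "\<Theta> \<phi> (ops A f xs) = ops E f (map (\<Theta> \<phi>) xs)" if xs: "xs \<in> tuples (univ A) (ar f)" for f xs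
    proof -
      have "map k xs \<in> tuples (univ B) (ar f)" using xs kc by (auto simp: in_tuples)
      then have "\<phi> (ops B f (map k xs)) = ops E f (map \<phi> (map k xs))"
        using \<open>\<phi> \<in> carrier _\<close> unfolding Hom0_def alg_hom_def by auto
      moreover have "map \<phi> (map k xs) = map (\<Theta> \<phi>) xs"
        using xs unfolding \<Theta>_def by (auto simp: in_tuples)
      ultimately show ?thesis using kh[OF xs] Ac[OF xs] unfolding \<Theta>_def by (simp del: map_eq_conv)
    qed
    then show ?thesis using that kc z unfolding Hom0_def
      by (auto simp: alg_hom_def) (auto simp: \<Theta>_def)
  qed
  have c2: "\<Xi> \<psi> \<in> carrier (Hom0 ar B w M E)" if "\<psi> \<in> carrier (Hom0 ar A z M E)" for \<psi>
  proof -
    have "\<Xi> \<psi> (ops B f xs) = ops E f (map (\<Xi> \<psi>) xs)" if xs: "xs \<in> tuples (univ B) (ar f)" for f xs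
    proof -
      have "map j xs \<in> tuples (univ A) (ar f)" using xs jc by (auto simp: in_tuples)
      then have "\<psi> (ops A f (map j xs)) = ops E f (map \<psi> (map j xs))"
        using \<open>\<psi> \<in> carrier _\<close> unfolding Hom0_def alg_hom_def by auto
      moreover have "map \<psi> (map j xs) = map (\<Xi> \<psi>) xs"
        using xs unfolding \<Xi>_def by (auto simp: in_tuples)
      ultimately show ?thesis using jh[OF xs] unfolding \<Xi>_def by (simp del: map_eq_conv)
    qed
    then show ?thesis using that jc z kc jk unfolding Hom0_def
      by (auto simp: alg_hom_def) (auto simp: \<Xi>_def)
  qed
  have "bij_betw \<Theta> (carrier (Hom0 ar B w M E)) (carrier (Hom0 ar A z M E))"
  proof (rule bij_betw_byWitness[where f' = \<Xi>])
    show "\<forall>\<phi> \<in> carrier (Hom0 ar B w M E). \<Xi> (\<Theta> \<phi>) = \<phi>"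
      using jc kj unfolding \<Xi>_def \<Theta>_def Hom0_def alg_hom_def
      by (auto simp: PiE_def intro!: extensionalityI[of _ "univ B"])
    show "\<forall>\<psi> \<in> carrier (Hom0 ar A z M E). \<Theta> (\<Xi> \<psi>) = \<psi>"
      using kc jk unfolding \<Xi>_def \<Theta>_def Hom0_def alg_hom_def
      by (auto simp: PiE_def intro!: extensionalityI[of _ "univ A"])
  qed (use c1 c2 in auto)
  moreover have "\<Theta> \<in> hom (Hom0 ar B w M E) (Hom0 ar A z M E)"
    using c1 kc by (auto simp: hom_def Hom0_def \<Theta>_def intro!: restrict_ext)
  ultimately show ?thesis unfolding is_iso_def iso_def by blast
qed

text \<open>\<open>quot\<close> evaluates on representatives picked by choice; each is congruent to
  the given element, and a congruence respects the operations.\<close>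

lemma quot_ops:
  assumes A: "\<alpha> \<in> con ar A" and xs: "length xs = ar f" "\<And>x. x \<in> set xs \<Longrightarrow> x \<in> univ A"
  shows "ops (quot A \<alpha>) f (map (\<lambda>x. \<alpha> `` {x}) xs) = \<alpha> `` {ops A f xs}"
proof -
  have "((SOME y. y \<in> \<alpha> `` {x}), x) \<in> \<alpha>" if "x \<in> univ A" for x
    using someI[of "\<lambda>y. y \<in> \<alpha> `` {x}" x] con_refl[OF A that] con_sym[OF A] by blast
  then have "(ops A f (map (\<lambda>x. SOME y. y \<in> \<alpha> `` {x}) xs), ops A f (map (\<lambda>x. x) xs)) \<in> \<alpha>"
    using xs by (intro con_ops_map[OF A]) auto
  then show ?thesis
    using equiv_class_eq[OF con_equiv[OF A]] by (simp add: quot_def comp_def)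
qed

text \<open>An operation applied to elements congruent to \<open>u\<close> gives a value congruent
  to f(u, ..., u) = u.\<close>

lemma class_alg_ualgebra:
  assumes "\<gamma> \<in> con ar A" "idempotent_elem ar A u"
  shows "ualgebra ar (class_alg A \<gamma> u)"
proof -
  have u: "u \<in> univ A" "\<And>f. ops A f (replicate (ar f) u) = u"
    using assms(2) unfolding idempotent_elem_def by auto
  have "(u, ops A f xs) \<in> \<gamma>" if "xs \<in> tuples (\<gamma> `` {u}) (ar f)" for f xs
  proof -
    have "(ops A f (map (\<lambda>x. u) xs), ops A f (map (\<lambda>x. x) xs)) \<in> \<gamma>"
      using that by (intro con_ops_map[OF assms(1)]) (auto simp: in_tuples)
    then show ?thesis using that u by (simp add: map_replicate_const in_tuples)
  qed
  then show ?thesis using con_refl[OF assms(1) u(1)]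
    unfolding ualgebra_def subuniverse_def class_alg_def by auto
qed

section \<open>The kernel algebra of a central congruence\<close>

text \<open>Centrality of \<alpha> is expressed by its effects \<open>m2\<close> and
  \<open>commute\<close> on \<open>m\<close>. For \<theta>/[\<theta>,1] these are inherited from
  facts about \<open>F\<close> modulo [\<theta>,1], which avoids computing a commutator in the
  quotient.\<close>

locale central_class =
  fixes ar :: "'f \<Rightarrow> nat" and m :: 'f and A :: "('f, 'a) alg" and \<alpha> :: "('a \<times> 'a) set" and u :: 'a
  assumes alg: "ualgebra ar A" and ar_m: "ar m = 3" and \<alpha>: "\<alpha> \<in> con ar A"
    and idem: "idempotent_elem ar A u"
    and m1: "x \<in> univ A \<Longrightarrow> y \<in> univ A \<Longrightarrow> ops A m [x, x, y] = y"
    and m2: "(x, y) \<in> \<alpha> \<Longrightarrow> ops A m [x, y, y] = x"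
    and commute: "ps \<in> tuples \<alpha> (ar f) \<Longrightarrow> ops A f (map (\<lambda>(x, y). ops A m [x, y, u]) ps)
      = ops A m [ops A f (map fst ps), ops A f (map snd ps), u]"
begin

lemma u_univ: "u \<in> univ A" and u_ops: "length is = ar f \<Longrightarrow> ops A f (map (\<lambda>i. u) is) = u"
  using idem unfolding idempotent_elem_def by (auto simp: map_replicate_const)

abbreviation "same_difference \<equiv>
  {((x, y), (x', y')). (x, y) \<in> \<alpha> \<and> (x', y') \<in> \<alpha> \<and> ops A m [x, y, u] = ops A m [x', y', u]}"

lemma con_alg_ops: "ps \<in> tuples \<alpha> (ar f) \<Longrightarrow> ops (con_alg A \<alpha>) f ps \<in> \<alpha>"
  unfolding con_alg_def by (auto simp: in_tuples intro!: con_ops_map[OF \<alpha>])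

lemma same_difference_con: "same_difference \<in> con ar (con_alg A \<alpha>)"
proof -
  have "equiv (univ (con_alg A \<alpha>)) same_difference"
    unfolding con_alg_def by (rule equivI) (auto simp: refl_on_def sym_def trans_def)
  moreover have "(ops (con_alg A \<alpha>) f ps, ops (con_alg A \<alpha>) f qs) \<in> same_difference"
    if ps: "ps \<in> tuples \<alpha> (ar f)" and qs: "qs \<in> tuples \<alpha> (ar f)"
      and s: "list_all2 (\<lambda>x y. (x, y) \<in> same_difference) ps qs" for f ps qs
  proof -
    have "map (\<lambda>(x, y). ops A m [x, y, u]) ps = map (\<lambda>(x, y). ops A m [x, y, u]) qs"
      using s by (auto simp: list_all2_conv_all_nth split: prod.splits intro!: nth_equalityI)
    then show ?thesis
      using commute[OF ps] commute[OF qs] con_alg_ops[OF ps] con_alg_ops[OF qs]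
      by (simp add: con_alg_def)
  qed
  ultimately show ?thesis unfolding con_def by (simp add: con_alg_def)
qed

text \<open>A pair (x, y) stands for the difference x - y. All diagonal pairs have difference
  \<open>u\<close>, so the congruence \<open>same_difference\<close> contains the generators.
  Conversely each pair is \<open>Delta1\<close>-related to the normal form (m(x, y, u), u), which
  depends on the difference alone.\<close>

lemma Delta1_eq: "Delta1 ar A \<alpha> = same_difference"
proof
  have N: "same_difference \<in> {\<beta> \<in> con ar (con_alg A \<alpha>). {((a, a), (b, b)) | a b. a \<in> univ A \<and> b \<in> univ A} \<subseteq> \<beta>}"
    using same_difference_con by (auto simp: m1 u_univ con_refl[OF \<alpha>])
  then show "Delta1 ar A \<alpha> \<subseteq> same_difference" unfolding Delta1_def cg_def by (rule Inter_lower)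
  have \<Delta>: "Delta1 ar A \<alpha> \<in> con ar (con_alg A \<alpha>)"
    unfolding Delta1_def cg_def by (rule con_Inter) (use N in auto)
  have diag: "((a, a), (b, b)) \<in> Delta1 ar A \<alpha>" if "a \<in> univ A" "b \<in> univ A" for a b
    using that unfolding Delta1_def cg_def by auto
  \<comment> \<open>Apply \<open>m\<close> to (x, y), (y, y) and a third pair taken from the
    diagonal: (y, y) gives back (x, y), while (u, u) gives the normal form.\<close>
  have norm: "((x, y), (ops A m [x, y, u], u)) \<in> Delta1 ar A \<alpha>" if xy: "(x, y) \<in> \<alpha>" for x y
  proof -
    have y: "y \<in> univ A" using con_in[OF \<alpha> xy] by simp
    have "(ops (con_alg A \<alpha>) m [(x, y), (y, y), (y, y)], ops (con_alg A \<alpha>) m [(x, y), (y, y), (u, u)])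
        \<in> Delta1 ar A \<alpha>"
      using xy y diag u_univ con_refl[OF \<Delta>, of "(x, y)"]
      by (intro con_ops[OF \<Delta>]) (auto simp: ar_m con_alg_def)
    then show ?thesis using m1 m2 xy y u_univ by (simp add: con_alg_def)
  qed
  show "same_difference \<subseteq> Delta1 ar A \<alpha>"
  proof clarify
    fix x y x' y' assume "(x, y) \<in> \<alpha>" "(x', y') \<in> \<alpha>" "ops A m [x, y, u] = ops A m [x', y', u]"
    then show "((x, y), (x', y')) \<in> Delta1 ar A \<alpha>"
      using con_trans[OF \<Delta> norm con_sym[OF \<Delta>], of x y "(x', y')"] norm[of x' y'] by simp
  qed
qed

lemma kappa_eq_iff:
  "p \<in> \<alpha> \<Longrightarrow> q \<in> \<alpha> \<Longrightarrow> kappa ar A \<alpha> p = kappa ar A \<alpha> q \<longleftrightarrow>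
    ops A m [fst p, snd p, u] = ops A m [fst q, snd q, u]"
  unfolding kappa_def Delta1_eq
  by (subst con_Image_eq_iff[OF same_difference_con]) (auto simp: con_alg_def)

definition kappa_u :: "('a \<times> 'a) set \<Rightarrow> 'a \<Rightarrow> ('a \<times> 'a) set" where
  "kappa_u \<gamma> = (\<lambda>x \<in> \<gamma> `` {u}. kappa ar A \<alpha> (x, u))"

lemma kappa_u_bij:
  assumes \<gamma>: "\<gamma> \<in> con ar A" "\<gamma> \<subseteq> \<alpha>"
  shows "bij_betw (kappa_u \<gamma>) (univ (class_alg A \<gamma> u)) (univ (kappa_image ar A \<alpha> \<gamma>))"
  unfolding bij_betw_def
proof
  have xu: "(x, u) \<in> \<gamma>" if "x \<in> \<gamma> `` {u}" for x using that con_sym[OF \<gamma>(1)] by blast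
  show "inj_on (kappa_u \<gamma>) (univ (class_alg A \<gamma> u))"
  proof (rule inj_onI)
    fix x y assume "x \<in> univ (class_alg A \<gamma> u)" "y \<in> univ (class_alg A \<gamma> u)" "kappa_u \<gamma> x = kappa_u \<gamma> y"
    then have "ops A m [x, u, u] = ops A m [y, u, u]" "(x, u) \<in> \<alpha>" "(y, u) \<in> \<alpha>"
      using kappa_eq_iff[of "(x, u)" "(y, u)"] xu \<gamma>(2) unfolding kappa_u_def class_alg_def
      by (auto simp: subset_iff)
    then show "x = y" using m2 by simp
  qed
  show "kappa_u \<gamma> ` univ (class_alg A \<gamma> u) = univ (kappa_image ar A \<alpha> \<gamma>)"
  proof
    show "kappa_u \<gamma> ` univ (class_alg A \<gamma> u) \<subseteq> univ (kappa_image ar A \<alpha> \<gamma>)"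
      using xu by (auto simp: kappa_u_def class_alg_def kappa_image_def)
    show "univ (kappa_image ar A \<alpha> \<gamma>) \<subseteq> kappa_u \<gamma> ` univ (class_alg A \<gamma> u)"
    proof
      fix c assume "c \<in> univ (kappa_image ar A \<alpha> \<gamma>)"
      then obtain x y where c: "c = kappa ar A \<alpha> (x, y)" and xy: "(x, y) \<in> \<gamma>"
        unfolding kappa_image_def by auto
      have y: "y \<in> univ A" using con_in[OF \<gamma>(1) xy] by simp
      have "(ops A m [x, y, u], ops A m [y, y, u]) \<in> \<gamma>"
        using xy con_refl[OF \<gamma>(1)] y u_univ by (intro con_ops[OF \<gamma>(1)]) (auto simp: ar_m)
      then have g: "(ops A m [x, y, u], u) \<in> \<gamma>" using m1 y u_univ by simp
      then have "kappa ar A \<alpha> (ops A m [x, y, u], u) = c"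
        unfolding c using \<gamma>(2) xy m2 by (subst kappa_eq_iff) auto
      then show "c \<in> kappa_u \<gamma> ` univ (class_alg A \<gamma> u)"
        using con_sym[OF \<gamma>(1) g] unfolding kappa_u_def class_alg_def by (auto intro!: image_eqI)
    qed
  qed
qed

text \<open>Since \<open>u\<close> is idempotent, an operation applied to pairs with second entry
  \<open>u\<close> again has second entry \<open>u\<close>.\<close>

lemma kappa_u_hom:
  assumes \<gamma>: "\<gamma> \<in> con ar A" "\<gamma> \<subseteq> \<alpha>"
  shows "kappa_u \<gamma> \<in> alg_hom ar (class_alg A \<gamma> u) (kappa_image ar A \<alpha> \<gamma>)"
proof -
  have "kappa_u \<gamma> (ops A f xs) = ops (kappa_image ar A \<alpha> \<gamma>) f (map (kappa_u \<gamma>) xs)"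
    if xs: "xs \<in> tuples (\<gamma> `` {u}) (ar f)" for f xs
  proof -
    have D: "Delta1 ar A \<alpha> \<in> con ar (con_alg A \<alpha>)" unfolding Delta1_eq by (rule same_difference_con)
    have xu: "(x, u) \<in> \<alpha>" if "x \<in> set xs" for x
      using that xs \<gamma>(2) con_sym[OF \<gamma>(1)] by (auto simp: in_tuples)
    have "map (kappa_u \<gamma>) xs = map (\<lambda>p. Delta1 ar A \<alpha> `` {p}) (map (\<lambda>x. (x, u)) xs)"
      using xs by (auto simp: in_tuples kappa_u_def kappa_def)
    then have "ops (kappa_image ar A \<alpha> \<gamma>) f (map (kappa_u \<gamma>) xs)
        = Delta1 ar A \<alpha> `` {ops (con_alg A \<alpha>) f (map (\<lambda>x. (x, u)) xs)}"
      using xs xu unfolding kappa_image_def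
      by (simp del: map_map map_eq_conv, subst quot_ops[OF D]) (auto simp: in_tuples con_alg_def)
    also have "ops (con_alg A \<alpha>) f (map (\<lambda>x. (x, u)) xs) = (ops A f xs, u)"
      using xs u_ops[of xs f] by (simp add: con_alg_def comp_def in_tuples)
    finally have e: "ops (kappa_image ar A \<alpha> \<gamma>) f (map (kappa_u \<gamma>) xs) = kappa ar A \<alpha> (ops A f xs, u)"
      by (simp add: kappa_def)
    have "ops A f xs \<in> \<gamma> `` {u}"
      using class_alg_ualgebra[OF \<gamma>(1) idem] xs unfolding ualgebra_def subuniverse_def class_alg_def by auto
    then show ?thesis unfolding e by (simp add: kappa_u_def)
  qed
  then show ?thesis
    using bij_betw_apply[OF kappa_u_bij[OF \<gamma>]] unfolding alg_hom_def
    by (auto simp: class_alg_def) (auto simp: kappa_u_def)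
qed

lemma kappa_u_u:
  assumes "\<gamma> \<in> con ar A"
  shows "kappa_u \<gamma> u = diag_class ar A \<alpha>"
proof -
  have D: "Delta1 ar A \<alpha> \<in> con ar (con_alg A \<alpha>)" unfolding Delta1_eq by (rule same_difference_con)
  have "((u, u), (a, a)) \<in> Delta1 ar A \<alpha>" if "a \<in> univ A" for a
    unfolding Delta1_eq using that con_refl[OF \<alpha>] u_univ m1 by auto
  then have "Delta1 ar A \<alpha> `` {(u, u)} = Delta1 ar A \<alpha> `` Id_on (univ A)"
    using u_univ con_trans[OF D] by blast
  then show ?thesis using con_refl[OF assms u_univ] by (simp add: kappa_u_def kappa_def diag_class_def)
qed

lemma Hom0_kappa_image:
  assumes "\<gamma> \<in> con ar A" "\<gamma> \<subseteq> \<alpha>"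
  shows "Hom0 ar (kappa_image ar A \<alpha> \<gamma>) (diag_class ar A \<alpha>) M E \<cong> Hom0 ar (class_alg A \<gamma> u) u M E"
proof (rule Hom0_iso[OF class_alg_ualgebra[OF assms(1) idem] kappa_u_hom[OF assms] kappa_u_bij[OF assms]])
  show "u \<in> univ (class_alg A \<gamma> u)" using con_refl[OF assms(1) u_univ] by (simp add: class_alg_def)
qed (rule kappa_u_u[OF assms(1)])

text \<open>Closure under the operations is pulled back along the bijection \<open>kappa_u\<close>
  to the class algebra.\<close>

lemma kappa_image_ualgebra:
  assumes \<gamma>: "\<gamma> \<in> con ar A" "\<gamma> \<subseteq> \<alpha>"
  shows "ualgebra ar (kappa_image ar A \<alpha> \<gamma>)" "diag_class ar A \<alpha> \<in> univ (kappa_image ar A \<alpha> \<gamma>)"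
proof -
  let ?I = "class_alg A \<gamma> u" and ?K = "kappa_image ar A \<alpha> \<gamma>"
  note I = class_alg_ualgebra[OF \<gamma>(1) idem] and bij = kappa_u_bij[OF \<gamma>]
  show d: "diag_class ar A \<alpha> \<in> univ ?K"
    using bij_betw_apply[OF bij, of u] con_refl[OF \<gamma>(1) u_univ] kappa_u_u[OF \<gamma>(1)]
    by (simp add: class_alg_def)
  have "ops ?K f ys \<in> univ ?K" if ys: "ys \<in> tuples (univ ?K) (ar f)" for f ys
  proof -
    define xs where "xs = map (inv_into (univ ?I) (kappa_u \<gamma>)) ys"
    have y: "y \<in> kappa_u \<gamma> ` univ ?I" if "y \<in> set ys" for y
      using that ys bij_betw_imp_surj_on[OF bij] by (simp add: tuples_def subset_iff)
    have xs: "ys = map (kappa_u \<gamma>) xs"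
      unfolding xs_def map_map by (rule map_idI[symmetric]) (simp add: f_inv_into_f[OF y])
    have "set xs \<subseteq> univ ?I" unfolding xs_def using inv_into_into[OF y] by auto
    moreover have "length xs = length ys" by (simp add: xs_def)
    ultimately have t: "xs \<in> tuples (univ ?I) (ar f)" using ys by (simp add: tuples_def)
    then have "ops ?K f ys = kappa_u \<gamma> (ops ?I f xs)"
      using kappa_u_hom[OF \<gamma>] unfolding xs alg_hom_def by simp
    moreover have "ops ?I f xs \<in> univ ?I" using I t by (simp add: ualgebra_def subuniverse_def)
    ultimately show ?thesis by (simp add: bij_betw_apply[OF bij])
  qed
  then show "ualgebra ar ?K" using d by (auto simp: ualgebra_def subuniverse_def)
qed

end

section \<open>Derivations and cocycles\<close>

lemma (in left_module) add_diff_add_cancel: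
  assumes "x \<in> carrier M" "y \<in> carrier M" "z \<in> carrier M"
  shows "(x \<oplus>\<^bsub>M\<^esub> z) \<ominus>\<^bsub>M\<^esub> (y \<oplus>\<^bsub>M\<^esub> z) = x \<ominus>\<^bsub>M\<^esub> y"
proof -
  have "(x \<oplus>\<^bsub>M\<^esub> z) \<ominus>\<^bsub>M\<^esub> (y \<oplus>\<^bsub>M\<^esub> z) = (x \<oplus>\<^bsub>M\<^esub> z) \<oplus>\<^bsub>M\<^esub> (\<ominus>\<^bsub>M\<^esub> z \<oplus>\<^bsub>M\<^esub> \<ominus>\<^bsub>M\<^esub> y)"
    using assms by (simp add: M.minus_eq M.minus_add M.a_comm[of "\<ominus>\<^bsub>M\<^esub> y"])
  then show ?thesis using assms by (simp add: M.minus_eq M.a_assoc M.r_neg2)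
qed

lemma (in left_module) diff_eq_iff:
  assumes "x \<in> carrier M" "y \<in> carrier M" "z \<in> carrier M"
  shows "x \<ominus>\<^bsub>M\<^esub> y = z \<longleftrightarrow> x = z \<oplus>\<^bsub>M\<^esub> y"
  using assms by (auto simp: M.minus_eq M.a_assoc M.l_neg M.r_neg)

lemma partial_trm_closed:
  fixes R :: "'r ring" and M :: "('r, 'b) module"
  assumes E: "kernel_alg R M ar m E" and Q: "ualgebra ar Q" and T: "T \<in> cocycles ar Q E"
    and "wf_trm ar t" and \<sigma>: "\<And>v. \<sigma> v \<in> univ Q"
  shows "partial_trm Q M E T \<sigma> t \<in> carrier M"
proof -
  interpret kernel_alg R M ar m E by (rule E)
  show ?thesis using \<open>wf_trm ar t\<close>
  proof (induction t)
    case (App f ts)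
    have "map (eval_trm Q \<sigma>) ts \<in> tuples (univ Q) (ar f)"
      using App.prems by (auto simp: in_tuples intro!: eval_closed[OF Q _ \<sigma>])
    then have "T f (map (eval_trm Q \<sigma>) ts) \<in> carrier M"
      using T unfolding cocycles_def univ_E by auto
    moreover have "ops E f (map (partial_trm Q M E T \<sigma>) ts) \<in> carrier M"
      using App by (intro ops_E_closed) auto
    ultimately show ?case by simp
  qed simp
qed

text \<open>\<open>F\<close> and \<open>Q\<close> may live over different types: besides the given
  presentation, the one-element algebra over \<open>unit\<close> will serve as
  \<open>Q\<close>.\<close>

locale presented_alg = kernel_alg R M ar m E
  for R :: "'r ring" and M :: "('r, 'b) module" and ar :: "'f \<Rightarrow> nat" and m and E :: "('f, 'b) alg" +
  fixes F :: "('f, 'a) alg" and Q :: "('f, 'q) alg" and p :: "'a \<Rightarrow> 'q"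
  assumes F: "ualgebra ar F" and Q: "ualgebra ar Q"
    and p_in: "x \<in> univ F \<Longrightarrow> p x \<in> univ Q"
    and p_hom: "xs \<in> tuples (univ F) (ar f) \<Longrightarrow> p (ops F f xs) = ops Q f (map p xs)"
    and p_surj: "q \<in> univ Q \<Longrightarrow> \<exists>x \<in> univ F. p x = q"
begin

text \<open>A derivation with respect to \<open>T\<close> is the first coordinate of a homomorphism from
  \<open>F\<close> into the central extension of \<open>Q\<close> by \<open>E\<close> given by \<open>T\<close>.\<close>

definition derivation :: "('f \<Rightarrow> 'q list \<Rightarrow> 'b) \<Rightarrow> ('a \<Rightarrow> 'b) \<Rightarrow> bool" where
  "derivation T D \<longleftrightarrow> (\<forall>x \<in> univ F. D x \<in> carrier M) \<and>
     (\<forall>f. \<forall>xs \<in> tuples (univ F) (ar f).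
        D (ops F f xs) = ops E f (map D xs) \<oplus>\<^bsub>M\<^esub> T f (map p xs))"

lemma derivation_in: "derivation T D \<Longrightarrow> x \<in> univ F \<Longrightarrow> D x \<in> carrier M"
  unfolding derivation_def by simp

lemma derivation_ops: "derivation T D \<Longrightarrow> xs \<in> tuples (univ F) (ar f) \<Longrightarrow>
    D (ops F f xs) = ops E f (map D xs) \<oplus>\<^bsub>M\<^esub> T f (map p xs)"
  unfolding derivation_def by simp

lemma tuples_p: "xs \<in> tuples (univ F) n \<Longrightarrow> map p xs \<in> tuples (univ Q) n"
  by (auto simp: in_tuples p_in)

lemma F_ops: "xs \<in> tuples (univ F) (ar f) \<Longrightarrow> ops F f xs \<in> univ F"
  by (auto simp: in_tuples intro: ops_closed[OF F])

lemma cocycle_in: "T \<in> cocycles ar Q E \<Longrightarrow> qs \<in> tuples (univ Q) (ar f) \<Longrightarrow> T f qs \<in> carrier M"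
  unfolding cocycles_def univ_E by auto

lemma derivation_opsE_in:
  "derivation T D \<Longrightarrow> xs \<in> tuples (univ F) (ar f) \<Longrightarrow> ops E f (map D xs) \<in> carrier M"
  by (rule ops_E_closed) (auto simp: in_tuples derivation_in)

lemma eval_E_closed: "wf_trm ar t \<Longrightarrow> (\<And>v. \<rho> v \<in> carrier M) \<Longrightarrow> eval_trm E \<rho> t \<in> carrier M"
  using eval_closed[OF ualgebra_E, of t \<rho>] unfolding univ_E by simp

lemma eval_E_add:
  assumes "wf_trm ar t" "\<And>v. \<rho> v \<in> carrier M" "\<And>v. \<sigma> v \<in> carrier M"
  shows "eval_trm E (\<lambda>v. \<rho> v \<oplus>\<^bsub>M\<^esub> \<sigma> v) t = eval_trm E \<rho> t \<oplus>\<^bsub>M\<^esub> eval_trm E \<sigma> t"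
  using assms(1)
proof (induction t)
  case (App f ts)
  have "map (eval_trm E (\<lambda>v. \<rho> v \<oplus>\<^bsub>M\<^esub> \<sigma> v)) ts = map (\<lambda>t. eval_trm E \<rho> t \<oplus>\<^bsub>M\<^esub> eval_trm E \<sigma> t) ts"
    using App by simp
  moreover have "ops E f (map (\<lambda>t. eval_trm E \<rho> t \<oplus>\<^bsub>M\<^esub> eval_trm E \<sigma> t) ts)
      = ops E f (map (eval_trm E \<rho>) ts) \<oplus>\<^bsub>M\<^esub> ops E f (map (eval_trm E \<sigma>) ts)"
    using App.prems by (intro ops_add eval_E_closed assms(2,3)) auto
  ultimately show ?case by (simp del: map_eq_conv)
qed simp

text \<open>Additivity of the operations separates a linear part, depending on the values of
  \<open>D\<close> at the variables, from a correction that sees the variables through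
  \<open>p\<close> only.\<close>

lemma derivation_eval:
  assumes D: "derivation T D" and T: "T \<in> cocycles ar Q E" and "wf_trm ar t"
    and \<rho>: "\<And>v. \<rho> v \<in> univ F"
  shows "D (eval_trm F \<rho> t) = eval_trm E (\<lambda>v. D (\<rho> v)) t \<oplus>\<^bsub>M\<^esub> partial_trm Q M E T (\<lambda>v. p (\<rho> v)) t"
  using \<open>wf_trm ar t\<close>
proof (induction t)
  case (Var v)
  then show ?case using derivation_in[OF D \<rho>] by simp
next
  case (App f ts)
  let ?P = "partial_trm Q M E T (\<lambda>v. p (\<rho> v))" and ?e = "eval_trm E (\<lambda>v. D (\<rho> v))"
  have wf: "wf_trm ar t" if "t \<in> set ts" for t using App.prems that by simp
  have xs: "map (eval_trm F \<rho>) ts \<in> tuples (univ F) (ar f)"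
    using App.prems by (auto simp: in_tuples intro: eval_closed[OF F _ \<rho>])
  have P: "?P t \<in> carrier M" if "t \<in> set ts" for t
    by (rule partial_trm_closed[OF kernel_alg_axioms Q T wf[OF that] p_in[OF \<rho>]])
  have e: "?e t \<in> carrier M" if "t \<in> set ts" for t
    by (rule eval_E_closed[OF wf[OF that] derivation_in[OF D \<rho>]])
  have pe: "map p (map (eval_trm F \<rho>) ts) = map (eval_trm Q (\<lambda>v. p (\<rho> v))) ts"
    using eval_hom[OF F wf \<rho> p_hom] by simp
  have De: "map D (map (eval_trm F \<rho>) ts) = map (\<lambda>t. ?e t \<oplus>\<^bsub>M\<^esub> ?P t) ts"
    using App.IH wf by simp
  have "D (eval_trm F \<rho> (App f ts)) = ops E f (map (\<lambda>t. ?e t \<oplus>\<^bsub>M\<^esub> ?P t) ts)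
      \<oplus>\<^bsub>M\<^esub> T f (map (eval_trm Q (\<lambda>v. p (\<rho> v))) ts)"
    using derivation_ops[OF D xs] unfolding pe De by simp
  also have "ops E f (map (\<lambda>t. ?e t \<oplus>\<^bsub>M\<^esub> ?P t) ts) = ops E f (map ?e ts) \<oplus>\<^bsub>M\<^esub> ops E f (map ?P ts)"
    using App.prems e P by (intro ops_add) auto
  also have "\<dots> \<oplus>\<^bsub>M\<^esub> T f (map (eval_trm Q (\<lambda>v. p (\<rho> v))) ts) = ?e (App f ts) \<oplus>\<^bsub>M\<^esub> ?P (App f ts)"
  proof -
    have "ops E f (map ?e ts) \<in> carrier M" "ops E f (map ?P ts) \<in> carrier M"
      using App.prems e P by (auto intro!: ops_E_closed)
    then show ?thesis
      using cocycle_in[OF T tuples_p[OF xs]] unfolding pe by (simp add: M.a_assoc)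
  qed
  finally show ?case .
qed

text \<open>An evaluation in \<open>Q\<close> lifts to \<open>F\<close> along \<open>p\<close>. For
  an identity the values of \<open>D\<close> and the linear parts in \<open>E\<close> agree on both
  sides, and by \<open>derivation_eval\<close> cancelling them leaves the corrections.\<close>

lemma compatible_if_derivation:
  assumes D: "derivation T D" and T: "T \<in> cocycles ar Q E"
    and id: "\<And>e. e \<in> identities ar \<U> \<Longrightarrow> satisfies F e \<and> satisfies E e"
  shows "compatible ar \<U> Q M E T"
  unfolding compatible_def
proof (intro ballI, clarify)
  fix s t and \<sigma> :: "nat \<Rightarrow> 'q"
  assume st: "(s, t) \<in> identities ar \<U>" and \<sigma>: "range \<sigma> \<subseteq> univ Q"
  then have wf: "wf_trm ar s" "wf_trm ar t" unfolding identities_def by auto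
  have "\<exists>x. x \<in> univ F \<and> p x = \<sigma> v" for v using p_surj[of "\<sigma> v"] \<sigma> by auto
  then obtain \<rho> where \<rho>: "\<And>v. \<rho> v \<in> univ F" and p\<rho>: "\<And>v. p (\<rho> v) = \<sigma> v" by metis
  have Dc: "range (\<lambda>v. D (\<rho> v)) \<subseteq> univ E" using derivation_in[OF D \<rho>] univ_E by auto
  have "range \<rho> \<subseteq> univ F" using \<rho> by auto
  then have "eval_trm F \<rho> s = eval_trm F \<rho> t" "eval_trm E (\<lambda>v. D (\<rho> v)) s = eval_trm E (\<lambda>v. D (\<rho> v)) t"
    using id[OF st] Dc unfolding satisfies_def by auto
  then have "eval_trm E (\<lambda>v. D (\<rho> v)) t \<oplus>\<^bsub>M\<^esub> partial_trm Q M E T \<sigma> s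
      = eval_trm E (\<lambda>v. D (\<rho> v)) t \<oplus>\<^bsub>M\<^esub> partial_trm Q M E T \<sigma> t"
    using derivation_eval[OF D T wf(1), of \<rho>] derivation_eval[OF D T wf(2), of \<rho>] \<rho> p\<rho> by simp
  moreover have "eval_trm E (\<lambda>v. D (\<rho> v)) t \<in> carrier M"
    by (rule eval_E_closed[OF wf(2) derivation_in[OF D \<rho>]])
  moreover have "partial_trm Q M E T \<sigma> r \<in> carrier M" if "wf_trm ar r" for r
    by (rule partial_trm_closed[OF kernel_alg_axioms Q T that]) (use \<sigma> in auto)
  ultimately show "partial_trm Q M E T \<sigma> s = partial_trm Q M E T \<sigma> t" using wf by simp
qed

lemma derivation_add:
  assumes "derivation S C" "derivation T D" "S \<in> cocycles ar Q E" "T \<in> cocycles ar Q E"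
  shows "derivation (\<lambda>f. \<lambda>xs \<in> tuples (univ Q) (ar f). S f xs \<oplus>\<^bsub>M\<^esub> T f xs) (\<lambda>x. C x \<oplus>\<^bsub>M\<^esub> D x)"
  unfolding derivation_def
proof (intro conjI allI ballI)
  fix f xs assume xs: "xs \<in> tuples (univ F) (ar f)"
  have "ops E f (map (\<lambda>x. C x \<oplus>\<^bsub>M\<^esub> D x) xs) = ops E f (map C xs) \<oplus>\<^bsub>M\<^esub> ops E f (map D xs)"
    by (rule ops_add) (use xs assms(1,2)[THEN derivation_in] in \<open>auto simp: in_tuples\<close>)
  then show "C (ops F f xs) \<oplus>\<^bsub>M\<^esub> D (ops F f xs) = ops E f (map (\<lambda>x. C x \<oplus>\<^bsub>M\<^esub> D x) xs) \<oplus>\<^bsub>M\<^esub>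
      (\<lambda>xs \<in> tuples (univ Q) (ar f). S f xs \<oplus>\<^bsub>M\<^esub> T f xs) (map p xs)"
    using derivation_ops[OF assms(1) xs] derivation_ops[OF assms(2) xs] tuples_p[OF xs]
      derivation_opsE_in[OF assms(1) xs] derivation_opsE_in[OF assms(2) xs]
      cocycle_in[OF assms(3) tuples_p[OF xs]] cocycle_in[OF assms(4) tuples_p[OF xs]]
    by (simp add: M.a_ac)
qed (use assms(1,2)[THEN derivation_in] in auto)

lemma derivation_neg:
  assumes "derivation T D" "T \<in> cocycles ar Q E"
  shows "derivation (\<lambda>f. \<lambda>xs \<in> tuples (univ Q) (ar f). \<ominus>\<^bsub>M\<^esub> T f xs) (\<lambda>x. \<ominus>\<^bsub>M\<^esub> D x)"
  unfolding derivation_def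
proof (intro conjI allI ballI)
  fix f xs assume xs: "xs \<in> tuples (univ F) (ar f)"
  have "ops E f (map (\<lambda>x. \<ominus>\<^bsub>M\<^esub> D x) xs) = \<ominus>\<^bsub>M\<^esub> ops E f (map D xs)"
    by (rule ops_neg) (use xs derivation_in[OF assms(1)] in \<open>auto simp: in_tuples\<close>)
  then show "\<ominus>\<^bsub>M\<^esub> D (ops F f xs) = ops E f (map (\<lambda>x. \<ominus>\<^bsub>M\<^esub> D x) xs) \<oplus>\<^bsub>M\<^esub>
      (\<lambda>xs \<in> tuples (univ Q) (ar f). \<ominus>\<^bsub>M\<^esub> T f xs) (map p xs)"
    using derivation_ops[OF assms(1) xs] tuples_p[OF xs] derivation_opsE_in[OF assms(1) xs]
      cocycle_in[OF assms(2) tuples_p[OF xs]]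
    by (simp add: M.minus_add)
qed (use derivation_in[OF assms(1)] in auto)

lemma derivation_diff_hom:
  assumes C: "derivation T C" and D: "derivation T D" and T: "T \<in> cocycles ar Q E"
    and xs: "xs \<in> tuples (univ F) (ar f)"
  shows "C (ops F f xs) \<ominus>\<^bsub>M\<^esub> D (ops F f xs) = ops E f (map (\<lambda>x. C x \<ominus>\<^bsub>M\<^esub> D x) xs)"
proof -
  have "ops E f (map (\<lambda>x. C x \<ominus>\<^bsub>M\<^esub> D x) xs) = ops E f (map C xs) \<ominus>\<^bsub>M\<^esub> ops E f (map D xs)"
    by (rule ops_diff) (use xs C[THEN derivation_in] D[THEN derivation_in] in \<open>auto simp: in_tuples\<close>)
  then show ?thesis
    using derivation_ops[OF C xs] derivation_ops[OF D xs] tuples_p[OF xs]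
      derivation_opsE_in[OF C xs] derivation_opsE_in[OF D xs]
      cocycle_in[OF T tuples_p[OF xs]]
    by (simp add: add_diff_add_cancel)
qed

text \<open>The kernel of x |-> (D x, p x), the homomorphism into the central extension.\<close>

definition fibre_ker :: "('a \<Rightarrow> 'b) \<Rightarrow> ('a \<times> 'a) set" where
  "fibre_ker D = {(x, y). x \<in> univ F \<and> y \<in> univ F \<and> p x = p y \<and> D x = D y}"

lemma fibre_ker_con:
  assumes D: "derivation T D"
  shows "fibre_ker D \<in> con ar F"
proof -
  have "equiv (univ F) (fibre_ker D)"
    unfolding fibre_ker_def by (rule equivI) (auto simp: refl_on_def sym_def trans_def)
  moreover have "(ops F f xs, ops F f ys) \<in> fibre_ker D"
    if "xs \<in> tuples (univ F) (ar f)" "ys \<in> tuples (univ F) (ar f)"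
      and s: "list_all2 (\<lambda>x y. (x, y) \<in> fibre_ker D) xs ys" for f xs ys
  proof -
    have "map p xs = map p ys" "map D xs = map D ys"
      using s by (auto simp: list_all2_conv_all_nth fibre_ker_def intro!: nth_equalityI)
    then show ?thesis using that derivation_ops[OF D] p_hom F_ops unfolding fibre_ker_def by simp
  qed
  ultimately show ?thesis unfolding con_def by simp
qed

text \<open>On a term, \<open>D\<close> splits as L(x) + K(y) + P(y), where \<open>x\<close> are the
  variables moved inside classes of \<theta>; the correction P does not notice this move, as p(x) is
  unchanged. So equality for \<open>c\<close> and \<open>d\<close> means K(c) + P(c) = K(d) + P(d),
  whichever of \<open>a\<close> and \<open>b\<close> is used.\<close>

lemma derivation_centralizes:
  assumes D: "derivation T D" and T: "T \<in> cocycles ar Q E"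
  shows "centralizes ar F (hom_ker F p) (one_con F) (fibre_ker D)"
  unfolding centralizes_def
proof (intro allI impI, elim conjE)
  fix t :: "('f, nat + nat) trm" and a b c d :: "nat \<Rightarrow> 'a"
  assume t: "wf_trm ar t" and ab: "\<forall>i. (a i, b i) \<in> hom_ker F p" and cd: "\<forall>i. (c i, d i) \<in> one_con F"
    and s: "(eval_trm F (case_sum a c) t, eval_trm F (case_sum a d) t) \<in> fibre_ker D"
  have u: "a i \<in> univ F" "b i \<in> univ F" "c i \<in> univ F" "d i \<in> univ F" "p (a i) = p (b i)" for i
    using ab cd unfolding hom_ker_def one_con_def by auto
  define ev where "ev = (\<lambda>x y. eval_trm F (case_sum x y) t)"
  define P where "P = (\<lambda>y. partial_trm Q M E T (case_sum (\<lambda>i. p (a i)) (\<lambda>i. p (y i))) t)"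
  define L where "L = (\<lambda>x. eval_trm E (case_sum (\<lambda>i. D (x i)) (\<lambda>i. \<zero>\<^bsub>M\<^esub>)) t)"
  define K where "K = (\<lambda>y. eval_trm E (case_sum (\<lambda>i. \<zero>\<^bsub>M\<^esub>) (\<lambda>i. D (y i))) t)"
  have in_F: "case_sum x y v \<in> univ F" if "\<And>i. x i \<in> univ F" "\<And>i. y i \<in> univ F" for x y :: "nat \<Rightarrow> 'a" and v
    using that by (simp split: sum.split)
  have evc: "ev x y \<in> univ F" if "\<And>i. x i \<in> univ F" "\<And>i. y i \<in> univ F" for x y
    unfolding ev_def by (rule eval_closed[OF F t in_F]) (use that in auto)
  have Lc: "L x \<in> carrier M" "K x \<in> carrier M" if "\<And>i. x i \<in> univ F" for x
    unfolding L_def K_def using derivation_in[OF D that]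
    by (intro eval_E_closed[OF t]; simp split: sum.split)+
  have Pc: "P x \<in> carrier M" if "\<And>i. x i \<in> univ F" for x
    unfolding P_def
    by (rule partial_trm_closed[OF kernel_alg_axioms Q T t]) (use that u p_in in \<open>simp split: sum.split\<close>)
  have split: "D (ev x y) = (L x \<oplus>\<^bsub>M\<^esub> K y) \<oplus>\<^bsub>M\<^esub> P y"
    if x: "\<And>i. x i \<in> univ F" "\<And>i. p (x i) = p (a i)" and y: "\<And>i. y i \<in> univ F" for x y
  proof -
    have "(\<lambda>v. D (case_sum x y v)) = (\<lambda>v. case_sum (\<lambda>i. D (x i)) (\<lambda>i. \<zero>\<^bsub>M\<^esub>) v \<oplus>\<^bsub>M\<^esub> case_sum (\<lambda>i. \<zero>\<^bsub>M\<^esub>) (\<lambda>i. D (y i)) v)"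
      using derivation_in[OF D] x y by (auto split: sum.split)
    moreover have "eval_trm E (\<lambda>v. case_sum (\<lambda>i. D (x i)) (\<lambda>i. \<zero>\<^bsub>M\<^esub>) v \<oplus>\<^bsub>M\<^esub> case_sum (\<lambda>i. \<zero>\<^bsub>M\<^esub>) (\<lambda>i. D (y i)) v) t = L x \<oplus>\<^bsub>M\<^esub> K y"
      unfolding L_def K_def
      by (rule eval_E_add[OF t]) (use derivation_in[OF D] x y in \<open>simp_all split: sum.split\<close>)
    moreover have "(\<lambda>v. p (case_sum x y v)) = case_sum (\<lambda>i. p (a i)) (\<lambda>i. p (y i))"
      by (rule ext) (simp add: x split: sum.split)
    ultimately show ?thesis
      using derivation_eval[OF D T t in_F[OF x(1) y]] unfolding ev_def P_def by simp
  qed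
  have pe: "p (ev x y) = eval_trm Q (case_sum (\<lambda>i. p (x i)) (\<lambda>i. p (y i))) t"
    if "\<And>i. x i \<in> univ F" "\<And>i. y i \<in> univ F" for x y
  proof -
    have "(\<lambda>v. p (case_sum x y v)) = case_sum (\<lambda>i. p (x i)) (\<lambda>i. p (y i))"
      by (rule ext) (simp split: sum.split)
    then show ?thesis
      using eval_hom[OF F t in_F p_hom, OF that] unfolding ev_def by simp
  qed
  have "p (ev a c) = p (ev a d)" and e: "D (ev a c) = D (ev a d)"
    using s unfolding fibre_ker_def ev_def by auto
  then have 1: "p (ev b c) = p (ev b d)" using pe u by simp
  have "L a \<oplus>\<^bsub>M\<^esub> (K c \<oplus>\<^bsub>M\<^esub> P c) = L a \<oplus>\<^bsub>M\<^esub> (K d \<oplus>\<^bsub>M\<^esub> P d)"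
    using e split[of a c] split[of a d] u Lc Pc by (simp add: M.a_assoc)
  then have "K c \<oplus>\<^bsub>M\<^esub> P c = K d \<oplus>\<^bsub>M\<^esub> P d" using u Lc Pc by simp
  then have "D (ev b c) = D (ev b d)"
    using split[of b c] split[of b d] u Lc Pc by (simp add: M.a_assoc)
  with 1 show "(eval_trm F (case_sum b c) t, eval_trm F (case_sum b d) t) \<in> fibre_ker D"
    using evc u unfolding fibre_ker_def ev_def by simp
qed

lemma commutator_le_fibre_ker:
  assumes "derivation T D" "T \<in> cocycles ar Q E"
  shows "commutator ar F (hom_ker F p) (one_con F) \<subseteq> fibre_ker D"
  by (rule commutator_least[OF fibre_ker_con[OF assms(1)] derivation_centralizes[OF assms]])

end

text \<open>A homomorphism into \<open>E\<close> is a derivation over the one-element algebra.\<close>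

lemma (in kernel_alg) commutator_le_ker:
  fixes F :: "('f, 'a) alg"
  assumes F: "ualgebra ar F" and H: "\<And>x. x \<in> univ F \<Longrightarrow> H x \<in> carrier M"
    "\<And>f xs. xs \<in> tuples (univ F) (ar f) \<Longrightarrow> H (ops F f xs) = ops E f (map H xs)"
    and xy: "(x, y) \<in> commutator ar F (one_con F) (one_con F)"
  shows "H x = H y"
proof -
  define Q :: "('f, unit) alg" where "Q = \<lparr>univ = UNIV, ops = (\<lambda>f xs. ())\<rparr>"
  define T where "T = (\<lambda>f. \<lambda>xs \<in> tuples (univ Q) (ar f). \<zero>\<^bsub>M\<^esub>)"
  interpret Q: presented_alg R M ar m E F Q "\<lambda>x. ()"
    by unfold_locales (use F in \<open>auto simp: Q_def ualgebra_def subuniverse_def\<close>)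
  have T: "T \<in> cocycles ar Q E" unfolding cocycles_def T_def univ_E by auto
  have D: "Q.derivation T H"
    unfolding Q.derivation_def
  proof (intro conjI allI ballI)
    fix f xs assume xs: "xs \<in> tuples (univ F) (ar f)"
    then have "ops E f (map H xs) \<in> carrier M"
      by (intro ops_E_closed) (auto simp: in_tuples H(1))
    then show "H (ops F f xs) = ops E f (map H xs) \<oplus>\<^bsub>M\<^esub> T f (map (\<lambda>x. ()) xs)"
      using xs by (simp add: H(2) T_def Q_def tuples_def)
  qed (rule H(1))
  \<comment> \<open>Over the one-element algebra the kernel of the presentation is everything, so
    [\<theta>,1] becomes [1,1].\<close>
  have "hom_ker F (\<lambda>x. ()) = one_con F" unfolding hom_ker_def one_con_def by auto
  then show ?thesis using Q.commutator_le_fibre_ker[OF D T] xy unfolding Q.fibre_ker_def by auto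
qed

section \<open>Extending homomorphisms modulo a congruence\<close>

lemma variety_ualgebra: "variety ar \<U> \<Longrightarrow> A \<in> \<U> \<Longrightarrow> ualgebra ar A"
  unfolding variety_def by auto

lemma variety_identities: "A \<in> \<U> \<Longrightarrow> e \<in> identities ar \<U> \<Longrightarrow> satisfies A e"
  unfolding identities_def by (cases e) auto

text \<open>The defining equations of \<open>\<U>\<close> are themselves identities of
  \<open>\<U>\<close>, so membership can be tested without choosing a set of equations
  again.\<close>

lemma variety_memI:
  assumes "variety ar \<U>" "ualgebra ar A" "\<And>e. e \<in> identities ar \<U> \<Longrightarrow> satisfies A e"
  shows "A \<in> \<U>"
proof -
  from assms(1) obtain \<Sigma> where \<Sigma>: "\<forall>(s, t) \<in> \<Sigma>. wf_trm ar s \<and> wf_trm ar t"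
    and \<U>: "\<U> = {A. ualgebra ar A \<and> (\<forall>e \<in> \<Sigma>. satisfies A e)}"
    unfolding variety_def by auto
  have "\<Sigma> \<subseteq> identities ar \<U>" using \<Sigma> unfolding identities_def \<U> by auto
  then show ?thesis using assms(2,3) unfolding \<U> by auto
qed

lemma variety_image:
  fixes A B :: "('f, 'u) alg"
  assumes var: "variety ar \<U>" and A: "A \<in> \<U>" and k: "k ` univ A = univ B"
    and hom: "\<And>f xs. xs \<in> tuples (univ A) (ar f) \<Longrightarrow> k (ops A f xs) = ops B f (map k xs)"
  shows "B \<in> \<U>"
proof (rule variety_memI[OF var])
  note Aa = variety_ualgebra[OF var A]
  define j where "j = inv_into (univ A) k"
  have j: "j y \<in> univ A" "k (j y) = y" if "y \<in> univ B" for y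
    using that k unfolding j_def by (auto intro: inv_into_into f_inv_into_f)
  have "ops B f ys \<in> univ B" if "ys \<in> tuples (univ B) (ar f)" for f ys
  proof -
    have xs: "map j ys \<in> tuples (univ A) (ar f)" using that j by (auto simp: in_tuples)
    have "map k (map j ys) = ys" using that j by (auto simp: in_tuples intro!: map_idI)
    with hom[OF xs] have "ops B f ys = k (ops A f (map j ys))" by simp
    moreover have "ops A f (map j ys) \<in> univ A" using xs by (intro ops_closed[OF Aa]) (auto simp: in_tuples)
    ultimately show ?thesis using k by auto
  qed
  then show "ualgebra ar B" using Aa k unfolding ualgebra_def subuniverse_def by auto
  show "satisfies B e" if e: "e \<in> identities ar \<U>" for e
    unfolding satisfies_def
  proof (intro allI impI)
    fix \<rho> :: "nat \<Rightarrow> 'u" assume \<rho>: "range \<rho> \<subseteq> univ B"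
    have wf: "wf_trm ar (fst e)" "wf_trm ar (snd e)" using e unfolding identities_def by auto
    have jr: "range (\<lambda>v. j (\<rho> v)) \<subseteq> univ A" using \<rho> j by auto
    have ev: "eval_trm B \<rho> t = k (eval_trm A (\<lambda>v. j (\<rho> v)) t)" if "wf_trm ar t" for t :: "('f, nat) trm"
    proof -
      have "k (j (\<rho> v)) = \<rho> v" for v using j \<rho> by (simp add: image_subset_iff)
      then show ?thesis using eval_hom[OF Aa that _ hom, of "\<lambda>v. j (\<rho> v)"] jr
        by (simp add: image_subset_iff)
    qed
    have "eval_trm A (\<lambda>v. j (\<rho> v)) (fst e) = eval_trm A (\<lambda>v. j (\<rho> v)) (snd e)"
      using variety_identities[OF A e] jr unfolding satisfies_def by simp
    then show "eval_trm B \<rho> (fst e) = eval_trm B \<rho> (snd e)" using ev wf by simp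
  qed
qed

lemma variety_subuniverse:
  assumes var: "variety ar \<U>" and A: "A \<in> \<U>" and S: "subuniverse ar A S" "S \<noteq> {}"
  shows "\<lparr>univ = S, ops = ops A\<rparr> \<in> \<U>"
proof (rule variety_memI[OF var])
  let ?B = "\<lparr>univ = S, ops = ops A\<rparr>"
  show "ualgebra ar ?B" using S unfolding ualgebra_def subuniverse_def by auto
  show "satisfies ?B e" if e: "e \<in> identities ar \<U>" for e
  proof -
    have "eval_trm ?B \<rho> t = eval_trm A \<rho> t" for \<rho> and t :: "('a, nat) trm"
      by (induction t) (simp_all cong: map_cong)
    then show ?thesis
      using variety_identities[OF A e] S unfolding satisfies_def subuniverse_def by auto
  qed
qed

text \<open>The choice is made from the class, so it is the same for all elements of one
  class.\<close>

definition rep :: "('a \<times> 'a) set \<Rightarrow> 'a \<Rightarrow> 'a" where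
  "rep \<beta> x = (SOME y. y \<in> \<beta> `` {x})"

text \<open>The image of \<open>S\<close> in \<open>A/\<beta>\<close>, realised on representatives to stay inside the
  type of \<open>A\<close>.\<close>

definition transversal :: "('f, 'a) alg \<Rightarrow> ('a \<times> 'a) set \<Rightarrow> 'a set \<Rightarrow> ('f, 'a) alg" where
  "transversal A \<beta> S = \<lparr>univ = rep \<beta> ` S, ops = (\<lambda>f xs. rep \<beta> (ops A f xs))\<rparr>"

lemma rep_rel:
  assumes "\<beta> \<in> con ar A" "x \<in> univ A"
  shows "(rep \<beta> x, x) \<in> \<beta>"
proof -
  have "rep \<beta> x \<in> \<beta> `` {x}"
    unfolding rep_def by (rule someI[of _ x]) (simp add: con_refl[OF assms])
  then show ?thesis using con_sym[OF assms(1)] by auto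
qed

lemma rep_eq_iff:
  assumes \<beta>: "\<beta> \<in> con ar A" and x: "x \<in> univ A" and y: "y \<in> univ A"
  shows "rep \<beta> x = rep \<beta> y \<longleftrightarrow> (x, y) \<in> \<beta>"
proof
  assume "rep \<beta> x = rep \<beta> y"
  then show "(x, y) \<in> \<beta>"
    using con_trans[OF \<beta> con_sym[OF \<beta> rep_rel[OF \<beta> x]]] rep_rel[OF \<beta> y] by simp
next
  assume "(x, y) \<in> \<beta>"
  then show "rep \<beta> x = rep \<beta> y"
    using con_Image_eq_iff[OF \<beta> x y] unfolding rep_def by simp
qed

lemma rep_ops:
  assumes \<beta>: "\<beta> \<in> con ar A" and A: "ualgebra ar A" and xs: "xs \<in> tuples (univ A) (ar f)"
  shows "rep \<beta> (ops A f (map (rep \<beta>) xs)) = rep \<beta> (ops A f xs)"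
proof -
  have "(ops A f (map (rep \<beta>) xs), ops A f (map (\<lambda>x. x) xs)) \<in> \<beta>"
    using xs by (intro con_ops_map[OF \<beta>]) (auto simp: in_tuples intro: rep_rel[OF \<beta>])
  then show ?thesis using rep_eq_iff[OF \<beta>] con_in[OF \<beta>] by simp
qed

lemma subuniverse_sub: "subuniverse ar A S \<Longrightarrow> x \<in> S \<Longrightarrow> x \<in> univ A"
  unfolding subuniverse_def by auto

lemma subuniverse_ops: "subuniverse ar A S \<Longrightarrow> xs \<in> tuples S (ar f) \<Longrightarrow> ops A f xs \<in> S"
  unfolding subuniverse_def by auto

lemma subuniverse_tuples: "subuniverse ar A S \<Longrightarrow> xs \<in> tuples S n \<Longrightarrow> xs \<in> tuples (univ A) n"
  unfolding subuniverse_def tuples_def by auto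

lemma transversal_in_variety:
  assumes var: "variety ar \<U>" and A: "A \<in> \<U>" and \<beta>: "\<beta> \<in> con ar A"
    and S: "subuniverse ar A S" "S \<noteq> {}"
  shows "transversal A \<beta> S \<in> \<U>"
proof (rule variety_image[OF var variety_subuniverse[OF var A S], of "rep \<beta>"])
  show "rep \<beta> ` univ \<lparr>univ = S, ops = ops A\<rparr> = univ (transversal A \<beta> S)"
    by (simp add: transversal_def)
  show "rep \<beta> (ops \<lparr>univ = S, ops = ops A\<rparr> f xs) = ops (transversal A \<beta> S) f (map (rep \<beta>) xs)"
    if "xs \<in> tuples (univ \<lparr>univ = S, ops = ops A\<rparr>) (ar f)" for f xs
    using rep_ops[OF \<beta> variety_ualgebra[OF var A] subuniverse_tuples[OF S(1)], of xs f] that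
    by (simp add: transversal_def)
qed

text \<open>Representatives of elements of \<open>S\<close> may lie outside \<open>S\<close>, since
  \<open>S\<close> need not be a union of \<beta>-classes; the laws \<open>m2\<close> and
  \<open>commute\<close> are therefore required on a set \<open>T\<close> that catches the
  representatives. They hold modulo \<beta> in \<open>A\<close> and become equations on the
  transversal, an affine algebra with zero \<open>rep \<beta> u\<close>.\<close>

lemma transversal_kernel_algebra:
  assumes var: "variety ar \<U>" and A: "A \<in> \<U>" and \<beta>: "\<beta> \<in> con ar A"
    and S: "subuniverse ar A S" and u: "u \<in> S" and ar_m: "ar m = 3"
    and u_idem: "\<And>f. (ops A f (replicate (ar f) u), u) \<in> \<beta>"
    and T: "rep \<beta> ` S \<subseteq> T" "T \<subseteq> univ A"
    and m1: "\<And>x y. x \<in> univ A \<Longrightarrow> y \<in> univ A \<Longrightarrow> ops A m [x, x, y] = y"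
    and m2: "\<And>x y. x \<in> T \<Longrightarrow> y \<in> T \<Longrightarrow> (ops A m [x, y, y], x) \<in> \<beta>"
    and commute: "\<And>ps f. ps \<in> tuples (T \<times> T \<times> T) (ar f) \<Longrightarrow>
      (ops A f (map (\<lambda>(x, y, z). ops A m [x, y, z]) ps),
       ops A m [ops A f (map fst ps), ops A f (map (fst \<circ> snd) ps), ops A f (map (snd \<circ> snd) ps)]) \<in> \<beta>"
  shows "is_kernel_algebra ar m (transversal A \<beta> S)"
proof -
  let ?B = "transversal A \<beta> S"
  note Aa = variety_ualgebra[OF var A]
  have Bu: "x \<in> T" "x \<in> univ A" "rep \<beta> x = x" if x: "x \<in> univ ?B" for x
  proof -
    obtain s where s: "s \<in> S" "x = rep \<beta> s" using x unfolding transversal_def by auto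
    show "x \<in> T" using s T by auto
    then show xu: "x \<in> univ A" using T by auto
    show "rep \<beta> x = x"
      using rep_rel[OF \<beta>, of s] subuniverse_sub[OF S s(1)] rep_eq_iff[OF \<beta> xu, of s] s by simp
  qed
  have opsB: "ops ?B f xs = rep \<beta> (ops A f xs)" for f xs by (simp add: transversal_def)
  have m_in: "ops A m [x, y, z] \<in> univ A" if "x \<in> univ A" "y \<in> univ A" "z \<in> univ A" for x y z
    using that by (intro ops_closed[OF Aa]) (auto simp: ar_m)
  interpret affine_alg ar m ?B "rep \<beta> u"
  proof
    show "ualgebra ar ?B"
      using transversal_in_variety[OF var A \<beta> S] u variety_ualgebra[OF var] by blast
    have uu: "u \<in> univ A" by (rule subuniverse_sub[OF S u])
    have "ops ?B f (replicate (ar f) (rep \<beta> u)) = rep \<beta> u" for f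
    proof -
      have "rep \<beta> (ops A f (map (rep \<beta>) (replicate (ar f) u))) = rep \<beta> (ops A f (replicate (ar f) u))"
        by (rule rep_ops[OF \<beta> Aa]) (use uu in \<open>auto simp: in_tuples\<close>)
      also have "\<dots> = rep \<beta> u" using u_idem[of f] rep_eq_iff[OF \<beta>] con_in[OF \<beta>] by blast
      finally show ?thesis by (simp add: opsB)
    qed
    then show "idempotent_elem ar ?B (rep \<beta> u)"
      using u unfolding idempotent_elem_def by (simp add: transversal_def)
  next
    fix x y assume xy: "x \<in> univ ?B" "y \<in> univ ?B"
    show "ops ?B m [x, x, y] = y" using Bu[OF xy(1)] Bu[OF xy(2)] m1 by (simp add: opsB)
    show "ops ?B m [x, y, y] = x"
      using Bu[OF xy(1)] Bu[OF xy(2)] m2[of x y] rep_eq_iff[OF \<beta> m_in, of x y y x] by (simp add: opsB)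
  next
    fix ps f assume ps: "ps \<in> tuples (univ ?B \<times> univ ?B \<times> univ ?B) (ar f)"
    let ?g = "\<lambda>h. ops A f (map h ps)"
    have gin: "?g h \<in> univ A" if "\<And>q. q \<in> set ps \<Longrightarrow> h q \<in> univ A" for h
      using ps that by (intro ops_closed[OF Aa]) (auto simp: in_tuples)
    have psu: "fst q \<in> univ A" "fst (snd q) \<in> univ A" "snd (snd q) \<in> univ A" if "q \<in> set ps" for q
      using ps that Bu(2) unfolding in_tuples by auto
    have pm: "ops A m [fst q, fst (snd q), snd (snd q)] \<in> univ A" if "q \<in> set ps" for q
      using psu[OF that] by (rule m_in)
    have T': "ps \<in> tuples (T \<times> T \<times> T) (ar f)"
      using ps Bu(1) unfolding in_tuples by auto
    have "ops ?B f (map (\<lambda>(x, y, z). ops ?B m [x, y, z]) ps)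
        = rep \<beta> (ops A f (map (rep \<beta>) (map (\<lambda>(x, y, z). ops A m [x, y, z]) ps)))"
      by (simp add: opsB comp_def case_prod_unfold)
    also have "\<dots> = rep \<beta> (ops A f (map (\<lambda>(x, y, z). ops A m [x, y, z]) ps))"
      using ps pm by (intro rep_ops[OF \<beta> Aa]) (auto simp: in_tuples case_prod_unfold)
    also have "\<dots> = rep \<beta> (ops A m [?g fst, ?g (fst \<circ> snd), ?g (snd \<circ> snd)])"
      using commute[OF T'] rep_eq_iff[OF \<beta>] con_in[OF \<beta>] by blast
    also have "\<dots> = rep \<beta> (ops A m (map (rep \<beta>) [?g fst, ?g (fst \<circ> snd), ?g (snd \<circ> snd)]))"
      using gin psu by (intro rep_ops[OF \<beta> Aa, symmetric]) (auto simp: in_tuples ar_m)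
    finally show "ops ?B f (map (\<lambda>(x, y, z). ops ?B m [x, y, z]) ps)
        = ops ?B m [ops ?B f (map fst ps), ops ?B f (map (fst \<circ> snd) ps), ops ?B f (map (snd \<circ> snd) ps)]"
      by (simp add: opsB)
  qed (rule ar_m)
  show ?thesis by (rule is_kernel_algebra)
qed

text \<open>\<open>RD1\<close> restated upstairs, for homomorphisms on the image of \<open>S\<close>
  modulo \<beta> and their extension to the image of \<open>S'\<close>. Maps constant on
  \<beta>-classes pass to the transversals and back. Saturation of \<open>S'\<close> keeps the
  representatives where the laws of \<open>m\<close> are available.\<close>

lemma (in kernel_alg) extend_hom:
  fixes F :: "('f, 'b) alg"
  assumes var: "variety ar \<U>" and F: "F \<in> \<U>" and RD1: "RD1 ar \<U> m E" and \<beta>: "\<beta> \<in> con ar F"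
    and S: "subuniverse ar F S" and S': "subuniverse ar F S'" and SS': "S \<subseteq> S'"
    and u: "u \<in> S" and ar_m: "ar m = 3"
    and u_idem: "\<And>f. (ops F f (replicate (ar f) u), u) \<in> \<beta>"
    and sat: "\<And>x y. x \<in> S' \<Longrightarrow> (x, y) \<in> \<beta> \<Longrightarrow> y \<in> S'"
    and m1: "\<And>x y. x \<in> univ F \<Longrightarrow> y \<in> univ F \<Longrightarrow> ops F m [x, x, y] = y"
    and m2: "\<And>x y. x \<in> S' \<Longrightarrow> y \<in> S' \<Longrightarrow> (ops F m [x, y, y], x) \<in> \<beta>"
    and commute: "\<And>ps f. ps \<in> tuples (S' \<times> S' \<times> S') (ar f) \<Longrightarrow>
      (ops F f (map (\<lambda>(x, y, z). ops F m [x, y, z]) ps),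
       ops F m [ops F f (map fst ps), ops F f (map (fst \<circ> snd) ps), ops F f (map (snd \<circ> snd) ps)]) \<in> \<beta>"
    and \<phi>_in: "\<And>x. x \<in> S \<Longrightarrow> \<phi> x \<in> carrier M"
    and \<phi>_\<beta>: "\<And>x y. x \<in> S \<Longrightarrow> y \<in> S \<Longrightarrow> (x, y) \<in> \<beta> \<Longrightarrow> \<phi> x = \<phi> y"
    and \<phi>_hom: "\<And>f xs. xs \<in> tuples S (ar f) \<Longrightarrow> \<phi> (ops F f xs) = ops E f (map \<phi> xs)"
  obtains \<psi> where "\<And>x. x \<in> S' \<Longrightarrow> \<psi> x \<in> carrier M"
    and "\<And>x y. x \<in> S' \<Longrightarrow> y \<in> S' \<Longrightarrow> (x, y) \<in> \<beta> \<Longrightarrow> \<psi> x = \<psi> y"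
    and "\<And>f xs. xs \<in> tuples S' (ar f) \<Longrightarrow> \<psi> (ops F f xs) = ops E f (map \<psi> xs)"
    and "\<And>x. x \<in> S \<Longrightarrow> \<psi> x = \<phi> x"
proof -
  let ?r = "rep \<beta>" and ?B = "transversal F \<beta> S" and ?C = "transversal F \<beta> S'"
  note Fa = variety_ualgebra[OF var F]
  note Su = subuniverse_sub[OF S] and S'u = subuniverse_sub[OF S']
  have rS': "?r ` S' \<subseteq> S'"
    using rep_rel[OF \<beta> S'u] sat con_sym[OF \<beta>] by blast
  have B: "is_kernel_algebra ar m ?B"
    by (rule transversal_kernel_algebra[OF var F \<beta> S u ar_m u_idem _ _ m1 m2 commute])
       (use rS' SS' S'u in auto)
  have C: "is_kernel_algebra ar m ?C"
    by (rule transversal_kernel_algebra[OF var F \<beta> S' _ ar_m u_idem _ _ m1 m2 commute])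
       (use rS' SS' S'u u in auto)
  have B\<U>: "?B \<in> \<U>" and C\<U>: "?C \<in> \<U>"
    by (rule transversal_in_variety[OF var F \<beta> S] transversal_in_variety[OF var F \<beta> S']; use u SS' in blast)+
  \<comment> \<open>Both transversals use the same representatives and the same formula for the
    operations, so inclusion of the universes suffices.\<close>
  have sub: "subalgebra ar ?B ?C"
    unfolding subalgebra_def transversal_def using SS' by auto
  define j where "j = inv_into S ?r"
  have j: "j y \<in> S" "?r (j y) = y" if "y \<in> ?r ` S" for y
    using that unfolding j_def by (auto intro: inv_into_into f_inv_into_f)
  define \<phi>' where "\<phi>' = (\<lambda>y \<in> ?r ` S. \<phi> (j y))"
  have \<phi>'r: "\<phi>' (?r x) = \<phi> x" if "x \<in> S" for x
    using \<phi>_\<beta>[OF j(1) that] j[of "?r x"] rep_eq_iff[OF \<beta> Su[OF j(1)] Su[OF that]] that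
    unfolding \<phi>'_def by auto
  have "\<phi>' (ops ?B f ys) = ops E f (map \<phi>' ys)" if ys: "ys \<in> tuples (univ ?B) (ar f)" for f ys
  proof -
    have xs: "map j ys \<in> tuples S (ar f)" using ys j by (auto simp: in_tuples transversal_def)
    have y: "map ?r (map j ys) = ys" using ys j by (auto simp: in_tuples transversal_def intro!: map_idI)
    have "ops ?B f ys = ?r (ops F f (map j ys))"
      using rep_ops[OF \<beta> Fa subuniverse_tuples[OF S xs]] unfolding y by (simp add: transversal_def)
    then have "\<phi>' (ops ?B f ys) = ops E f (map \<phi> (map j ys))"
      using \<phi>'r[OF subuniverse_ops[OF S xs]] \<phi>_hom[OF xs] by simp
    also have "map \<phi> (map j ys) = map \<phi>' ys"
      using ys by (auto simp: \<phi>'_def in_tuples transversal_def)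
    finally show ?thesis .
  qed
  then have "\<phi>' \<in> alg_hom ar ?B E"
    using j \<phi>_in unfolding alg_hom_def univ_E by (auto simp: \<phi>'_def transversal_def)
  then obtain \<psi>' where \<psi>': "\<psi>' \<in> alg_hom ar ?C E" "\<And>x. x \<in> univ ?B \<Longrightarrow> \<psi>' x = \<phi>' x"
    using RD1 B C B\<U> C\<U> sub unfolding RD1_def by blast
  show ?thesis
  proof (rule that[of "\<lambda>x. \<psi>' (?r x)"])
    show "\<psi>' (?r x) \<in> carrier M" if "x \<in> S'" for x
      using \<psi>'(1) that unfolding alg_hom_def univ_E by (auto simp: transversal_def)
    show "\<psi>' (?r x) = \<psi>' (?r y)" if "x \<in> S'" "y \<in> S'" "(x, y) \<in> \<beta>" for x y
      using rep_eq_iff[OF \<beta> S'u[OF that(1)] S'u[OF that(2)]] that(3) by simp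
    show "\<psi>' (?r (ops F f xs)) = ops E f (map (\<lambda>x. \<psi>' (?r x)) xs)" if xs: "xs \<in> tuples S' (ar f)" for f xs
    proof -
      have "map ?r xs \<in> tuples (univ ?C) (ar f)" using xs by (auto simp: in_tuples transversal_def)
      then have "\<psi>' (ops ?C f (map ?r xs)) = ops E f (map \<psi>' (map ?r xs))"
        using \<psi>'(1) unfolding alg_hom_def by blast
      then show ?thesis
        using rep_ops[OF \<beta> Fa subuniverse_tuples[OF S' xs]] by (simp add: transversal_def comp_def)
    qed
    show "\<psi>' (?r x) = \<phi> x" if "x \<in> S" for x
      using \<psi>'(2)[of "?r x"] \<phi>'r[OF that] that by (simp add: transversal_def)
  qed
qed

section \<open>Free presentations\<close>

lemma inj_pair_infinite:
  assumes "infinite (UNIV :: 'u set)"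
  obtains j :: "'u \<times> 'u \<Rightarrow> 'u" where "inj j"
proof -
  have "(card_of (UNIV \<times> UNIV :: ('u \<times> 'u) set), card_of (UNIV :: 'u set)) \<in> ordLeq"
    using card_of_Times_same_infinite[OF assms] ordIso_imp_ordLeq by blast
  then show ?thesis using that unfolding card_of_ordLeq[symmetric] by auto
qed

text \<open>\<open>u0\<close> is a lift to \<open>F\<close> of the given idempotent of
  F/[\<theta>,1]; its idempotence survives modulo the commutator.\<close>

locale free_presentation = presented_alg R M ar m E F Q p
  for R :: "'r ring" and M :: "('r, 'u) module" and ar :: "'f \<Rightarrow> nat" and m
    and E F Q :: "('f, 'u) alg" and p +
  fixes \<U> :: "('f, 'u) alg set" and u0 :: 'u
  assumes inf: "infinite (UNIV :: 'u set)" and var: "variety ar \<U>" and diff: "difference_term ar \<U> m"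
    and RD1: "RD1 ar \<U> m E" and free: "free_algebra ar \<U> F" and Q_in: "Q \<in> \<U>" and E_in: "E \<in> \<U>"
    and u0: "u0 \<in> univ F"
    and u0_idem: "(ops F f (replicate (ar f) u0), u0) \<in> commutator ar F (hom_ker F p) (one_con F)"
begin

abbreviation "\<theta> \<equiv> hom_ker F p"
abbreviation "\<delta> \<equiv> commutator ar F \<theta> (one_con F)"
abbreviation "\<epsilon> \<equiv> commutator ar F (one_con F) (one_con F)"

lemma F_in: "F \<in> \<U>"
  using free unfolding free_algebra_def by simp

lemma ar_m: "ar m = 3"
  using diff unfolding difference_term_def by simp

lemma m1: "x \<in> univ F \<Longrightarrow> y \<in> univ F \<Longrightarrow> ops F m [x, x, y] = y"
  using diff F_in unfolding difference_term_def by simp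

lemma \<theta>_con: "\<theta> \<in> con ar F"
proof -
  have "equiv (univ F) \<theta>"
    unfolding hom_ker_def by (rule equivI) (auto simp: refl_on_def sym_def trans_def)
  moreover have "(ops F f xs, ops F f ys) \<in> \<theta>"
    if "xs \<in> tuples (univ F) (ar f)" "ys \<in> tuples (univ F) (ar f)"
      and s: "list_all2 (\<lambda>x y. (x, y) \<in> \<theta>) xs ys" for f xs ys
  proof -
    have "map p xs = map p ys"
      using s by (auto simp: list_all2_conv_all_nth hom_ker_def intro!: nth_equalityI)
    then show ?thesis using that p_hom F_ops unfolding hom_ker_def by simp
  qed
  ultimately show ?thesis unfolding con_def by simp
qed

lemma \<theta>_one: "\<theta> \<subseteq> one_con F"
  unfolding hom_ker_def one_con_def by auto

lemma \<delta>_con: "\<delta> \<in> con ar F" and \<epsilon>_con: "\<epsilon> \<in> con ar F"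
  by (rule commutator_con[OF F \<theta>_one order_refl] commutator_con[OF F order_refl order_refl])+

lemma \<delta>_le_\<theta>: "\<delta> \<subseteq> \<theta>"
  by (rule commutator_le_left[OF F \<theta>_con order_refl])

lemma \<delta>_le_\<epsilon>: "\<delta> \<subseteq> \<epsilon>"
  by (rule commutator_mono[OF \<theta>_one order_refl])

lemma m2_con:
  assumes \<alpha>: "\<alpha> \<in> con ar F" and xy: "(x, y) \<in> \<alpha>"
  shows "(ops F m [x, y, y], x) \<in> commutator ar F \<alpha> (one_con F)"
proof -
  have \<alpha>1: "\<alpha> \<subseteq> one_con F" using con_in[OF \<alpha>] unfolding one_con_def by auto
  have "(x, ops F m [x, y, y]) \<in> commutator ar F \<alpha> \<alpha>"
    using diff F_in \<alpha> xy unfolding difference_term_def by fastforce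
  then have "(x, ops F m [x, y, y]) \<in> commutator ar F \<alpha> (one_con F)"
    using commutator_mono[OF order_refl \<alpha>1] by auto
  then show ?thesis by (rule con_sym[OF commutator_con[OF F \<alpha>1 order_refl]])
qed

text \<open>Used for \<alpha> = \<theta>, modulo \<delta>, and for the full congruence, modulo
  \<epsilon>.\<close>

lemma m_commutes:
  assumes \<alpha>: "\<alpha> \<in> con ar F" and "length is = ar f"
    and "\<And>i. i \<in> set is \<Longrightarrow> (y i, x i) \<in> \<alpha>" "\<And>i. i \<in> set is \<Longrightarrow> z i \<in> univ F"
  shows "(ops F f (map (\<lambda>i. ops F m [y i, x i, z i]) is),
    ops F m [ops F f (map y is), ops F f (map x is), ops F f (map z is)]) \<in> commutator ar F \<alpha> (one_con F)"
proof -
  have \<alpha>1: "\<alpha> \<subseteq> one_con F" using con_in[OF \<alpha>] unfolding one_con_def by auto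
  show ?thesis
    by (rule central_difference_commutes[OF F \<alpha> commutator_con[OF F \<alpha>1 order_refl]
          centralizes_commutator ar_m m1 m2_con[OF \<alpha>]]) (use assms in auto)
qed

text \<open>The extension of \<open>Q\<close> by \<open>E\<close> given by \<open>T\<close> is copied into the type of
  \<open>F\<close> by an injection of pairs, so that the universal property of \<open>F\<close> applies.\<close>

lemma derivation_exists:
  assumes T: "T \<in> cocycles ar Q E" and comp: "compatible ar \<U> Q M E T"
  obtains D where "derivation T D"
proof -
  obtain j :: "'u \<times> 'u \<Rightarrow> 'u" where j: "inj j" using inj_pair_infinite[OF inf] .
  define i where "i = inv_into UNIV j"
  have ij: "i (j x) = x" for x using j unfolding i_def by simp
  define a b where "a = (\<lambda>x. fst (i x))" and "b = (\<lambda>x. snd (i x))"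
  define P where "P = \<lparr>univ = j ` (carrier M \<times> univ Q),
     ops = (\<lambda>f xs. j (ops E f (map a xs) \<oplus>\<^bsub>M\<^esub> T f (map b xs), ops Q f (map b xs)))\<rparr>"
  have ab: "a x \<in> carrier M" "b x \<in> univ Q" "j (a x, b x) = x" if "x \<in> univ P" for x
    using that ij unfolding P_def a_def b_def by auto
  have abj: "a (j (x, y)) = x" "b (j (x, y)) = y" for x y unfolding a_def b_def by (simp_all add: ij)
  have opsP: "ops E f (map a xs) \<in> carrier M" "T f (map b xs) \<in> carrier M" "ops Q f (map b xs) \<in> univ Q"
    if "xs \<in> tuples (univ P) (ar f)" for f xs
    using that ab by (auto simp: in_tuples intro!: ops_E_closed ops_closed[OF Q] cocycle_in[OF T])
  have "univ P \<noteq> {}" using u0 p_in by (auto simp: P_def)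
  moreover have "ops P f xs \<in> univ P" if "xs \<in> tuples (univ P) (ar f)" for f xs
    using opsP[OF that] by (simp add: P_def)
  ultimately have Pa: "ualgebra ar P" by (simp add: ualgebra_def subuniverse_def)
  have P_in: "P \<in> \<U>"
  proof (rule variety_memI[OF var Pa])
    fix e assume e: "e \<in> identities ar \<U>"
    then have wf: "wf_trm ar (fst e)" "wf_trm ar (snd e)" unfolding identities_def by auto
    show "satisfies P e"
      unfolding satisfies_def
    proof (intro allI impI)
      fix \<rho> :: "nat \<Rightarrow> 'u" assume \<rho>: "range \<rho> \<subseteq> univ P"
      have \<rho>a: "a (\<rho> v) \<in> carrier M" "b (\<rho> v) \<in> univ Q" for v using \<rho> ab by auto
      \<comment> \<open>Terms evaluate in the extension to (linear part + correction, value in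
        \<open>Q\<close>). The three parts agree on the two sides of an identity because of
        \<open>E\<close>, of compatibility and of \<open>Q\<close> respectively.\<close>
      have ev: "eval_trm P \<rho> t = j (eval_trm E (\<lambda>v. a (\<rho> v)) t \<oplus>\<^bsub>M\<^esub> partial_trm Q M E T (\<lambda>v. b (\<rho> v)) t,
          eval_trm Q (\<lambda>v. b (\<rho> v)) t)" if "wf_trm ar t" for t :: "('f, nat) trm"
        using that
      proof (induction t)
        case (Var v)
        then show ?case using ab(3)[of "\<rho> v"] \<rho> \<rho>a by (simp add: image_subset_iff)
      next
        case (App f ts)
        let ?e = "eval_trm E (\<lambda>v. a (\<rho> v))" and ?d = "partial_trm Q M E T (\<lambda>v. b (\<rho> v))"
          and ?q = "eval_trm Q (\<lambda>v. b (\<rho> v))"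
        have wf: "wf_trm ar t" if "t \<in> set ts" for t using App.prems that by simp
        have c: "?e t \<in> carrier M" "?d t \<in> carrier M" "?q t \<in> univ Q" if "t \<in> set ts" for t
          using wf[OF that] eval_E_closed[of t "\<lambda>v. a (\<rho> v)"] \<rho>a
            partial_trm_closed[OF kernel_alg_axioms Q T, of t "\<lambda>v. b (\<rho> v)"] eval_closed[OF Q, of t "\<lambda>v. b (\<rho> v)"]
          by auto
        have ma: "map a (map (eval_trm P \<rho>) ts) = map (\<lambda>t. ?e t \<oplus>\<^bsub>M\<^esub> ?d t) ts"
          and mb: "map b (map (eval_trm P \<rho>) ts) = map ?q ts"
          using App.IH wf by (simp_all add: abj)
        have "ops E f (map (\<lambda>t. ?e t \<oplus>\<^bsub>M\<^esub> ?d t) ts) = ops E f (map ?e ts) \<oplus>\<^bsub>M\<^esub> ops E f (map ?d ts)"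
          by (rule ops_add) (use App.prems c in auto)
        moreover have "ops E f (map ?e ts) \<in> carrier M" "ops E f (map ?d ts) \<in> carrier M"
          "T f (map ?q ts) \<in> carrier M"
          using App.prems c by (auto simp: in_tuples intro!: ops_E_closed cocycle_in[OF T])
        ultimately have "ops E f (map (\<lambda>t. ?e t \<oplus>\<^bsub>M\<^esub> ?d t) ts) \<oplus>\<^bsub>M\<^esub> T f (map ?q ts)
            = ?e (App f ts) \<oplus>\<^bsub>M\<^esub> ?d (App f ts)"
          by (simp add: M.a_assoc)
        then have "j (ops E f (map a (map (eval_trm P \<rho>) ts)) \<oplus>\<^bsub>M\<^esub> T f (map b (map (eval_trm P \<rho>) ts)),
            ops Q f (map b (map (eval_trm P \<rho>) ts))) = j (?e (App f ts) \<oplus>\<^bsub>M\<^esub> ?d (App f ts), ?q (App f ts))"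
          unfolding ma mb by simp
        then show ?case by (simp add: P_def)
      qed
      have "eval_trm E (\<lambda>v. a (\<rho> v)) (fst e) = eval_trm E (\<lambda>v. a (\<rho> v)) (snd e)"
        using variety_identities[OF E_in e] \<rho>a unfolding satisfies_def univ_E by (auto simp: image_subset_iff)
      moreover have "eval_trm Q (\<lambda>v. b (\<rho> v)) (fst e) = eval_trm Q (\<lambda>v. b (\<rho> v)) (snd e)"
        using variety_identities[OF Q_in e] \<rho>a unfolding satisfies_def by (auto simp: image_subset_iff)
      moreover have "partial_trm Q M E T (\<lambda>v. b (\<rho> v)) (fst e) = partial_trm Q M E T (\<lambda>v. b (\<rho> v)) (snd e)"
        using comp e \<rho>a unfolding compatible_def by (cases e) (auto simp: image_subset_iff)
      ultimately show "eval_trm P \<rho> (fst e) = eval_trm P \<rho> (snd e)" using ev wf by simp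
    qed
  qed
  obtain X where X: "X \<subseteq> univ F" "\<Inter>{S. subuniverse ar F S \<and> X \<subseteq> S} = univ F"
    and up: "\<forall>A \<in> \<U>. \<forall>g \<in> X \<rightarrow> univ A. \<exists>\<phi> \<in> alg_hom ar F A. \<forall>x \<in> X. \<phi> x = g x"
    using free unfolding free_algebra_def by blast
  \<comment> \<open>A generator \<open>x\<close> is sent to the point over \<open>p x\<close> with
    first coordinate 0; any other first coordinate would serve as well.\<close>
  have g: "(\<lambda>x. j (\<zero>\<^bsub>M\<^esub>, p x)) \<in> X \<rightarrow> univ P" using X(1) p_in unfolding P_def by auto
  obtain \<phi> where \<phi>: "\<phi> \<in> alg_hom ar F P" "\<And>x. x \<in> X \<Longrightarrow> \<phi> x = j (\<zero>\<^bsub>M\<^esub>, p x)"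
    using bspec[OF bspec[OF up P_in] g] by auto
  have \<phi>P: "\<phi> x \<in> univ P" if "x \<in> univ F" for x using \<phi>(1) that unfolding alg_hom_def by auto
  have \<phi>h: "\<phi> (ops F f xs) = ops P f (map \<phi> xs)" if "xs \<in> tuples (univ F) (ar f)" for f xs
    using \<phi>(1) that unfolding alg_hom_def by auto
  \<comment> \<open>The lift lies over \<open>p\<close>: the set on which it does is a subuniverse
    containing the generators.\<close>
  have "subuniverse ar F {x \<in> univ F. b (\<phi> x) = p x}"
    unfolding subuniverse_def
  proof (intro conjI allI ballI)
    fix f xs assume xs: "xs \<in> tuples {x \<in> univ F. b (\<phi> x) = p x} (ar f)"
    then have xF: "xs \<in> tuples (univ F) (ar f)" by (auto simp: in_tuples)
    have "map b (map \<phi> xs) = map p xs" using xs by (auto simp: in_tuples)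
    then have "b (\<phi> (ops F f xs)) = p (ops F f xs)"
      unfolding \<phi>h[OF xF] p_hom[OF xF] by (simp add: P_def abj del: map_map map_eq_conv)
    then show "ops F f xs \<in> {x \<in> univ F. b (\<phi> x) = p x}" using F_ops[OF xF] by simp
  qed auto
  moreover have "X \<subseteq> {x \<in> univ F. b (\<phi> x) = p x}" using X(1) \<phi>(2) abj by auto
  ultimately have "univ F \<subseteq> {x \<in> univ F. b (\<phi> x) = p x}" using X(2) by blast
  then have b\<phi>: "b (\<phi> x) = p x" if "x \<in> univ F" for x using that by auto
  have "derivation T (\<lambda>x. a (\<phi> x))"
    unfolding derivation_def
  proof (intro conjI allI ballI)
    fix f xs assume xs: "xs \<in> tuples (univ F) (ar f)"
    have "map b (map \<phi> xs) = map p xs" using xs b\<phi> by (auto simp: in_tuples)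
    then show "a (\<phi> (ops F f xs)) = ops E f (map (\<lambda>x. a (\<phi> x)) xs) \<oplus>\<^bsub>M\<^esub> T f (map p xs)"
      unfolding \<phi>h[OF xs] by (simp add: P_def abj comp_def del: map_eq_conv)
  qed (use \<phi>P ab in auto)
  then show ?thesis by (rule that)
qed

lemma compatible_iff:
  assumes "T \<in> cocycles ar Q E"
  shows "compatible ar \<U> Q M E T \<longleftrightarrow> (\<exists>D. derivation T D)"
  using derivation_exists[OF assms] compatible_if_derivation[OF _ assms]
    variety_identities[OF F_in] variety_identities[OF E_in] by metis

end

section \<open>The homomorphism attached to a cocycle\<close>

context free_presentation
begin

definition base_class :: "'u set" where
  "base_class = {x \<in> univ F. p x = p u0}"

text \<open>The preimage in \<open>F\<close> of the class algebra of the theorem. Homomorphisms on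
  that algebra are handled as maps on this set that are constant on classes of \<delta>.\<close>

definition derived_class :: "'u set" where
  "derived_class = {x \<in> base_class. (u0, x) \<in> \<epsilon>}"

abbreviation "cl x \<equiv> \<delta> `` {x}"

lemma base_classD: "x \<in> base_class \<Longrightarrow> x \<in> univ F" "x \<in> base_class \<Longrightarrow> p x = p u0"
  and u0_base: "u0 \<in> base_class"
  using u0 unfolding base_class_def by auto

lemma derived_classD: "x \<in> derived_class \<Longrightarrow> x \<in> base_class" "x \<in> derived_class \<Longrightarrow> (x, u0) \<in> \<epsilon>"
  and u0_derived: "u0 \<in> derived_class"
  using u0_base con_sym[OF \<epsilon>_con] con_refl[OF \<epsilon>_con u0] unfolding derived_class_def by auto

lemma \<theta>_iff: "(x, y) \<in> \<theta> \<longleftrightarrow> x \<in> univ F \<and> y \<in> univ F \<and> p x = p y"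
  unfolding hom_ker_def by auto

lemma \<delta>_p: "(x, y) \<in> \<delta> \<Longrightarrow> p x = p y"
  using subsetD[OF \<delta>_le_\<theta>, of "(x, y)"] \<theta>_iff[of x y] by simp

lemma u0_ops: "length is = ar f \<Longrightarrow> (ops F f (map (\<lambda>i. u0) is), u0) \<in> \<delta>"
  using u0_idem[of f] by (simp add: map_replicate_const)

text \<open>Since \<delta> lies below \<theta>, the element \<open>p u0\<close> is idempotent in
  \<open>Q\<close>, and its fibre is closed under the operations.\<close>

lemma base_subuniverse: "subuniverse ar F base_class"
  unfolding subuniverse_def
proof (intro conjI allI ballI)
  show "base_class \<subseteq> univ F" unfolding base_class_def by auto
  fix f xs assume xs: "xs \<in> tuples base_class (ar f)"
  then have xF: "xs \<in> tuples (univ F) (ar f)" and uF: "map (\<lambda>x. u0) xs \<in> tuples (univ F) (ar f)"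
    using base_classD u0 by (auto simp: in_tuples)
  have "map p xs = map p (map (\<lambda>x. u0) xs)" using xs base_classD(2) by (auto simp: in_tuples)
  then have "p (ops F f xs) = p (ops F f (map (\<lambda>x. u0) xs))" using p_hom[OF xF] p_hom[OF uF] by (simp only:)
  also have "\<dots> = p u0" using u0_ops xs by (intro \<delta>_p) (auto simp: in_tuples)
  finally show "ops F f xs \<in> base_class" using F_ops[OF xF] unfolding base_class_def by simp
qed

lemma derived_subuniverse: "subuniverse ar F derived_class"
  unfolding subuniverse_def
proof (intro conjI allI ballI)
  show "derived_class \<subseteq> univ F" using derived_classD(1) base_classD(1) by auto
  fix f xs assume xs: "xs \<in> tuples derived_class (ar f)"
  then have "ops F f xs \<in> base_class"
    using derived_classD(1) by (intro subuniverse_ops[OF base_subuniverse]) (auto simp: in_tuples)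
  moreover have "(ops F f (map (\<lambda>x. u0) xs), ops F f (map (\<lambda>x. x) xs)) \<in> \<epsilon>"
    using xs by (intro con_ops_map[OF \<epsilon>_con]) (auto simp: in_tuples derived_class_def)
  moreover have "(u0, ops F f (map (\<lambda>x. u0) xs)) \<in> \<epsilon>"
    by (rule con_sym[OF \<epsilon>_con subsetD[OF \<delta>_le_\<epsilon> u0_ops]]) (use xs in \<open>simp add: in_tuples\<close>)
  ultimately show "ops F f xs \<in> derived_class"
    using con_trans[OF \<epsilon>_con, of u0 "ops F f (map (\<lambda>x. u0) xs)"] unfolding derived_class_def by simp
qed

lemma derivation_\<delta>:
  "derivation T D \<Longrightarrow> T \<in> cocycles ar Q E \<Longrightarrow> (x, y) \<in> \<delta> \<Longrightarrow> D x = D y"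
  using commutator_le_fibre_ker[of T D] unfolding fibre_ker_def by auto

lemma derivation_unique:
  assumes C: "derivation T C" and D: "derivation T D" and T: "T \<in> cocycles ar Q E"
    and x: "x \<in> derived_class"
  shows "C x \<ominus>\<^bsub>M\<^esub> C u0 = D x \<ominus>\<^bsub>M\<^esub> D u0"
proof -
  have "C x \<ominus>\<^bsub>M\<^esub> D x = C u0 \<ominus>\<^bsub>M\<^esub> D u0"
    by (rule commutator_le_ker[OF F _ derivation_diff_hom[OF C D T] derived_classD(2)[OF x]])
       (use derivation_in[OF C] derivation_in[OF D] in auto)
  moreover have "C x \<in> carrier M" "D x \<in> carrier M" "C u0 \<in> carrier M" "D u0 \<in> carrier M"
    using derivation_in[OF C] derivation_in[OF D] base_classD(1)[OF derived_classD(1)[OF x]] u0 by auto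
  ultimately have "C x = (C u0 \<ominus>\<^bsub>M\<^esub> D u0) \<oplus>\<^bsub>M\<^esub> D x" "C u0 \<in> carrier M" "D x \<in> carrier M" "D u0 \<in> carrier M" "C x \<in> carrier M"
    by (auto simp: diff_eq_iff)
  then have "C x = (D x \<ominus>\<^bsub>M\<^esub> D u0) \<oplus>\<^bsub>M\<^esub> C u0" by (simp add: M.minus_eq M.a_ac)
  then show ?thesis using \<open>C x \<in> _\<close> \<open>C u0 \<in> _\<close> \<open>D x \<in> _\<close> \<open>D u0 \<in> _\<close> by (simp add: diff_eq_iff)
qed

text \<open>Here idempotence enters. On the fibre of \<open>u0\<close> the cocycle term is the same
  for \<open>xs\<close> as for the constant tuple \<open>u0\<close>; and D(u0) = D(f(u0, ..., u0)),
  as \<open>D\<close> is constant on classes of \<delta>. In the difference the cocycle terms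
  cancel.\<close>

lemma derivation_base_hom:
  assumes D: "derivation T D" and T: "T \<in> cocycles ar Q E" and xs: "xs \<in> tuples base_class (ar f)"
  shows "D (ops F f xs) \<ominus>\<^bsub>M\<^esub> D u0 = ops E f (map (\<lambda>x. D x \<ominus>\<^bsub>M\<^esub> D u0) xs)"
proof -
  have xF: "xs \<in> tuples (univ F) (ar f)" and uF: "map (\<lambda>x. u0) xs \<in> tuples (univ F) (ar f)"
    using xs base_classD u0 by (auto simp: in_tuples)
  have pe: "map p (map (\<lambda>x. u0) xs) = map p xs" using xs base_classD(2) by (auto simp: in_tuples)
  have "D u0 = D (ops F f (map (\<lambda>x. u0) xs))"
    by (rule derivation_\<delta>[OF D T con_sym[OF \<delta>_con u0_ops]]) (use xs in \<open>simp add: in_tuples\<close>)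
  also have "\<dots> = ops E f (map D (map (\<lambda>x. u0) xs)) \<oplus>\<^bsub>M\<^esub> T f (map p xs)"
    unfolding derivation_ops[OF D uF] pe ..
  finally have "D (ops F f xs) \<ominus>\<^bsub>M\<^esub> D u0 = ops E f (map D xs) \<ominus>\<^bsub>M\<^esub> ops E f (map D (map (\<lambda>x. u0) xs))"
    using derivation_ops[OF D xF] derivation_opsE_in[OF D xF] derivation_opsE_in[OF D uF]
      cocycle_in[OF T tuples_p[OF xF]] by (simp add: add_diff_add_cancel)
  also have "\<dots> = ops E f (map D xs) \<ominus>\<^bsub>M\<^esub> ops E f (map (\<lambda>x. D u0) xs)" by (simp add: comp_def)
  also have "\<dots> = ops E f (map (\<lambda>x. D x \<ominus>\<^bsub>M\<^esub> D u0) xs)"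
    using xF u0 by (intro ops_diff[symmetric]) (auto simp: in_tuples intro: derivation_in[OF D])
  finally show ?thesis .
qed

abbreviation "derived_alg \<equiv> class_alg (quot F \<delta>) (quot_con (\<theta> \<inter> \<epsilon>) \<delta>) (cl u0)"

text \<open>The base point of a pair may be changed inside its class of \<delta>, because \<delta>
  lies below both \<theta> and \<epsilon>.\<close>

lemma derived_alg_univ: "univ derived_alg = cl ` derived_class"
proof -
  have "y \<in> derived_class" if xy: "(x, y) \<in> \<theta>" "(x, y) \<in> \<epsilon>" and e: "cl u0 = cl x" for x y
  proof -
    have d: "(u0, x) \<in> \<delta>" using e con_Image_eq_iff[OF \<delta>_con u0, of x] xy \<theta>_iff by simp
    have "(u0, y) \<in> \<epsilon>" by (rule con_trans[OF \<epsilon>_con subsetD[OF \<delta>_le_\<epsilon> d] xy(2)])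
    then show ?thesis using \<delta>_p[OF d] xy \<theta>_iff unfolding derived_class_def base_class_def by simp
  qed
  note sub = this
  show ?thesis
  proof (rule equalityI; rule subsetI)
    fix c assume "c \<in> univ derived_alg"
    then obtain x y where "cl u0 = cl x" "c = cl y" "(x, y) \<in> \<theta>" "(x, y) \<in> \<epsilon>"
      unfolding class_alg_def quot_con_def by auto
    then show "c \<in> cl ` derived_class" using sub[of x y] by auto
  next
    fix c assume "c \<in> cl ` derived_class"
    then obtain x where x: "c = cl x" "x \<in> derived_class" by auto
    then have "(u0, x) \<in> \<theta> \<inter> \<epsilon>" using u0 unfolding derived_class_def base_class_def by (simp add: \<theta>_iff)
    then show "c \<in> univ derived_alg" unfolding x class_alg_def quot_con_def by auto
  qed
qed

lemma derived_alg_ops: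
  assumes "xs \<in> tuples (univ F) (ar f)"
  shows "ops derived_alg f (map cl xs) = cl (ops F f xs)"
  using quot_ops[OF \<delta>_con, of xs f] assms unfolding class_alg_def by (auto simp: in_tuples)

lemma cl_eq_iff: "x \<in> univ F \<Longrightarrow> y \<in> univ F \<Longrightarrow> cl x = cl y \<longleftrightarrow> (x, y) \<in> \<delta>"
  by (rule con_Image_eq_iff[OF \<delta>_con])

lemma derived_tuples:
  assumes "cs \<in> tuples (univ derived_alg) n"
  obtains xs where "xs \<in> tuples derived_class n" "cs = map cl xs"
proof -
  have "\<forall>c \<in> set cs. \<exists>x. c = cl x \<and> x \<in> derived_class"
    using assms unfolding derived_alg_univ in_tuples by auto
  then obtain g where g: "\<And>c. c \<in> set cs \<Longrightarrow> c = cl (g c) \<and> g c \<in> derived_class" by metis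
  show ?thesis
    by (rule that[of "map g cs"])
       (use g assms in \<open>auto simp: in_tuples intro!: map_idI[symmetric]\<close>)
qed

lemma derived_class_F: "x \<in> derived_class \<Longrightarrow> x \<in> univ F"
  using derived_classD(1) base_classD(1) by blast

text \<open>By \<open>derivation_unique\<close> the choice of the derivation does not matter.\<close>

definition Psi :: "('f \<Rightarrow> 'u list \<Rightarrow> 'u) \<Rightarrow> 'u set \<Rightarrow> 'u" where
  "Psi T = (\<lambda>c \<in> univ derived_alg. let D = SOME D. derivation T D in
     D (SOME x. x \<in> derived_class \<and> cl x = c) \<ominus>\<^bsub>M\<^esub> D u0)"

lemma Psi_cl:
  assumes D: "derivation T D" and T: "T \<in> cocycles ar Q E" and x: "x \<in> derived_class"
  shows "Psi T (cl x) = D x \<ominus>\<^bsub>M\<^esub> D u0"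
proof -
  define C where "C = (SOME D. derivation T D)"
  define y where "y = (SOME y. y \<in> derived_class \<and> cl y = cl x)"
  have C: "derivation T C" unfolding C_def by (rule someI[of "derivation T", OF D])
  have y: "y \<in> derived_class" "cl y = cl x"
    using someI[of "\<lambda>y. y \<in> derived_class \<and> cl y = cl x" x] x unfolding y_def by auto
  then have "(y, x) \<in> \<delta>" using cl_eq_iff[of y x] derived_class_F x by simp
  then have "C y = C x" by (rule derivation_\<delta>[OF C T])
  then have "Psi T (cl x) = C x \<ominus>\<^bsub>M\<^esub> C u0"
    using x unfolding Psi_def C_def[symmetric] y_def[symmetric] derived_alg_univ by (simp add: Let_def y_def[symmetric])
  then show ?thesis using derivation_unique[OF C D T x] by simp
qed

lemma Psi_in:
  assumes T: "T \<in> cocycles ar Q E" and D: "derivation T D"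
  shows "Psi T \<in> carrier (Hom0 ar derived_alg (cl u0) M E)"
proof -
  have "Psi T (ops derived_alg f cs) = ops E f (map (Psi T) cs)"
    if cs: "cs \<in> tuples (univ derived_alg) (ar f)" for f cs
  proof -
    obtain xs where xs: "xs \<in> tuples derived_class (ar f)" and c: "cs = map cl xs"
      using derived_tuples[OF cs] .
    have xF: "xs \<in> tuples (univ F) (ar f)" and xb: "xs \<in> tuples base_class (ar f)"
      using xs derived_class_F derived_classD(1) by (auto simp: in_tuples)
    have "Psi T (ops derived_alg f cs) = D (ops F f xs) \<ominus>\<^bsub>M\<^esub> D u0"
      unfolding c derived_alg_ops[OF xF]
      by (rule Psi_cl[OF D T subuniverse_ops[OF derived_subuniverse xs]])
    also have "\<dots> = ops E f (map (\<lambda>x. D x \<ominus>\<^bsub>M\<^esub> D u0) xs)" by (rule derivation_base_hom[OF D T xb])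
    also have "map (\<lambda>x. D x \<ominus>\<^bsub>M\<^esub> D u0) xs = map (Psi T) cs"
      unfolding c using xs Psi_cl[OF D T] by (auto simp: in_tuples)
    finally show ?thesis .
  qed
  moreover have "Psi T c \<in> carrier M" if "c \<in> univ derived_alg" for c
    using that Psi_cl[OF D T] derivation_in[OF D] derived_class_F u0 unfolding derived_alg_univ by auto
  moreover have "Psi T \<in> extensional (univ derived_alg)" unfolding Psi_def by simp
  moreover have "Psi T (cl u0) = \<zero>\<^bsub>M\<^esub>"
    using Psi_cl[OF D T u0_derived] derivation_in[OF D u0] by (simp add: M.minus_eq M.r_neg)
  ultimately show ?thesis unfolding Hom0_def alg_hom_def univ_E by (auto simp: PiE_def)
qed

lemma Psi_eqI:
  assumes "\<phi> \<in> extensional (univ derived_alg)" "\<psi> \<in> extensional (univ derived_alg)"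
    and "\<And>x. x \<in> derived_class \<Longrightarrow> \<phi> (cl x) = \<psi> (cl x)"
  shows "\<phi> = \<psi>"
  using assms by (intro extensionalityI[of _ "univ derived_alg"]) (auto simp: derived_alg_univ)

end

section \<open>Surjectivity and kernel of \<open>Psi\<close>\<close>

context free_presentation
begin

lemma m_in: "x \<in> univ F \<Longrightarrow> y \<in> univ F \<Longrightarrow> z \<in> univ F \<Longrightarrow> ops F m [x, y, z] \<in> univ F"
  by (rule ops_closed[OF F]) (auto simp: ar_m)

lemma m_con:
  assumes "\<beta> \<in> con ar F" "(x, x') \<in> \<beta>" "(y, y') \<in> \<beta>" "(z, z') \<in> \<beta>"
  shows "(ops F m [x, y, z], ops F m [x', y', z']) \<in> \<beta>"
  using assms by (intro con_ops[where ar = ar]) (auto simp: ar_m)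

text \<open>The difference of two elements of one fibre of \<open>p\<close>, translated to the fibre
  of \<open>u0\<close>.\<close>

lemma m_base:
  assumes "x \<in> univ F" "y \<in> univ F" "p x = p y"
  shows "ops F m [x, y, u0] \<in> base_class"
proof -
  have "(ops F m [x, y, u0], ops F m [y, y, u0]) \<in> \<theta>"
    using assms u0 by (intro m_con[OF \<theta>_con]) (auto simp: \<theta>_iff)
  then show ?thesis using m1[of y u0] assms u0 unfolding base_class_def \<theta>_iff by simp
qed

text \<open>The form of \<open>m_commutes\<close> that \<open>extend_hom\<close> asks for, with
  \<open>S\<close> inside a single class of \<alpha>.\<close>

lemma m_commutes_ps:
  assumes \<alpha>: "\<alpha> \<in> con ar F" and S: "S \<times> S \<subseteq> \<alpha>" and ps: "ps \<in> tuples (S \<times> S \<times> S) (ar f)"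
  shows "(ops F f (map (\<lambda>(x, y, z). ops F m [x, y, z]) ps),
       ops F m [ops F f (map fst ps), ops F f (map (fst \<circ> snd) ps), ops F f (map (snd \<circ> snd) ps)])
    \<in> commutator ar F \<alpha> (one_con F)"
proof -
  have "(fst q, (fst \<circ> snd) q) \<in> \<alpha>" "(snd \<circ> snd) q \<in> univ F" if "q \<in> set ps" for q
  proof -
    have "q \<in> S \<times> S \<times> S" using ps that by (simp add: in_tuples)
    then have "(fst q, fst (snd q)) \<in> \<alpha>" "(snd (snd q), snd (snd q)) \<in> \<alpha>"
      by (auto intro!: subsetD[OF S])
    then show "(fst q, (fst \<circ> snd) q) \<in> \<alpha>" "(snd \<circ> snd) q \<in> univ F"
      using con_in[OF \<alpha>, of "snd (snd q)"] by simp_all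
  qed
  then show ?thesis
    using m_commutes[OF \<alpha>, of ps f fst "fst \<circ> snd" "snd \<circ> snd"] ps
    by (simp add: in_tuples case_prod_unfold)
qed

lemma base_square: "base_class \<times> base_class \<subseteq> \<theta>"
  by (auto simp: \<theta>_iff base_class_def)

text \<open>Regularity extends \<phi> from \<open>derived_class\<close> to a map \<psi> on
  \<open>base_class\<close>. For a section \<open>l\<close> of \<open>p\<close>, the cocycle is
  \<psi> applied to f(l q) - l(f q), the failure of \<open>l\<close> to be a homomorphism, and
  \<open>D\<close> is \<psi> applied to x - l(p x). The extension is needed because these
  differences are only known to lie in \<open>base_class\<close>.\<close>

lemma Psi_surj:
  assumes \<phi>: "\<phi> \<in> carrier (Hom0 ar derived_alg (cl u0) M E)"
  obtains T where "T \<in> cocycles ar Q E" "\<exists>D. derivation T D" "Psi T = \<phi>"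
proof -
  have \<phi>_in: "\<phi> (cl x) \<in> carrier M" if "x \<in> derived_class" for x
    using \<phi> that unfolding Hom0_def alg_hom_def univ_E derived_alg_univ by auto
  have \<phi>_hom: "\<phi> (cl (ops F f xs)) = ops E f (map (\<lambda>x. \<phi> (cl x)) xs)" if xs: "xs \<in> tuples derived_class (ar f)" for f xs
  proof -
    have "map cl xs \<in> tuples (univ derived_alg) (ar f)" using xs by (auto simp: in_tuples derived_alg_univ)
    then have "\<phi> (ops derived_alg f (map cl xs)) = ops E f (map \<phi> (map cl xs))"
      using \<phi> unfolding Hom0_def alg_hom_def by simp
    then show ?thesis
      using derived_alg_ops[of xs f] xs derived_class_F by (simp add: comp_def in_tuples)
  qed
  obtain \<psi> where \<psi>_in: "\<And>x. x \<in> base_class \<Longrightarrow> \<psi> x \<in> carrier M"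
    and \<psi>_\<delta>: "\<And>x y. x \<in> base_class \<Longrightarrow> y \<in> base_class \<Longrightarrow> (x, y) \<in> \<delta> \<Longrightarrow> \<psi> x = \<psi> y"
    and \<psi>_hom: "\<And>f xs. xs \<in> tuples base_class (ar f) \<Longrightarrow> \<psi> (ops F f xs) = ops E f (map \<psi> xs)"
    and \<psi>_\<phi>: "\<And>x. x \<in> derived_class \<Longrightarrow> \<psi> x = \<phi> (cl x)"
  proof (rule extend_hom[OF var F_in RD1 \<delta>_con derived_subuniverse base_subuniverse _ u0_derived ar_m u0_idem
        _ m1 _ m_commutes_ps[OF \<theta>_con base_square] \<phi>_in _ \<phi>_hom])
    show "derived_class \<subseteq> base_class" using derived_classD(1) by auto
    show "y \<in> base_class" if "x \<in> base_class" "(x, y) \<in> \<delta>" for x y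
      using that \<delta>_p[OF that(2)] con_in[OF \<delta>_con that(2)] by (simp add: base_class_def)
    show "(ops F m [x, y, y], x) \<in> \<delta>" if "x \<in> base_class" "y \<in> base_class" for x y
      using m2_con[OF \<theta>_con] that base_square by auto
    show "\<phi> (cl x) = \<phi> (cl y)" if "x \<in> derived_class" "y \<in> derived_class" "(x, y) \<in> \<delta>" for x y
      using that cl_eq_iff[of x y] derived_class_F by simp
  qed auto
  have \<psi>0: "\<psi> u0 = \<zero>\<^bsub>M\<^esub>"
    using \<psi>_\<phi>[OF u0_derived] \<phi> unfolding Hom0_def by simp
  \<comment> \<open>The normalisation l(p u0) = u0 makes \<open>D\<close> agree with \<psi> on
    \<open>base_class\<close>, hence with \<phi> on \<open>derived_class\<close>.\<close>
  define l where "l = (\<lambda>q. if q = p u0 then u0 else SOME x. x \<in> univ F \<and> p x = q)"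
  have l: "l q \<in> univ F" "p (l q) = q" if "q \<in> univ Q" for q
    using someI_ex[of "\<lambda>x. x \<in> univ F \<and> p x = q"] p_surj[OF that] u0 unfolding l_def by auto
  define T where "T = (\<lambda>f. \<lambda>qs \<in> tuples (univ Q) (ar f). \<psi> (ops F m [ops F f (map l qs), l (ops Q f qs), u0]))"
  define D where "D = (\<lambda>x. \<psi> (ops F m [x, l (p x), u0]))"
  have lF: "map l qs \<in> tuples (univ F) n" "map p (map l qs) = qs" if "qs \<in> tuples (univ Q) n" for qs n
    using that l by (auto simp: in_tuples intro!: map_idI)
  have Qc: "ops Q f qs \<in> univ Q" if "qs \<in> tuples (univ Q) (ar f)" for f qs
    using that by (intro ops_closed[OF Q]) (auto simp: in_tuples)
  have pl: "p (ops F f (map l qs)) = ops Q f qs" if "qs \<in> tuples (univ Q) (ar f)" for f qs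
    unfolding p_hom[OF lF(1)[OF that]] lF(2)[OF that] ..
  have Tb: "ops F m [ops F f (map l qs), l (ops Q f qs), u0] \<in> base_class" if "qs \<in> tuples (univ Q) (ar f)" for f qs
    by (rule m_base[OF F_ops[OF lF(1)[OF that]] l(1)[OF Qc[OF that]]]) (simp add: pl[OF that] l(2)[OF Qc[OF that]])
  have T: "T \<in> cocycles ar Q E"
    unfolding cocycles_def T_def univ_E using \<psi>_in[OF Tb] by auto
  have Db: "ops F m [x, l (p x), u0] \<in> base_class" if "x \<in> univ F" for x
    by (rule m_base[OF that l(1)[OF p_in[OF that]]]) (simp add: l(2)[OF p_in[OF that]])
  have D: "derivation T D"
    unfolding derivation_def
  proof (intro conjI allI ballI)
    show "D x \<in> carrier M" if "x \<in> univ F" for x unfolding D_def by (rule \<psi>_in[OF Db[OF that]])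
    fix f xs assume xs: "xs \<in> tuples (univ F) (ar f)"
    have xu: "x \<in> univ F" if "x \<in> set xs" for x using xs that by (simp add: in_tuples)
    have len: "length xs = ar f" using xs by (simp add: in_tuples)
    define fx fl lf where "fx = ops F f xs" and "fl = ops F f (map l (map p xs))" and "lf = l (ops Q f (map p xs))"
    note ps = tuples_p[OF xs]
    have px: "p fx = ops Q f (map p xs)" unfolding fx_def by (rule p_hom[OF xs])
    have pfl: "p fl = ops Q f (map p xs)" unfolding fl_def by (rule pl[OF ps])
    have plf: "p lf = ops Q f (map p xs)" unfolding lf_def by (rule l(2)[OF Qc[OF ps]])
    have u: "fx \<in> univ F" "fl \<in> univ F" "lf \<in> univ F"
      unfolding fx_def fl_def lf_def by (rule F_ops[OF xs] F_ops[OF lF(1)[OF ps]] l(1)[OF Qc[OF ps]])+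
    note re = con_refl[OF \<delta>_con] and tr = con_trans[OF \<delta>_con] and sy = con_sym[OF \<delta>_con]
    \<comment> \<open>Split f(x) - l(f(p x)) at f(l(p x)): modulo \<delta>, \<open>w1\<close> is
      \<open>f\<close> of the differences x - l(p x), and \<open>w2\<close> is the element at which
      the cocycle evaluates \<psi>.\<close>
    define w1 w2 where "w1 = ops F m [fx, fl, u0]" and "w2 = ops F m [fl, lf, u0]"
    have w1b: "w1 \<in> base_class" and w2b: "w2 \<in> base_class" and wb: "ops F m [fx, lf, u0] \<in> base_class"
      unfolding w1_def w2_def using m_base u px pfl plf by simp_all
    have Dxs: "map (\<lambda>x. ops F m [x, l (p x), u0]) xs \<in> tuples base_class (ar f)"
      using Db xu len by (auto simp: in_tuples)
    have "(ops F f (map (\<lambda>x. ops F m [x, l (p x), u0]) xs),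
        ops F m [ops F f (map (\<lambda>x. x) xs), ops F f (map (\<lambda>x. l (p x)) xs), ops F f (map (\<lambda>x. u0) xs)]) \<in> \<delta>"
      by (rule m_commutes[OF \<theta>_con]) (use xu u0 l p_in len in \<open>auto simp: \<theta>_iff\<close>)
    moreover have "(ops F m [fx, fl, ops F f (map (\<lambda>x. u0) xs)], w1) \<in> \<delta>"
      unfolding w1_def by (rule m_con[OF \<delta>_con re[OF u(1)] re[OF u(2)] u0_ops[OF len]])
    ultimately have "(ops F f (map (\<lambda>x. ops F m [x, l (p x), u0]) xs), w1) \<in> \<delta>"
      using tr unfolding fx_def fl_def by (simp add: comp_def)
    then have "\<psi> w1 = \<psi> (ops F f (map (\<lambda>x. ops F m [x, l (p x), u0]) xs))"
      using \<psi>_\<delta>[OF subuniverse_ops[OF base_subuniverse Dxs] w1b] by simp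
    also have "\<dots> = ops E f (map D xs)"
      unfolding \<psi>_hom[OF Dxs] D_def by (simp add: comp_def)
    finally have w1: "\<psi> w1 = ops E f (map D xs)" .
    have w2: "\<psi> w2 = T f (map p xs)"
      using ps unfolding T_def w2_def fl_def lf_def by simp
    have sum: "\<psi> (ops F m [w1, u0, w2]) = ops E f (map D xs) \<oplus>\<^bsub>M\<^esub> T f (map p xs)"
    proof -
      have "[w1, u0, w2] \<in> tuples base_class (ar m)" using w1b w2b u0_base by (simp add: in_tuples ar_m)
      from \<psi>_hom[OF this] have "\<psi> (ops F m [w1, u0, w2]) = ops E m [\<psi> w1, \<zero>\<^bsub>M\<^esub>, \<psi> w2]" by (simp add: \<psi>0)
      also have "\<dots> = \<psi> w1 \<oplus>\<^bsub>M\<^esub> \<psi> w2"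
        using \<psi>_in[OF w1b] \<psi>_in[OF w2b] by (simp add: ops_m M.minus_eq)
      finally show ?thesis unfolding w1 w2 .
    qed
    \<comment> \<open>By rows this 3 x 3 array gives m(w1, u0, w2), the sum of the two parts; by
      columns it gives m(fx, lf, u0) modulo \<delta>.\<close>
    let ?ps = "[(fx, fl, u0), (fl, fl, u0), (fl, lf, u0)]"
    have "(ops F m (map (\<lambda>q. ops F m [fst q, fst (snd q), snd (snd q)]) ?ps),
       ops F m [ops F m (map fst ?ps), ops F m (map (\<lambda>q. fst (snd q)) ?ps), ops F m (map (\<lambda>q. snd (snd q)) ?ps)]) \<in> \<delta>"
      by (rule m_commutes[OF \<theta>_con]) (use u u0 px pfl plf in \<open>auto simp: ar_m \<theta>_iff\<close>)
    then have "(ops F m [w1, u0, w2], ops F m [ops F m [fx, fl, fl], lf, u0]) \<in> \<delta>"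
      using m1 u u0 by (simp add: w1_def w2_def)
    moreover have "(ops F m [ops F m [fx, fl, fl], lf, u0], ops F m [fx, lf, u0]) \<in> \<delta>"
      using m2_con[OF \<theta>_con, of fx fl] u px pfl u0 re by (intro m_con[OF \<delta>_con]) (auto simp: \<theta>_iff)
    ultimately have "(ops F m [w1, u0, w2], ops F m [fx, lf, u0]) \<in> \<delta>" by (rule tr)
    moreover have "ops F m [w1, u0, w2] \<in> base_class"
      using w1b w2b u0_base by (intro subuniverse_ops[OF base_subuniverse]) (simp add: in_tuples ar_m)
    ultimately have "\<psi> (ops F m [fx, lf, u0]) = ops E f (map D xs) \<oplus>\<^bsub>M\<^esub> T f (map p xs)"
      using \<psi>_\<delta>[OF _ wb] sum by simp
    then show "D (ops F f xs) = ops E f (map D xs) \<oplus>\<^bsub>M\<^esub> T f (map p xs)"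
      using px unfolding D_def fx_def lf_def by simp
  qed
  have Db: "D x = \<psi> x" if x: "x \<in> base_class" for x
  proof -
    have "l (p x) = u0" using x unfolding l_def base_class_def by simp
    moreover have "(ops F m [x, u0, u0], x) \<in> \<delta>"
      using m2_con[OF \<theta>_con] x base_square u0_base by auto
    moreover have "ops F m [x, u0, u0] \<in> base_class"
      using x u0_base by (intro subuniverse_ops[OF base_subuniverse]) (simp add: in_tuples ar_m)
    ultimately show ?thesis using \<psi>_\<delta>[OF _ x] unfolding D_def by simp
  qed
  have "Psi T = \<phi>"
  proof (rule Psi_eqI)
    show "Psi T \<in> extensional (univ derived_alg)" unfolding Psi_def by simp
    show "\<phi> \<in> extensional (univ derived_alg)" using \<phi> unfolding Hom0_def alg_hom_def by (auto simp: PiE_def)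
    show "Psi T (cl x) = \<phi> (cl x)" if x: "x \<in> derived_class" for x
      using Psi_cl[OF D T x] Db[OF derived_classD(1)[OF x]] Db[OF u0_base] \<psi>0 \<psi>_\<phi>[OF x] \<phi>_in[OF x]
      by (simp add: M.minus_eq)
  qed
  then show ?thesis using that T D by blast
qed

text \<open>The cocycle f(h) - h(f) is exactly the failure of -h to be a homomorphism. The resulting
  derivation factors through \<open>p\<close>, so it is constant on \<open>base_class\<close>, which
  makes \<open>Psi\<close> vanish on coboundaries.\<close>

lemma coboundary_derivation:
  assumes h: "h \<in> univ Q \<rightarrow> carrier M"
    and T: "T = (\<lambda>f. \<lambda>xs \<in> tuples (univ Q) (ar f). ops E f (map h xs) \<ominus>\<^bsub>M\<^esub> h (ops Q f xs))"
  shows "T \<in> cocycles ar Q E" "derivation T (\<lambda>x. \<ominus>\<^bsub>M\<^esub> h (p x))"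
proof -
  have hc: "h q \<in> carrier M" if "q \<in> univ Q" for q using h that by auto
  have c: "h (ops Q f qs) \<in> carrier M" "ops E f (map h qs) \<in> carrier M" if "qs \<in> tuples (univ Q) (ar f)" for f qs
    using that ops_closed[OF Q, of qs f] by (auto simp: in_tuples intro!: ops_E_closed hc)
  then show "T \<in> cocycles ar Q E" unfolding T cocycles_def univ_E by auto
  show "derivation T (\<lambda>x. \<ominus>\<^bsub>M\<^esub> h (p x))"
    unfolding derivation_def
  proof (intro conjI allI ballI)
    show "\<ominus>\<^bsub>M\<^esub> h (p x) \<in> carrier M" if "x \<in> univ F" for x using h p_in[OF that] by auto
    fix f xs assume xs: "xs \<in> tuples (univ F) (ar f)"
    have "ops E f (map (\<lambda>x. \<ominus>\<^bsub>M\<^esub> h (p x)) xs) = \<ominus>\<^bsub>M\<^esub> ops E f (map (\<lambda>x. h (p x)) xs)"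
      by (rule ops_neg) (use xs h p_in in \<open>auto simp: in_tuples\<close>)
    then show "\<ominus>\<^bsub>M\<^esub> h (p (ops F f xs)) = ops E f (map (\<lambda>x. \<ominus>\<^bsub>M\<^esub> h (p x)) xs) \<oplus>\<^bsub>M\<^esub> T f (map p xs)"
      using p_hom[OF xs] tuples_p[OF xs] c[OF tuples_p[OF xs]]
      by (simp add: T comp_def M.minus_eq M.r_neg1)
  qed
qed

lemma Psi_coboundary:
  assumes "T \<in> coboundaries ar Q M E"
  shows "T \<in> cocycles ar Q E" "\<exists>D. derivation T D" "Psi T = (\<lambda>c \<in> univ derived_alg. \<zero>\<^bsub>M\<^esub>)"
proof -
  obtain h where h: "h \<in> univ Q \<rightarrow> carrier M"
    and T: "T = (\<lambda>f. \<lambda>xs \<in> tuples (univ Q) (ar f). ops E f (map h xs) \<ominus>\<^bsub>M\<^esub> h (ops Q f xs))"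
    using assms unfolding coboundaries_def univ_E by blast
  note D = coboundary_derivation[OF h T]
  show "T \<in> cocycles ar Q E" "\<exists>D. derivation T D" using D by auto
  show "Psi T = (\<lambda>c \<in> univ derived_alg. \<zero>\<^bsub>M\<^esub>)"
  proof (rule Psi_eqI)
    show "Psi T \<in> extensional (univ derived_alg)" unfolding Psi_def by simp
    have "h (p u0) \<in> carrier M" using h p_in[OF u0] by auto
    then show "Psi T (cl x) = (\<lambda>c \<in> univ derived_alg. \<zero>\<^bsub>M\<^esub>) (cl x)" if x: "x \<in> derived_class" for x
      using Psi_cl[OF D(2,1) x] base_classD(2)[OF derived_classD(1)[OF x]] x
      by (simp add: derived_alg_univ M.minus_eq M.l_neg)
  qed simp
qed

text \<open>Conversely, if \<open>Psi T = 0\<close> then \<open>D - D u0\<close> factors on \<open>base_class\<close> through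
  \<open>F/[1,1]\<close>; regularity extends it to all of \<open>F/[1,1]\<close>, and subtracting the extension makes
  the derivation constant on the classes of \<open>\<theta>\<close>.\<close>

lemma coboundary_if_Psi:
  assumes T: "T \<in> cocycles ar Q E" and D: "derivation T D" and 0: "Psi T = (\<lambda>c \<in> univ derived_alg. \<zero>\<^bsub>M\<^esub>)"
  shows "T \<in> coboundaries ar Q M E"
proof -
  have Din: "D x \<in> carrier M" if "x \<in> univ F" for x by (rule derivation_in[OF D that])
  have D0: "D x = D u0" if x: "x \<in> derived_class" for x
  proof -
    have "D x \<ominus>\<^bsub>M\<^esub> D u0 = \<zero>\<^bsub>M\<^esub>" using Psi_cl[OF D T x] x unfolding 0 derived_alg_univ by simp
    then show ?thesis using Din derived_class_F[OF x] u0 by (simp add: diff_eq_iff)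
  qed
  define \<phi> where "\<phi> = (\<lambda>x. D x \<ominus>\<^bsub>M\<^esub> D u0)"
  have \<phi>_in: "\<phi> x \<in> carrier M" if "x \<in> base_class" for x
    unfolding \<phi>_def using Din base_classD(1)[OF that] u0 by simp
  have \<phi>_hom: "\<phi> (ops F f xs) = ops E f (map \<phi> xs)" if "xs \<in> tuples base_class (ar f)" for f xs
    unfolding \<phi>_def by (rule derivation_base_hom[OF D T that])
  \<comment> \<open>For \<epsilon>-related \<open>x\<close> and \<open>y\<close> the difference m(x,
    y, u0) lies in \<open>derived_class\<close>, where \<phi> vanishes; and \<phi> turns it into
    \<phi> x - \<phi> y.\<close>
  have \<phi>_\<epsilon>: "\<phi> x = \<phi> y" if x: "x \<in> base_class" and y: "y \<in> base_class" and xy: "(x, y) \<in> \<epsilon>" for x y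
  proof -
    have t: "[x, y, u0] \<in> tuples base_class (ar m)" using x y u0_base by (simp add: in_tuples ar_m)
    have b: "ops F m [x, y, u0] \<in> base_class" by (rule subuniverse_ops[OF base_subuniverse t])
    have "(ops F m [x, y, u0], ops F m [y, y, u0]) \<in> \<epsilon>"
      by (rule m_con[OF \<epsilon>_con xy con_refl[OF \<epsilon>_con base_classD(1)[OF y]] con_refl[OF \<epsilon>_con u0]])
    then have "(u0, ops F m [x, y, u0]) \<in> \<epsilon>"
      using m1[OF base_classD(1)[OF y] u0] con_sym[OF \<epsilon>_con] by simp
    then have "ops F m [x, y, u0] \<in> derived_class" using b unfolding derived_class_def by simp
    then have "\<phi> (ops F m [x, y, u0]) = \<zero>\<^bsub>M\<^esub>" using D0 Din[OF u0] unfolding \<phi>_def by (simp add: M.minus_eq M.r_neg)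
    moreover have "\<phi> u0 = \<zero>\<^bsub>M\<^esub>" using Din[OF u0] unfolding \<phi>_def by (simp add: M.minus_eq M.r_neg)
    ultimately have "(\<phi> x \<ominus>\<^bsub>M\<^esub> \<phi> y) \<oplus>\<^bsub>M\<^esub> \<zero>\<^bsub>M\<^esub> = \<zero>\<^bsub>M\<^esub>"
      using \<phi>_hom[OF t] \<phi>_in[OF x] \<phi>_in[OF y] by (simp add: ops_m)
    then show ?thesis using \<phi>_in[OF x] \<phi>_in[OF y] by (simp add: diff_eq_iff)
  qed
  have FF: "univ F \<times> univ F \<subseteq> one_con F" unfolding one_con_def by simp
  have subF: "subuniverse ar F (univ F)" using F unfolding ualgebra_def by simp
  obtain \<psi> where \<psi>_in: "\<And>x. x \<in> univ F \<Longrightarrow> \<psi> x \<in> carrier M"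
    and \<psi>_hom: "\<And>f xs. xs \<in> tuples (univ F) (ar f) \<Longrightarrow> \<psi> (ops F f xs) = ops E f (map \<psi> xs)"
    and \<psi>_\<phi>: "\<And>x. x \<in> base_class \<Longrightarrow> \<psi> x = \<phi> x"
  proof (rule extend_hom[OF var F_in RD1 \<epsilon>_con base_subuniverse subF _ u0_base ar_m subsetD[OF \<delta>_le_\<epsilon> u0_idem]
        _ m1 _ m_commutes_ps[OF one_con_con[OF F] FF] \<phi>_in \<phi>_\<epsilon> \<phi>_hom])
    show "base_class \<subseteq> univ F" using base_classD(1) by auto
    show "y \<in> univ F" if "(x, y) \<in> \<epsilon>" for x y using con_in[OF \<epsilon>_con that] by simp
    show "(ops F m [x, y, y], x) \<in> \<epsilon>" if "x \<in> univ F" "y \<in> univ F" for x y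
      using m2_con[OF one_con_con[OF F]] that unfolding one_con_def by simp
  qed auto
  define C where "C = (\<lambda>x. D x \<ominus>\<^bsub>M\<^esub> \<psi> x)"
  have Cin: "C x \<in> carrier M" if "x \<in> univ F" for x unfolding C_def using Din \<psi>_in that by simp
  have C: "derivation T C"
    unfolding derivation_def
  proof (intro conjI allI ballI)
    fix f xs assume xs: "xs \<in> tuples (univ F) (ar f)"
    have "ops E f (map C xs) = ops E f (map D xs) \<ominus>\<^bsub>M\<^esub> ops E f (map \<psi> xs)"
      unfolding C_def by (rule ops_diff) (use xs Din \<psi>_in in \<open>auto simp: in_tuples\<close>)
    moreover have "ops E f (map \<psi> xs) \<in> carrier M"
      using xs \<psi>_in by (intro ops_E_closed) (auto simp: in_tuples)
    ultimately show "C (ops F f xs) = ops E f (map C xs) \<oplus>\<^bsub>M\<^esub> T f (map p xs)"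
      using derivation_ops[OF D xs] \<psi>_hom[OF xs] derivation_opsE_in[OF D xs] cocycle_in[OF T tuples_p[OF xs]]
      unfolding C_def by (simp add: M.minus_eq M.a_ac)
  qed (rule Cin)
  have Cb: "C x = D u0" if x: "x \<in> base_class" for x
    using \<psi>_\<phi>[OF x] Din[OF u0] Din[OF base_classD(1)[OF x]] unfolding C_def \<phi>_def
    by (simp add: M.minus_eq M.minus_add M.r_neg2)
  \<comment> \<open>Constancy spreads from \<open>base_class\<close> to every class of \<theta>. If
    p x = p y, then m(x, y, u0) is in \<open>base_class\<close>, so the derivation rule for
    \<open>m\<close> determines C x - C y by a cocycle value that depends on \<open>p y\<close> and
    not on \<open>x\<close>; comparison with the case x = y gives zero.\<close>
  have C\<theta>: "C x = C y" if xy: "x \<in> univ F" "y \<in> univ F" "p x = p y" for x y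
  proof -
    have e: "D u0 = ((C x \<ominus>\<^bsub>M\<^esub> C y) \<oplus>\<^bsub>M\<^esub> D u0) \<oplus>\<^bsub>M\<^esub> T m [p y, p y, p u0]"
      if "x \<in> univ F" "p x = p y" for x
    proof -
      have t: "[x, y, u0] \<in> tuples (univ F) (ar m)" using that xy(2) u0 by (simp add: in_tuples ar_m)
      then show ?thesis
        using derivation_ops[OF C t] Cb[OF m_base[OF that(1) xy(2) that(2)]] Cb[OF u0_base] that
          Cin[OF that(1)] Cin[OF xy(2)] Din[OF u0] by (simp add: ops_m)
    qed
    have "[p y, p y, p u0] \<in> tuples (univ Q) (ar m)" using p_in xy u0 by (simp add: in_tuples ar_m)
    then have tc: "T m [p y, p y, p u0] \<in> carrier M" by (rule cocycle_in[OF T])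
    have "((C x \<ominus>\<^bsub>M\<^esub> C y) \<oplus>\<^bsub>M\<^esub> D u0) \<oplus>\<^bsub>M\<^esub> T m [p y, p y, p u0] = ((C y \<ominus>\<^bsub>M\<^esub> C y) \<oplus>\<^bsub>M\<^esub> D u0) \<oplus>\<^bsub>M\<^esub> T m [p y, p y, p u0]"
      using e[OF xy(1,3)] e[OF xy(2) refl] by simp
    then have "C x \<ominus>\<^bsub>M\<^esub> C y = C y \<ominus>\<^bsub>M\<^esub> C y"
      using tc Cin xy Din[OF u0] by (simp add: M.add.right_cancel)
    then show ?thesis using Cin xy by (simp add: M.minus_eq M.add.right_cancel)
  qed
  define l where "l = (\<lambda>q. SOME x. x \<in> univ F \<and> p x = q)"
  have l: "l q \<in> univ F" "p (l q) = q" if "q \<in> univ Q" for q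
    using someI_ex[of "\<lambda>x. x \<in> univ F \<and> p x = q"] p_surj[OF that] unfolding l_def by auto
  \<comment> \<open>By \<open>C\<theta>\<close> the map \<open>C\<close> factors through
    \<open>p\<close> as q |-> C(l q); the sign matches the convention f(h) - h(f) for
    coboundaries.\<close>
  define h where "h = (\<lambda>q. \<ominus>\<^bsub>M\<^esub> C (l q))"
  have h: "h \<in> univ Q \<rightarrow> carrier M" unfolding h_def using Cin l by auto
  have "T f qs = ops E f (map h qs) \<ominus>\<^bsub>M\<^esub> h (ops Q f qs)" if qs: "qs \<in> tuples (univ Q) (ar f)" for f qs
  proof -
    have Qc: "ops Q f qs \<in> univ Q" using qs by (intro ops_closed[OF Q]) (auto simp: in_tuples)
    have lq: "map l qs \<in> tuples (univ F) (ar f)" and pl: "map p (map l qs) = qs"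
      using qs l by (auto simp: in_tuples intro!: map_idI)
    have "C (l (ops Q f qs)) = C (ops F f (map l qs))"
      by (rule C\<theta>[OF l(1)[OF Qc] F_ops[OF lq]]) (simp only: p_hom[OF lq] pl l(2)[OF Qc])
    also have "\<dots> = ops E f (map C (map l qs)) \<oplus>\<^bsub>M\<^esub> T f qs"
      using derivation_ops[OF C lq] unfolding pl .
    finally have e: "C (l (ops Q f qs)) = ops E f (map C (map l qs)) \<oplus>\<^bsub>M\<^esub> T f qs" .
    have "ops E f (map h qs) = \<ominus>\<^bsub>M\<^esub> ops E f (map (\<lambda>q. C (l q)) qs)"
      unfolding h_def by (rule ops_neg) (use qs Cin l in \<open>auto simp: in_tuples\<close>)
    then show ?thesis
      using e derivation_opsE_in[OF C lq] cocycle_in[OF T qs]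
      by (simp add: h_def M.minus_eq comp_def M.r_neg1)
  qed
  moreover have "T f \<in> extensional (tuples (univ Q) (ar f))" for f
    using T unfolding cocycles_def by (auto simp: PiE_def)
  ultimately have "T = (\<lambda>f. \<lambda>qs \<in> tuples (univ Q) (ar f). ops E f (map h qs) \<ominus>\<^bsub>M\<^esub> h (ops Q f qs))"
    by (intro ext[of T] extensionalityI[of _ "tuples (univ Q) (ar _)"]) auto
  then show ?thesis using h unfolding coboundaries_def univ_E by blast
qed

section \<open>The group of cocycles and the isomorphism theorem\<close>

abbreviation "ZZ \<equiv> Z2 ar \<U> Q M E"

lemma Z2_carrier: "T \<in> carrier ZZ \<longleftrightarrow> T \<in> cocycles ar Q E \<and> (\<exists>D. derivation T D)"
  unfolding Z2_def using compatible_iff by auto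

lemma Z2_mult: "S \<otimes>\<^bsub>ZZ\<^esub> T = (\<lambda>f. \<lambda>xs \<in> tuples (univ Q) (ar f). S f xs \<oplus>\<^bsub>M\<^esub> T f xs)"
  and Z2_one: "\<one>\<^bsub>ZZ\<^esub> = (\<lambda>f. \<lambda>xs \<in> tuples (univ Q) (ar f). \<zero>\<^bsub>M\<^esub>)"
  unfolding Z2_def by simp_all

text \<open>Compatibility is checked through derivations, which add and change sign together with
  their cocycles, rather than through identities.\<close>

lemma Z2_comm_group: "comm_group ZZ"
proof (rule comm_groupI)
  have ci: "T f xs \<in> carrier M" if "T \<in> carrier ZZ" "xs \<in> tuples (univ Q) (ar f)" for T f xs
    using that cocycle_in unfolding Z2_carrier by blast
  show "S \<otimes>\<^bsub>ZZ\<^esub> T \<in> carrier ZZ" if "S \<in> carrier ZZ" "T \<in> carrier ZZ" for S T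
  proof -
    have "S \<otimes>\<^bsub>ZZ\<^esub> T \<in> cocycles ar Q E"
      using ci[OF that(1)] ci[OF that(2)] unfolding Z2_mult cocycles_def univ_E by auto
    then show ?thesis using that derivation_add[of S _ T] unfolding Z2_carrier Z2_mult by blast
  qed
  show "\<one>\<^bsub>ZZ\<^esub> \<in> carrier ZZ"
  proof -
    have "\<one>\<^bsub>ZZ\<^esub> \<in> cocycles ar Q E" unfolding Z2_one cocycles_def univ_E by auto
    moreover have "derivation \<one>\<^bsub>ZZ\<^esub> (\<lambda>x. \<zero>\<^bsub>M\<^esub>)"
      unfolding derivation_def Z2_one by (auto simp: in_tuples p_in ops_zero)
    ultimately show ?thesis unfolding Z2_carrier by blast
  qed
  show "\<exists>S \<in> carrier ZZ. S \<otimes>\<^bsub>ZZ\<^esub> T = \<one>\<^bsub>ZZ\<^esub>" if "T \<in> carrier ZZ" for T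
  proof (rule bexI[of _ "\<lambda>f. \<lambda>xs \<in> tuples (univ Q) (ar f). \<ominus>\<^bsub>M\<^esub> T f xs"])
    show "(\<lambda>f. \<lambda>xs \<in> tuples (univ Q) (ar f). \<ominus>\<^bsub>M\<^esub> T f xs) \<otimes>\<^bsub>ZZ\<^esub> T = \<one>\<^bsub>ZZ\<^esub>"
      unfolding Z2_mult Z2_one using ci[OF that] by (auto simp: M.l_neg intro!: restrict_ext)
    have "(\<lambda>f. \<lambda>xs \<in> tuples (univ Q) (ar f). \<ominus>\<^bsub>M\<^esub> T f xs) \<in> cocycles ar Q E"
      using ci[OF that] unfolding cocycles_def univ_E by auto
    then show "(\<lambda>f. \<lambda>xs \<in> tuples (univ Q) (ar f). \<ominus>\<^bsub>M\<^esub> T f xs) \<in> carrier ZZ"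
      using that derivation_neg[of T] unfolding Z2_carrier by blast
  qed
  show "S \<otimes>\<^bsub>ZZ\<^esub> T \<otimes>\<^bsub>ZZ\<^esub> U = S \<otimes>\<^bsub>ZZ\<^esub> (T \<otimes>\<^bsub>ZZ\<^esub> U)"
    if "S \<in> carrier ZZ" "T \<in> carrier ZZ" "U \<in> carrier ZZ" for S T U
    unfolding Z2_mult using ci that by (auto simp: M.a_assoc intro!: restrict_ext)
  show "S \<otimes>\<^bsub>ZZ\<^esub> T = T \<otimes>\<^bsub>ZZ\<^esub> S" if "S \<in> carrier ZZ" "T \<in> carrier ZZ" for S T
    unfolding Z2_mult using ci that by (auto simp: M.a_comm intro!: restrict_ext)
  show "\<one>\<^bsub>ZZ\<^esub> \<otimes>\<^bsub>ZZ\<^esub> T = T" if T: "T \<in> carrier ZZ" for T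
  proof
    fix f
    have "T f \<in> extensional (tuples (univ Q) (ar f))"
      using T unfolding Z2_carrier cocycles_def by (auto simp: PiE_def)
    then show "(\<one>\<^bsub>ZZ\<^esub> \<otimes>\<^bsub>ZZ\<^esub> T) f = T f"
      unfolding Z2_mult Z2_one using ci[OF T]
      by (auto intro!: extensionalityI[of _ "tuples (univ Q) (ar f)"])
  qed
qed

lemma derived_alg_ualgebra: "ualgebra ar derived_alg" and cl_u0_in: "cl u0 \<in> univ derived_alg"
proof -
  show "cl u0 \<in> univ derived_alg" using u0_derived unfolding derived_alg_univ by simp
  moreover have "ops derived_alg f cs \<in> univ derived_alg" if cs: "cs \<in> tuples (univ derived_alg) (ar f)" for f cs
  proof -
    obtain xs where xs: "xs \<in> tuples derived_class (ar f)" and c: "cs = map cl xs"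
      using derived_tuples[OF cs] .
    have "xs \<in> tuples (univ F) (ar f)" using xs derived_class_F by (auto simp: in_tuples)
    then show ?thesis
      using subuniverse_ops[OF derived_subuniverse xs] unfolding c derived_alg_univ by (simp add: derived_alg_ops)
  qed
  ultimately show "ualgebra ar derived_alg" by (auto simp: ualgebra_def subuniverse_def)
qed

text \<open>First isomorphism theorem for \<open>Psi\<close>. That the coboundaries form a subgroup
  comes from recognising them as its kernel.\<close>

theorem H2_iso:
  shows "comm_group (H2 ar \<U> Q M E)" "H2 ar \<U> Q M E \<cong> Hom0 ar derived_alg (cl u0) M E"
proof -
  let ?H = "Hom0 ar derived_alg (cl u0) M E"
  interpret Z: comm_group ZZ by (rule Z2_comm_group)
  interpret H: comm_group ?H by (rule Hom0_comm_group[OF derived_alg_ualgebra cl_u0_in])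
  have PsiH: "Psi \<in> hom ZZ ?H"
  proof (rule homI)
    show "Psi T \<in> carrier ?H" if "T \<in> carrier ZZ" for T
      using that Psi_in unfolding Z2_carrier by blast
    fix S T assume S: "S \<in> carrier ZZ" and T: "T \<in> carrier ZZ"
    have ST: "S \<otimes>\<^bsub>ZZ\<^esub> T \<in> cocycles ar Q E" using Z.m_closed[OF S T] unfolding Z2_carrier by simp
    obtain C D where C: "derivation S C" "S \<in> cocycles ar Q E" and D: "derivation T D" "T \<in> cocycles ar Q E"
      using S T unfolding Z2_carrier by auto
    note CD = derivation_add[OF C(1) D(1) C(2) D(2), folded Z2_mult]
    show "Psi (S \<otimes>\<^bsub>ZZ\<^esub> T) = Psi S \<otimes>\<^bsub>?H\<^esub> Psi T"
    proof (rule Psi_eqI)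
      show "Psi (S \<otimes>\<^bsub>ZZ\<^esub> T) \<in> extensional (univ derived_alg)" unfolding Psi_def by simp
      show "Psi S \<otimes>\<^bsub>?H\<^esub> Psi T \<in> extensional (univ derived_alg)" by (simp add: Hom0_def)
      fix x assume x: "x \<in> derived_class"
      have "C x \<in> carrier M" "D x \<in> carrier M" "C u0 \<in> carrier M" "D u0 \<in> carrier M"
        using derivation_in[OF C(1)] derivation_in[OF D(1)] derived_class_F[OF x] u0 by auto
      then have "(C x \<oplus>\<^bsub>M\<^esub> D x) \<ominus>\<^bsub>M\<^esub> (C u0 \<oplus>\<^bsub>M\<^esub> D u0) = (C x \<ominus>\<^bsub>M\<^esub> C u0) \<oplus>\<^bsub>M\<^esub> (D x \<ominus>\<^bsub>M\<^esub> D u0)"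
        by (simp add: M.minus_eq M.minus_add M.a_ac)
      then show "Psi (S \<otimes>\<^bsub>ZZ\<^esub> T) (cl x) = (Psi S \<otimes>\<^bsub>?H\<^esub> Psi T) (cl x)"
        using Psi_cl[OF CD ST x] Psi_cl[OF C x] Psi_cl[OF D x] x by (simp add: Hom0_def derived_alg_univ)
    qed
  qed
  interpret PsiH: group_hom ZZ ?H Psi by unfold_locales (rule PsiH)
  have ker: "kernel ZZ ?H Psi = coboundaries ar Q M E"
  proof
    have one: "\<one>\<^bsub>?H\<^esub> = (\<lambda>c \<in> univ derived_alg. \<zero>\<^bsub>M\<^esub>)" by (simp add: Hom0_def)
    show "kernel ZZ ?H Psi \<subseteq> coboundaries ar Q M E"
      using coboundary_if_Psi unfolding kernel_def Z2_carrier one by auto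
    show "coboundaries ar Q M E \<subseteq> kernel ZZ ?H Psi"
      using Psi_coboundary unfolding kernel_def Z2_carrier one by auto
  qed
  have "Psi ` carrier ZZ = carrier ?H"
  proof
    show "Psi ` carrier ZZ \<subseteq> carrier ?H" using PsiH by (auto simp: hom_def)
    show "carrier ?H \<subseteq> Psi ` carrier ZZ"
    proof
      fix \<phi> assume "\<phi> \<in> carrier ?H"
      then obtain T where "T \<in> cocycles ar Q E" "\<exists>D. derivation T D" "Psi T = \<phi>" by (rule Psi_surj)
      then show "\<phi> \<in> Psi ` carrier ZZ" using Z2_carrier by blast
    qed
  qed
  from PsiH.FactGroup_iso[OF this] show "H2 ar \<U> Q M E \<cong> ?H" unfolding ker H2_def .
  show "comm_group (H2 ar \<U> Q M E)"
    unfolding H2_def ker[symmetric] by (rule Z.abelian_FactGroup[OF PsiH.subgroup_kernel])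
qed

end

section \<open>The quotient by a congruence\<close>

lemma quot_univ: "univ (quot A \<delta>) = (\<lambda>x. \<delta> `` {x}) ` univ A"
  unfolding quot_def quotient_def by auto

lemma quot_ualgebra:
  assumes A: "ualgebra ar A" and \<delta>: "\<delta> \<in> con ar A"
  shows "ualgebra ar (quot A \<delta>)"
proof -
  have "ops (quot A \<delta>) f cs \<in> univ (quot A \<delta>)" if cs: "cs \<in> tuples (univ (quot A \<delta>)) (ar f)" for f cs
  proof -
    have "\<forall>c \<in> set cs. \<exists>x. c = \<delta> `` {x} \<and> x \<in> univ A" using cs unfolding quot_univ in_tuples by auto
    then obtain g where g: "\<And>c. c \<in> set cs \<Longrightarrow> c = \<delta> `` {g c} \<and> g c \<in> univ A" by metis
    have "cs = map (\<lambda>x. \<delta> `` {x}) (map g cs)" using g by (auto intro!: map_idI[symmetric])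
    then have "ops (quot A \<delta>) f cs = \<delta> `` {ops A f (map g cs)}"
      using quot_ops[OF \<delta>, of "map g cs" f] g cs by (auto simp: in_tuples)
    moreover have "ops A f (map g cs) \<in> univ A"
      using g cs by (intro ops_closed[OF A]) (auto simp: in_tuples)
    ultimately show ?thesis unfolding quot_univ by simp
  qed
  moreover have "univ (quot A \<delta>) \<noteq> {}" using A unfolding quot_univ ualgebra_def by simp
  ultimately show ?thesis by (auto simp: ualgebra_def subuniverse_def)
qed

lemma quot_con_iff:
  assumes \<delta>: "\<delta> \<in> con ar A" and \<beta>: "\<beta> \<in> con ar A" and le: "\<delta> \<subseteq> \<beta>" and xy: "x \<in> univ A" "y \<in> univ A"
  shows "(\<delta> `` {x}, \<delta> `` {y}) \<in> quot_con \<beta> \<delta> \<longleftrightarrow> (x, y) \<in> \<beta>"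
proof
  assume "(\<delta> `` {x}, \<delta> `` {y}) \<in> quot_con \<beta> \<delta>"
  then obtain a b where e: "\<delta> `` {x} = \<delta> `` {a}" "\<delta> `` {y} = \<delta> `` {b}" and ab: "(a, b) \<in> \<beta>"
    unfolding quot_con_def by auto
  have "(x, a) \<in> \<beta>" "(y, b) \<in> \<beta>"
    using e con_Image_eq_iff[OF \<delta>] xy con_in[OF \<beta> ab] le by auto
  then show "(x, y) \<in> \<beta>" using con_trans[OF \<beta> con_trans[OF \<beta> _ ab] con_sym[OF \<beta>]] by blast
qed (auto simp: quot_con_def)

lemma quot_con_con:
  assumes \<delta>: "\<delta> \<in> con ar A" and \<beta>: "\<beta> \<in> con ar A" and le: "\<delta> \<subseteq> \<beta>"
  shows "quot_con \<beta> \<delta> \<in> con ar (quot A \<delta>)"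
proof -
  note iff = quot_con_iff[OF \<delta> \<beta> le]
  have "equiv (univ (quot A \<delta>)) (quot_con \<beta> \<delta>)"
  proof (rule equivI)
    show "quot_con \<beta> \<delta> \<subseteq> univ (quot A \<delta>) \<times> univ (quot A \<delta>)"
      using con_in[OF \<beta>] unfolding quot_univ quot_con_def by auto
    show "refl_on (univ (quot A \<delta>)) (quot_con \<beta> \<delta>)"
      unfolding refl_on_def quot_univ using iff con_refl[OF \<beta>] by auto
    show "sym (quot_con \<beta> \<delta>)"
      unfolding sym_def quot_con_def using con_sym[OF \<beta>] by auto
    show "trans (quot_con \<beta> \<delta>)"
    proof (rule transI)
      fix a b c assume ab: "(a, b) \<in> quot_con \<beta> \<delta>" and bc: "(b, c) \<in> quot_con \<beta> \<delta>"
      then obtain x y z where x: "a = \<delta> `` {x}" "b = \<delta> `` {y}" "c = \<delta> `` {z}" "(x, y) \<in> \<beta>" "z \<in> univ A"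
        using con_in[OF \<beta>] unfolding quot_con_def by auto
      then have "(y, z) \<in> \<beta>" using bc iff[of y z] con_in[OF \<beta> x(4)] by simp
      then show "(a, c) \<in> quot_con \<beta> \<delta>"
        using con_trans[OF \<beta> x(4)] unfolding x quot_con_def by auto
    qed
  qed
  moreover have "(ops (quot A \<delta>) f cs, ops (quot A \<delta>) f ds) \<in> quot_con \<beta> \<delta>"
    if cs: "cs \<in> tuples (univ (quot A \<delta>)) (ar f)" and r: "list_all2 (\<lambda>x y. (x, y) \<in> quot_con \<beta> \<delta>) cs ds" for f cs ds
  proof -
    have len: "length cs = ar f" "length ds = ar f" using cs r by (auto simp: in_tuples list_all2_conv_all_nth)
    \<comment> \<open>Lifts are chosen by position, not by element: a class may occur in
      \<open>cs\<close> several times with different partners in \<open>ds\<close>.\<close>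
    have "\<exists>q. i < ar f \<longrightarrow> cs ! i = \<delta> `` {fst q} \<and> ds ! i = \<delta> `` {snd q} \<and> q \<in> \<beta>" for i
      using r len unfolding list_all2_conv_all_nth quot_con_def by auto
    then obtain q where q: "\<And>i. i < ar f \<longrightarrow> cs ! i = \<delta> `` {fst (q i)} \<and> ds ! i = \<delta> `` {snd (q i)} \<and> q i \<in> \<beta>"
      using choice[of "\<lambda>i q. i < ar f \<longrightarrow> cs ! i = \<delta> `` {fst q} \<and> ds ! i = \<delta> `` {snd q} \<and> q \<in> \<beta>"] by auto
    define g h where "g = (\<lambda>i. fst (q i))" and "h = (\<lambda>i. snd (q i))"
    have gh: "cs ! i = \<delta> `` {g i} \<and> ds ! i = \<delta> `` {h i} \<and> (g i, h i) \<in> \<beta>" if "i < ar f" for i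
      using q that unfolding g_def h_def by simp
    have c: "cs = map (\<lambda>x. \<delta> `` {x}) (map g [0..<ar f])" and d: "ds = map (\<lambda>x. \<delta> `` {x}) (map h [0..<ar f])"
      using gh len by (auto intro!: nth_equalityI)
    have u: "g i \<in> univ A" "h i \<in> univ A" if "i < ar f" for i using gh[OF that] con_in[OF \<beta>] by auto
    have "ops (quot A \<delta>) f cs = \<delta> `` {ops A f (map g [0..<ar f])}"
      unfolding c by (rule quot_ops[OF \<delta>]) (use u in auto)
    moreover have "ops (quot A \<delta>) f ds = \<delta> `` {ops A f (map h [0..<ar f])}"
      unfolding d by (rule quot_ops[OF \<delta>]) (use u in auto)
    moreover have "(ops A f (map g [0..<ar f]), ops A f (map h [0..<ar f])) \<in> \<beta>"
      by (rule con_ops_map[OF \<beta>]) (use gh in auto)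
    ultimately show ?thesis unfolding quot_con_def by auto
  qed
  ultimately show ?thesis unfolding con_def by simp
qed

text \<open>What holds in \<open>F\<close> modulo \<delta> becomes an equation in the quotient;
  \<open>m2_con\<close> and \<open>m_commutes\<close> for \<theta> give the two laws of
  \<open>m\<close>.\<close>

lemma (in free_presentation) central_class_quot:
  assumes idem: "idempotent_elem ar (quot F \<delta>) (cl u0)"
  shows "central_class ar m (quot F \<delta>) (quot_con \<theta> \<delta>) (cl u0)"
proof
  show "ualgebra ar (quot F \<delta>)" by (rule quot_ualgebra[OF F \<delta>_con])
  show "quot_con \<theta> \<delta> \<in> con ar (quot F \<delta>)" by (rule quot_con_con[OF \<delta>_con \<theta>_con \<delta>_le_\<theta>])
  have m_cl: "ops (quot F \<delta>) m [cl x, cl y, cl z] = cl (ops F m [x, y, z])"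
    if "x \<in> univ F" "y \<in> univ F" "z \<in> univ F" for x y z
    using quot_ops[OF \<delta>_con, of "[x, y, z]" m] that by (auto simp: ar_m)
  show "ops (quot F \<delta>) m [c, c, d] = d" if "c \<in> univ (quot F \<delta>)" "d \<in> univ (quot F \<delta>)" for c d
    using that m_cl m1 unfolding quot_univ by auto
  show "ops (quot F \<delta>) m [c, d, d] = c" if cd: "(c, d) \<in> quot_con \<theta> \<delta>" for c d
  proof -
    obtain x y where x: "c = cl x" "d = cl y" "(x, y) \<in> \<theta>" using cd unfolding quot_con_def by auto
    have u: "x \<in> univ F" "y \<in> univ F" using con_in[OF \<theta>_con x(3)] by auto
    show ?thesis using m_cl u cl_eq_iff[OF m_in[OF u u(2)] u(1)] m2_con[OF \<theta>_con x(3)] unfolding x by simp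
  qed
  fix f ps assume ps: "ps \<in> tuples (quot_con \<theta> \<delta>) (ar f)"
  \<comment> \<open>Both entries of a pair are lifted together, so that the lifts are
    \<theta>-related.\<close>
  have "\<forall>q \<in> set ps. \<exists>r. q = (cl (fst r), cl (snd r)) \<and> r \<in> \<theta>"
    using ps unfolding in_tuples quot_con_def by fastforce
  then obtain r where r: "\<forall>q \<in> set ps. q = (cl (fst (r q)), cl (snd (r q))) \<and> r q \<in> \<theta>"
    using bchoice[of "set ps" "\<lambda>q r. q = (cl (fst r), cl (snd r)) \<and> r \<in> \<theta>"] by auto
  define g h where "g = (\<lambda>q. fst (r q))" and "h = (\<lambda>q. snd (r q))"
  have gh: "q = (cl (g q), cl (h q)) \<and> (g q, h q) \<in> \<theta>" if "q \<in> set ps" for q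
    using r that unfolding g_def h_def by simp
  then have g: "fst q = cl (g q)" and h: "snd q = cl (h q)" if "q \<in> set ps" for q
    using that by (metis fst_conv, metis snd_conv)
  have u: "g q \<in> univ F" "h q \<in> univ F" if "q \<in> set ps" for q using gh[OF that] con_in[OF \<theta>_con, of "g q" "h q"] by auto
  have len: "length ps = ar f" using ps by (simp add: in_tuples)
  have map_cl: "ops (quot F \<delta>) f (map (\<lambda>q. cl (k q)) ps) = cl (ops F f (map k ps))"
    and kF: "ops F f (map k ps) \<in> univ F" if "\<And>q. q \<in> set ps \<Longrightarrow> k q \<in> univ F" for k
  proof -
    have s: "\<And>x. x \<in> set (map k ps) \<Longrightarrow> x \<in> univ F" using that by auto
    show "ops (quot F \<delta>) f (map (\<lambda>q. cl (k q)) ps) = cl (ops F f (map k ps))"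
      using quot_ops[OF \<delta>_con, of "map k ps" f, OF _ s] len by (simp add: comp_def)
    show "ops F f (map k ps) \<in> univ F" by (rule F_ops) (use s len in \<open>simp add: in_tuples\<close>)
  qed
  have "map (\<lambda>(x, y). ops (quot F \<delta>) m [x, y, cl u0]) ps = map (\<lambda>q. cl (ops F m [g q, h q, u0])) ps"
    by (rule map_cong[OF refl]) (simp add: case_prod_unfold g h m_cl u u0)
  then have "ops (quot F \<delta>) f (map (\<lambda>(x, y). ops (quot F \<delta>) m [x, y, cl u0]) ps)
      = cl (ops F f (map (\<lambda>q. ops F m [g q, h q, u0]) ps))"
    using map_cl[of "\<lambda>q. ops F m [g q, h q, u0]"] m_in u u0 by (simp del: map_eq_conv)
  also have "\<dots> = cl (ops F m [ops F f (map g ps), ops F f (map h ps), u0])"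
  proof (subst cl_eq_iff)
    have "(ops F f (map (\<lambda>q. ops F m [g q, h q, u0]) ps),
        ops F m [ops F f (map g ps), ops F f (map h ps), ops F f (map (\<lambda>q. u0) ps)]) \<in> \<delta>"
      by (rule m_commutes[OF \<theta>_con len]) (use gh u0 in blast)+
    \<comment> \<open>The constant tuple \<open>u0\<close> is sent to \<open>u0\<close> modulo
      \<delta>, which is enough below the quotient map.\<close>
    moreover have "(ops F m [ops F f (map g ps), ops F f (map h ps), ops F f (map (\<lambda>q. u0) ps)],
        ops F m [ops F f (map g ps), ops F f (map h ps), u0]) \<in> \<delta>"
      by (rule m_con[OF \<delta>_con con_refl[OF \<delta>_con kF] con_refl[OF \<delta>_con kF] u0_ops[OF len]]) (use u in auto)
    ultimately show "(ops F f (map (\<lambda>q. ops F m [g q, h q, u0]) ps),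
        ops F m [ops F f (map g ps), ops F f (map h ps), u0]) \<in> \<delta>"
      by (rule con_trans[OF \<delta>_con])
  qed (use kF m_in u u0 in auto)
  also have "\<dots> = ops (quot F \<delta>) m [cl (ops F f (map g ps)), cl (ops F f (map h ps)), cl u0]"
    by (rule m_cl[symmetric]) (use kF u u0 in auto)
  also have "cl (ops F f (map g ps)) = ops (quot F \<delta>) f (map fst ps)"
  proof -
    have "map fst ps = map (\<lambda>q. cl (g q)) ps" by (rule map_cong[OF refl]) (rule g)
    then show ?thesis using map_cl[of g] u by (simp del: map_eq_conv)
  qed
  also have "cl (ops F f (map h ps)) = ops (quot F \<delta>) f (map snd ps)"
  proof -
    have "map snd ps = map (\<lambda>q. cl (h q)) ps" by (rule map_cong[OF refl]) (rule h)
    then show ?thesis using map_cl[of h] u by (simp del: map_eq_conv)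
  qed
  finally show "ops (quot F \<delta>) f (map (\<lambda>(x, y). ops (quot F \<delta>) m [x, y, cl u0]) ps) =
      ops (quot F \<delta>) m [ops (quot F \<delta>) f (map fst ps), ops (quot F \<delta>) f (map snd ps), cl u0]" .
qed (use ar_m idem in auto)

theorem theorem5p11:
  fixes ar :: "'f \<Rightarrow> nat" and m :: 'f
    and \<U> :: "('f, 'u) alg set"
    and Q E F :: "('f, 'u) alg"
    and R :: "'r ring" and M :: "('r, 'u) module"
    and \<theta> :: "('u \<times> 'u) set" and u :: "'u set"
  defines "A \<equiv> quot F (commutator ar F \<theta> (one_con F))"
    and "\<alpha> \<equiv> quot_con \<theta> (commutator ar F \<theta> (one_con F))"
    and "\<gamma> \<equiv> quot_con (\<theta> \<inter> commutator ar F (one_con F) (one_con F))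
                    (commutator ar F \<theta> (one_con F))"
  assumes large: "infinite (UNIV :: 'u set)" "\<exists>\<iota> :: 'f \<Rightarrow> 'u. inj \<iota>"
    and "variety ar \<U>" and "difference_term ar \<U> m"
    and "regular_datum ar \<U> m Q R M E"
    and "free_algebra ar \<U> F" and "\<theta> \<in> con ar F" and "alg_iso ar (quot F \<theta>) Q"
    and "idempotent_elem ar A u"
  shows "comm_group (H2 ar \<U> Q M E) \<and>
    comm_group (Hom0 ar (kappa_image ar A \<alpha> \<gamma>) (diag_class ar A \<alpha>) M E) \<and>
    comm_group (Hom0 ar (class_alg A \<gamma> u) u M E) \<and>
    H2 ar \<U> Q M E \<cong> Hom0 ar (kappa_image ar A \<alpha> \<gamma>) (diag_class ar A \<alpha>) M E \<and>
    Hom0 ar (kappa_image ar A \<alpha> \<gamma>) (diag_class ar A \<alpha>) M E \<cong> Hom0 ar (class_alg A \<gamma> u) u M E"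
proof -
  have E: "kernel_algebra ar m R M E" and EU: "E \<in> \<U>" and QU: "Q \<in> \<U>" and RD1: "RD1 ar \<U> m E"
    using \<open>regular_datum ar \<U> m Q R M E\<close> unfolding regular_datum_def central_datum_def by auto
  have FU: "F \<in> \<U>" using \<open>free_algebra ar \<U> F\<close> unfolding free_algebra_def by simp
  note Fa = variety_ualgebra[OF \<open>variety ar \<U>\<close> FU] and Qa = variety_ualgebra[OF \<open>variety ar \<U>\<close> QU]
  note \<theta> = \<open>\<theta> \<in> con ar F\<close>
  obtain \<phi> where \<phi>: "\<phi> \<in> alg_hom ar (quot F \<theta>) Q" and bij: "bij_betw \<phi> (univ (quot F \<theta>)) (univ Q)"
    using \<open>alg_iso ar (quot F \<theta>) Q\<close> unfolding alg_iso_def by blast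
  \<comment> \<open>The quotient map followed by the given isomorphism. Its kernel is \<theta>, so
    the notions defined from \<open>p\<close> are those of the statement.\<close>
  define p where "p = (\<lambda>x. \<phi> (\<theta> `` {x}))"
  have left: "left_module R M" using E unfolding kernel_algebra_def by simp
  have p_hom: "p (ops F f xs) = ops Q f (map p xs)" if xs: "xs \<in> tuples (univ F) (ar f)" for f xs
  proof -
    have "map (\<lambda>x. \<theta> `` {x}) xs \<in> tuples (univ (quot F \<theta>)) (ar f)"
      using xs by (auto simp: in_tuples quot_univ)
    then have "\<phi> (ops (quot F \<theta>) f (map (\<lambda>x. \<theta> `` {x}) xs)) = ops Q f (map \<phi> (map (\<lambda>x. \<theta> `` {x}) xs))"
      using \<phi> unfolding alg_hom_def by simp
    then show ?thesis
      using quot_ops[OF \<theta>, of xs f] xs by (simp add: p_def comp_def in_tuples)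
  qed
  have "\<phi> ` univ (quot F \<theta>) = univ Q" using bij by (rule bij_betw_imp_surj_on)
  then have p_im: "p ` univ F = univ Q" unfolding quot_univ p_def image_image .
  have ker: "hom_ker F p = \<theta>"
  proof -
    have "p x = p y \<longleftrightarrow> (x, y) \<in> \<theta>" if "x \<in> univ F" "y \<in> univ F" for x y
      using inj_on_eq_iff[OF bij_betw_imp_inj_on[OF bij], of "\<theta> `` {x}" "\<theta> `` {y}"]
        con_Image_eq_iff[OF \<theta> that] that by (simp add: p_def quot_univ)
    then show ?thesis using con_in[OF \<theta>] unfolding hom_ker_def by auto
  qed
  let ?\<delta> = "commutator ar F \<theta> (one_con F)"
  have \<theta>1: "\<theta> \<subseteq> one_con F" using con_in[OF \<theta>] unfolding one_con_def by auto
  note \<delta> = commutator_con[OF Fa \<theta>1 order_refl]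
  have "u \<in> univ (quot F ?\<delta>)" using \<open>idempotent_elem ar A u\<close> unfolding A_def idempotent_elem_def by simp
  \<comment> \<open>The idempotent \<open>u\<close> is a class; it is replaced by a representative
    in \<open>F\<close>.\<close>
  then obtain u0 where u0: "u0 \<in> univ F" and u: "u = ?\<delta> `` {u0}" unfolding quot_univ by auto
  have u0_idem: "(ops F f (replicate (ar f) u0), u0) \<in> ?\<delta>" for f
  proof -
    have r: "ops F f (replicate (ar f) u0) \<in> univ F" using u0 by (intro ops_closed[OF Fa]) auto
    have "ops (quot F ?\<delta>) f (replicate (ar f) u) = u"
      using \<open>idempotent_elem ar A u\<close> unfolding A_def idempotent_elem_def by simp
    then have "?\<delta> `` {ops F f (replicate (ar f) u0)} = ?\<delta> `` {u0}"
      using quot_ops[OF \<delta>, of "replicate (ar f) u0" f] u0 unfolding u by (simp add: map_replicate)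
    then show ?thesis using con_Image_eq_iff[OF \<delta> r u0] by simp
  qed
  interpret left_module R M by (rule left)
  interpret free_presentation R M ar m E F Q p \<U> u0
  proof
    show "(ops F f (replicate (ar f) u0), u0) \<in> commutator ar F (hom_ker F p) (one_con F)" for f
      unfolding ker by (rule u0_idem)
    show "p x \<in> univ Q" if "x \<in> univ F" for x using that p_im by auto
    show "\<exists>x \<in> univ F. p x = q" if "q \<in> univ Q" for q using that unfolding p_im[symmetric] by auto
  qed (fact E Fa Qa p_hom u0 EU QU RD1 large(1) \<open>variety ar \<U>\<close> \<open>difference_term ar \<U> m\<close>
        \<open>free_algebra ar \<U> F\<close>)+
  have eqs: "A = quot F (commutator ar F (hom_ker F p) (one_con F))"
    "\<alpha> = quot_con (hom_ker F p) (commutator ar F (hom_ker F p) (one_con F))"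
    "\<gamma> = quot_con (hom_ker F p \<inter> commutator ar F (one_con F) (one_con F))
      (commutator ar F (hom_ker F p) (one_con F))"
    "u = commutator ar F (hom_ker F p) (one_con F) `` {u0}"
    unfolding A_def \<alpha>_def \<gamma>_def u ker by (rule refl)+
  interpret c: central_class ar m A \<alpha> u
    unfolding eqs(1,2,4)
    by (rule central_class_quot[OF \<open>idempotent_elem ar A u\<close>[unfolded eqs(1,4)]])
  have \<gamma>: "\<gamma> \<in> con ar A" "\<gamma> \<subseteq> \<alpha>"
    unfolding eqs
    by (rule quot_con_con[OF \<delta>_con con_Int[OF \<theta>_con \<epsilon>_con] Int_greatest[OF \<delta>_le_\<theta> \<delta>_le_\<epsilon>]])
      (auto simp: quot_con_def)
  have K: "comm_group (Hom0 ar (kappa_image ar A \<alpha> \<gamma>) (diag_class ar A \<alpha>) M E)"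
    by (rule Hom0_comm_group[OF c.kappa_image_ualgebra[OF \<gamma>]])
  have I: "comm_group (Hom0 ar (class_alg A \<gamma> u) u M E)"
    unfolding eqs by (rule Hom0_comm_group[OF derived_alg_ualgebra cl_u0_in])
  have KI: "Hom0 ar (kappa_image ar A \<alpha> \<gamma>) (diag_class ar A \<alpha>) M E \<cong> Hom0 ar (class_alg A \<gamma> u) u M E"
    by (rule c.Hom0_kappa_image[OF \<gamma>])
  have HI: "H2 ar \<U> Q M E \<cong> Hom0 ar (class_alg A \<gamma> u) u M E"
    using H2_iso(2) unfolding eqs .
  \<comment> \<open>The cohomology was computed on the class of \<open>u\<close>; the kernel algebra
    is reached by going back along the second isomorphism.\<close>
  have "H2 ar \<U> Q M E \<cong> Hom0 ar (kappa_image ar A \<alpha> \<gamma>) (diag_class ar A \<alpha>) M E"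
    by (rule iso_trans[OF HI group.iso_sym[OF comm_group.axioms(2)[OF K] KI]])
  then show ?thesis using H2_iso(1) K I KI by (intro conjI)
qed

end
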